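(* Let $G$ be a countable (discrete) amenable group acting continuously on a compact metrizable space $X$, and let $\Sigma$ be a sofic approximation sequence for $G$. Then $$\mathrm{mdim}_{\Sigma,\mathrm M}(X,\rho)=\mathrm{mdim}_{\mathrm M}(X,\rho)$$ for every continuous pseudometric $\rho$ on $X$. In particular, $\mathrm{mdim}_{\Sigma,\mathrm M}(X)=\mathrm{mdim}_{\mathrm M}(X)$.
   Context: Sofic approximations. For $d\in\mathbb N$ write $[d]=\{1,\dots,d\}$ and $\mathrm{Sym}(d)$ for the permutation group of $[d]$. A sofic approximation sequence for a countable group $G$ is a sequence of maps $\Sigma=\{\sigma_i:G\to\mathrm{Sym}(d_i)\}_{i=1}^\infty$ such that: (1) for all $s,t\in G$, $\lim_i |\{a\in[d_i]:\sigma_i(s)\sigma_i(t)(a)=\sigma_i(st)(a)\}|/d_i=1$; (2) for all distinct $s,t\in G$, $\lim_i|\{a\in[d_i]:\sigma_i(s)(a)=\sigma_i(t)(a)\}|/d_i=0$; (3) $\lim_i d_i=+\infty$. $G$ is sofic if it has such a sequence (countable amenable groups are sofic). We write $\sigma_s=\sigma(s)$. Map spaces. Let $G$ act continuously on a compact metrizable space $X$ by $\alpha$, and let $\rho$ be a continuous pseudometric on $X$. For maps $\varphi,\psi:[d]\to X$ put $\rho_2(\varphi,\psi)=\big(\frac1d\sum_{a\in[d]}\rho(\varphi(a),\psi(a))^2\big)^{1/2}$ and $\rho_\infty(\varphi,\psi)=\max_{a\in[d]}\rho(\varphi(a),\psi(a))$. For a nonempty finite $F\subseteq G$, $\delta>0$,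 and a map $\sigma:G\to\mathrm{Sym}(d)$, $\mathrm{Map}(\rho,F,\delta,\sigma)$ is the set of all $\varphi:[d]\to X$ with $\rho_2(\varphi\circ\sigma_s,\alpha_s\circ\varphi)\le\delta$ for all $s\in F$. Sofic metric mean dimension. For a pseudometric space $(Y,\rho)$ and $\varepsilon>0$, a subset $Z\subseteq Y$ is $(\rho,\varepsilon)$-separated if $\rho(y,z)\ge\varepsilon$ for all distinct $y,z\in Z$; $N_\varepsilon(Y,\rho)$ is the maximal cardinality of $(\rho,\varepsilon)$-separated subsets of $Y$. Put $h^\varepsilon_{\Sigma,\infty}(\rho,F,\delta)=\varlimsup_{i\to\infty}\frac1{d_i}\log N_\varepsilon(\mathrm{Map}(\rho,F,\delta,\sigma_i),\rho_\infty)$, set to $-\infty$ if $\mathrm{Map}(\rho,F,\delta,\sigma_i)$ is empty for all sufficiently large $i$; $h^\varepsilon_{\Sigma,\infty}(\rho)=\inf_F\inf_{\delta>0}h^\varepsilon_{\Sigma,\infty}(\rho,F,\delta)$ over nonempty finite $F\subseteq G$ and $\delta>0$; $\mathrm{mdim}_{\Sigma,\mathrm M}(X,\rho)=\varliminf_{\varepsilon\to0}\frac{1}{|\log\varepsilon|}h^\varepsilon_{\Sigma,\infty}(\rho)$; and $\mathrm{mdim}_{\Sigma,\mathrm M}(X)=\inf_\rho\mathrm{mdim}_{\Sigma,\mathrm M}(X,\rho)$ over compatible metrics $\rho$ on $X$. Amenable case. A countable group $G$ is amenable if for every finite $K\subseteq G$ and $\varepsilon>0$ there is a nonempty finite $F\subseteq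 G$ with $|KF\setminus F|<\varepsilon|F|$. For a continuous pseudometric $\rho$ and nonempty finite $F\subseteq G$, put $\rho_F(x,y)=\max_{s\in F}\rho(sx,sy)$; for a finite open cover $\mathcal U$ put $\mathrm{mesh}(\mathcal U,\rho)=\max_{U\in\mathcal U}\mathrm{diam}(U,\rho)$. By the Ornstein–Weiss lemma, $\frac{1}{|F|}\log\min\{|\mathcal U|:\mathrm{mesh}(\mathcal U,\rho_F)<\varepsilon\}$ (over finite open covers $\mathcal U$ of $X$) converges to a real number $S(X,\varepsilon,\rho)$ as $F$ becomes more and more left invariant (i.e. for each $\theta>0$ there are nonempty finite $K\subseteq G$ and $\delta>0$ such that the quantity is within $\theta$ of $S(X,\varepsilon,\rho)$ whenever $|KF\setminus F|<\delta|F|$). Then $\mathrm{mdim}_{\mathrm M}(X,\rho)=\varliminf_{\varepsilon\to0}\frac{S(X,\varepsilon,\rho)}{|\log\varepsilon|}$, and $\mathrm{mdim}_{\mathrm M}(X)=\inf_\rho\mathrm{mdim}_{\mathrm M}(X,\rho)$ over compatible metrics $\rho$ on $X$. *)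

theory Defs
  imports
    "HOL-Analysis.Analysis"
    "HOL-Combinatorics.Permutations"
    "HOL-Algebra.Group_Action"
begin

section \<open>Groups, actions and pseudometrics\<close>

definition amenable_group :: "('g, 'm) monoid_scheme \<Rightarrow> bool" where
  "amenable_group G \<longleftrightarrow> group G \<and> countable (carrier G) \<and>
     (\<forall>K \<epsilon>. finite K \<and> K \<subseteq> carrier G \<and> (\<epsilon>::real) > 0 \<longrightarrow>
        (\<exists>F. finite F \<and> F \<noteq> {} \<and> F \<subseteq> carrier G \<and>
             real (card ((K <#>\<^bsub>G\<^esub> F) - F)) < \<epsilon> * real (card F)))"

text \<open>The group is discrete, so joint continuity of the action amounts to continuity of each
  \<^term>\<open>\<alpha> s\<close>.\<close>

definition continuous_action ::
    "('g, 'm) monoid_scheme \<Rightarrow> 'x topology \<Rightarrow> ('g \<Rightarrow> 'x \<Rightarrow> 'x) \<Rightarrow> bool" where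
  "continuous_action G X \<alpha> \<longleftrightarrow>
     group_action G (topspace X) \<alpha> \<and> (\<forall>s\<in>carrier G. continuous_map X X (\<alpha> s))"

definition continuous_pseudometric :: "'x topology \<Rightarrow> ('x \<Rightarrow> 'x \<Rightarrow> real) \<Rightarrow> bool" where
  "continuous_pseudometric X \<rho> \<longleftrightarrow>
     (\<forall>x\<in>topspace X. \<forall>y\<in>topspace X. 0 \<le> \<rho> x y) \<and>
     (\<forall>x\<in>topspace X. \<rho> x x = 0) \<and>
     (\<forall>x\<in>topspace X. \<forall>y\<in>topspace X. \<rho> x y = \<rho> y x) \<and>
     (\<forall>x\<in>topspace X. \<forall>y\<in>topspace X. \<forall>z\<in>topspace X. \<rho> x z \<le> \<rho> x y + \<rho> y z) \<and>
     continuous_map (prod_topology X X) euclideanreal (\<lambda>(x, y). \<rho> x y)"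

definition compatible_metric :: "'x topology \<Rightarrow> ('x \<Rightarrow> 'x \<Rightarrow> real) \<Rightarrow> bool" where
  "compatible_metric X \<rho> \<longleftrightarrow>
     Metric_space (topspace X) \<rho> \<and> Metric_space.mtopology (topspace X) \<rho> = X"

text \<open>Logarithm of a cardinality, with the conventions \<open>log 0 = -\<infinity>\<close> and \<open>log \<infinity> = \<infinity>\<close>.\<close>

definition log_card :: "enat \<Rightarrow> ereal" where
  "log_card n =
     (case n of enat k \<Rightarrow> (if k = 0 then -\<infinity> else ereal (ln (real k))) | \<infinity> \<Rightarrow> \<infinity>)"

section \<open>Sofic metric mean dimension\<close>

definition sofic_approximation ::
    "('g, 'm) monoid_scheme \<Rightarrow> (nat \<Rightarrow> nat) \<Rightarrow> (nat \<Rightarrow> 'g \<Rightarrow> nat \<Rightarrow> nat) \<Rightarrow> bool" where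
  "sofic_approximation G d \<sigma> \<longleftrightarrow>
     (\<forall>i. \<forall>s\<in>carrier G. \<sigma> i s permutes {1..d i}) \<and>
     (\<forall>s\<in>carrier G. \<forall>t\<in>carrier G.
        (\<lambda>i. real (card {a\<in>{1..d i}. \<sigma> i s (\<sigma> i t a) = \<sigma> i (s \<otimes>\<^bsub>G\<^esub> t) a}) / real (d i))
          \<longlonglongrightarrow> 1) \<and>
     (\<forall>s\<in>carrier G. \<forall>t\<in>carrier G. s \<noteq> t \<longrightarrow>
        (\<lambda>i. real (card {a\<in>{1..d i}. \<sigma> i s a = \<sigma> i t a}) / real (d i)) \<longlonglongrightarrow> 0) \<and>
     filterlim d at_top sequentially"

definition rho2 :: "('x \<Rightarrow> 'x \<Rightarrow> real) \<Rightarrow> nat \<Rightarrow> (nat \<Rightarrow> 'x) \<Rightarrow> (nat \<Rightarrow> 'x) \<Rightarrow> real" where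
  "rho2 \<rho> d \<phi> \<psi> = sqrt (1 / real d * (\<Sum>a\<in>{1..d}. (\<rho> (\<phi> a) (\<psi> a))\<^sup>2))"

definition rho_inf :: "('x \<Rightarrow> 'x \<Rightarrow> real) \<Rightarrow> nat \<Rightarrow> (nat \<Rightarrow> 'x) \<Rightarrow> (nat \<Rightarrow> 'x) \<Rightarrow> real" where
  "rho_inf \<rho> d \<phi> \<psi> = Max ((\<lambda>a. \<rho> (\<phi> a) (\<psi> a)) ` {1..d})"

definition Map_space ::
    "'x topology \<Rightarrow> ('g \<Rightarrow> 'x \<Rightarrow> 'x) \<Rightarrow> ('x \<Rightarrow> 'x \<Rightarrow> real) \<Rightarrow> 'g set \<Rightarrow> real \<Rightarrow> nat \<Rightarrow>
     ('g \<Rightarrow> nat \<Rightarrow> nat) \<Rightarrow> (nat \<Rightarrow> 'x) set" where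
  "Map_space X \<alpha> \<rho> F \<delta> d \<sigma> =
     {\<phi> \<in> {1..d} \<rightarrow>\<^sub>E topspace X. \<forall>s\<in>F. rho2 \<rho> d (\<phi> \<circ> \<sigma> s) (\<alpha> s \<circ> \<phi>) \<le> \<delta>}"

definition separated_set :: "('y \<Rightarrow> 'y \<Rightarrow> real) \<Rightarrow> real \<Rightarrow> 'y set \<Rightarrow> bool" where
  "separated_set \<rho> \<epsilon> Z \<longleftrightarrow> (\<forall>y\<in>Z. \<forall>z\<in>Z. y \<noteq> z \<longrightarrow> \<rho> y z \<ge> \<epsilon>)"

definition sep_number :: "'y set \<Rightarrow> ('y \<Rightarrow> 'y \<Rightarrow> real) \<Rightarrow> real \<Rightarrow> enat" where
  "sep_number Y \<rho> \<epsilon> = (SUP Z\<in>{Z. Z \<subseteq> Y \<and> finite Z \<and> separated_set \<rho> \<epsilon> Z}. enat (card Z))"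

text \<open>If the map spaces are eventually empty then the terms are eventually \<open>log 0 = -\<infinity>\<close>, and so
  is the upper limit.\<close>

definition sofic_h_loc ::
    "'x topology \<Rightarrow> ('g \<Rightarrow> 'x \<Rightarrow> 'x) \<Rightarrow> (nat \<Rightarrow> nat) \<Rightarrow> (nat \<Rightarrow> 'g \<Rightarrow> nat \<Rightarrow> nat) \<Rightarrow>
     real \<Rightarrow> ('x \<Rightarrow> 'x \<Rightarrow> real) \<Rightarrow> 'g set \<Rightarrow> real \<Rightarrow> ereal" where
  "sofic_h_loc X \<alpha> d \<sigma> \<epsilon> \<rho> F \<delta> =
     limsup (\<lambda>i. log_card (sep_number (Map_space X \<alpha> \<rho> F \<delta> (d i) (\<sigma> i)) (rho_inf \<rho> (d i)) \<epsilon>)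
                   / ereal (real (d i)))"

definition sofic_h ::
    "('g, 'm) monoid_scheme \<Rightarrow> 'x topology \<Rightarrow> ('g \<Rightarrow> 'x \<Rightarrow> 'x) \<Rightarrow> (nat \<Rightarrow> nat) \<Rightarrow>
     (nat \<Rightarrow> 'g \<Rightarrow> nat \<Rightarrow> nat) \<Rightarrow> real \<Rightarrow> ('x \<Rightarrow> 'x \<Rightarrow> real) \<Rightarrow> ereal" where
  "sofic_h G X \<alpha> d \<sigma> \<epsilon> \<rho> =
     (INF F\<in>{F. finite F \<and> F \<noteq> {} \<and> F \<subseteq> carrier G}. INF \<delta>\<in>{0<..}. sofic_h_loc X \<alpha> d \<sigma> \<epsilon> \<rho> F \<delta>)"

definition sofic_mdim_metric ::
    "('g, 'm) monoid_scheme \<Rightarrow> 'x topology \<Rightarrow> ('g \<Rightarrow> 'x \<Rightarrow> 'x) \<Rightarrow> (nat \<Rightarrow> nat) \<Rightarrow>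
     (nat \<Rightarrow> 'g \<Rightarrow> nat \<Rightarrow> nat) \<Rightarrow> ('x \<Rightarrow> 'x \<Rightarrow> real) \<Rightarrow> ereal" where
  "sofic_mdim_metric G X \<alpha> d \<sigma> \<rho> =
     Liminf (at_right 0) (\<lambda>\<epsilon>. sofic_h G X \<alpha> d \<sigma> \<epsilon> \<rho> / ereal \<bar>ln \<epsilon>\<bar>)"

definition sofic_mdim ::
    "('g, 'm) monoid_scheme \<Rightarrow> 'x topology \<Rightarrow> ('g \<Rightarrow> 'x \<Rightarrow> 'x) \<Rightarrow> (nat \<Rightarrow> nat) \<Rightarrow>
     (nat \<Rightarrow> 'g \<Rightarrow> nat \<Rightarrow> nat) \<Rightarrow> ereal" where
  "sofic_mdim G X \<alpha> d \<sigma> = (INF \<rho>\<in>{\<rho>. compatible_metric X \<rho>}. sofic_mdim_metric G X \<alpha> d \<sigma> \<rho>)"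

section \<open>Metric mean dimension for amenable groups\<close>

definition rho_set ::
    "('g \<Rightarrow> 'x \<Rightarrow> 'x) \<Rightarrow> ('x \<Rightarrow> 'x \<Rightarrow> real) \<Rightarrow> 'g set \<Rightarrow> 'x \<Rightarrow> 'x \<Rightarrow> real" where
  "rho_set \<alpha> \<rho> F x y = Max ((\<lambda>s. \<rho> (\<alpha> s x) (\<alpha> s y)) ` F)"

definition pdiam :: "('x \<Rightarrow> 'x \<Rightarrow> real) \<Rightarrow> 'x set \<Rightarrow> real" where
  "pdiam \<rho> U = (if U = {} then 0 else SUP (x, y)\<in>U \<times> U. \<rho> x y)"

definition mesh :: "'x set set \<Rightarrow> ('x \<Rightarrow> 'x \<Rightarrow> real) \<Rightarrow> real" where
  "mesh \<U> \<rho> = (if \<U> = {} then 0 else Max (pdiam \<rho> ` \<U>))"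

definition finite_open_cover :: "'x topology \<Rightarrow> 'x set set \<Rightarrow> bool" where
  "finite_open_cover X \<U> \<longleftrightarrow> finite \<U> \<and> (\<forall>U\<in>\<U>. openin X U) \<and> \<Union>\<U> = topspace X"

definition min_cover :: "'x topology \<Rightarrow> ('x \<Rightarrow> 'x \<Rightarrow> real) \<Rightarrow> real \<Rightarrow> nat" where
  "min_cover X \<rho> \<epsilon> = (LEAST n. \<exists>\<U>. finite_open_cover X \<U> \<and> mesh \<U> \<rho> < \<epsilon> \<and> card \<U> = n)"

text \<open>The filter on nonempty finite subsets \<open>F\<close> of the group along which ``\<open>F\<close> becomes more and
  more left invariant''.\<close>

definition left_invariant_sets ::
    "('g, 'm) monoid_scheme \<Rightarrow> 'g set \<Rightarrow> real \<Rightarrow> 'g set set" where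
  "left_invariant_sets G K \<delta> =
     {F. finite F \<and> F \<noteq> {} \<and> F \<subseteq> carrier G \<and>
         real (card ((K <#>\<^bsub>G\<^esub> F) - F)) < \<delta> * real (card F)}"

definition left_invariance :: "('g, 'm) monoid_scheme \<Rightarrow> 'g set filter" where
  "left_invariance G =
     (INF (K, \<delta>)\<in>{K. finite K \<and> K \<noteq> {} \<and> K \<subseteq> carrier G} \<times> {0<..}.
        principal (left_invariant_sets G K \<delta>))"

lemma eventually_left_invariance:
  assumes "group G"
  shows "eventually P (left_invariance G) \<longleftrightarrow>
    (\<exists>K \<delta>. finite K \<and> K \<noteq> {} \<and> K \<subseteq> carrier G \<and> \<delta> > 0 \<and>
       (\<forall>F. finite F \<and> F \<noteq> {} \<and> F \<subseteq> carrier G \<and>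
            real (card ((K <#>\<^bsub>G\<^esub> F) - F)) < \<delta> * real (card F) \<longrightarrow> P F))"
proof -
  interpret group G by fact
  let ?I = "{K. finite K \<and> K \<noteq> {} \<and> K \<subseteq> carrier G} \<times> {0<..} :: ('a set \<times> real) set"
  let ?A = "\<lambda>(K, \<delta>). principal (left_invariant_sets G K \<delta>)"
  have mono: "left_invariant_sets G K \<delta> \<subseteq> left_invariant_sets G K' \<delta>'"
    if "K' \<subseteq> K" "\<delta> \<le> \<delta>'" "finite K" for K K' \<delta> \<delta>'
  proof
    fix F assume F: "F \<in> left_invariant_sets G K \<delta>"
    have "(K <#>\<^bsub>G\<^esub> F) = (\<Union>h\<in>K. \<Union>k\<in>F. {h \<otimes>\<^bsub>G\<^esub> k})" by (simp add: set_mult_def)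
    then have "finite ((K <#>\<^bsub>G\<^esub> F) - F)"
      using that F by (simp add: left_invariant_sets_def)
    moreover have "(K' <#>\<^bsub>G\<^esub> F) - F \<subseteq> (K <#>\<^bsub>G\<^esub> F) - F"
      using that by (auto simp: set_mult_def)
    ultimately have "card ((K' <#>\<^bsub>G\<^esub> F) - F) \<le> card ((K <#>\<^bsub>G\<^esub> F) - F)"
      by (rule card_mono)
    moreover have "\<delta> * real (card F) \<le> \<delta>' * real (card F)"
      using that by (intro mult_right_mono) auto
    ultimately show "F \<in> left_invariant_sets G K' \<delta>'"
      using F by (auto simp: left_invariant_sets_def)
  qed
  have "({\<one>\<^bsub>G\<^esub>}, 1) \<in> ?I" by simp
  then have "?I \<noteq> {}" by (rule ex_in_conv[THEN iffD1, OF exI])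
  moreover have "\<exists>x\<in>?I. ?A x \<le> inf (?A a) (?A b)" if "a \<in> ?I" "b \<in> ?I" for a b
  proof (rule bexI[where x = "(fst a \<union> fst b, min (snd a) (snd b))"])
    show "(fst a \<union> fst b, min (snd a) (snd b)) \<in> ?I" using that by auto
    show "?A (fst a \<union> fst b, min (snd a) (snd b)) \<le> inf (?A a) (?A b)"
      using that mono[of "fst a" "fst a \<union> fst b" "min (snd a) (snd b)" "snd a"]
        mono[of "fst b" "fst a \<union> fst b" "min (snd a) (snd b)" "snd b"]
      by (simp add: case_prod_beta mem_Times_iff)
  qed
  ultimately have "eventually P (left_invariance G) \<longleftrightarrow> (\<exists>x\<in>?I. eventually P (?A x))"
    unfolding left_invariance_def by (rule eventually_INF_base)
  then show ?thesis
    by (simp add: eventually_principal left_invariant_sets_def Bex_def conj_assoc)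
qed

text \<open>Taking the limit in the extended reals only matters for empty \<open>X\<close>, where it is \<open>-\<infinity>\<close>; for
  nonempty \<open>X\<close> all terms, and the limit provided by the Ornstein--Weiss lemma, are real.\<close>

definition S_cover ::
    "('g, 'm) monoid_scheme \<Rightarrow> 'x topology \<Rightarrow> ('g \<Rightarrow> 'x \<Rightarrow> 'x) \<Rightarrow> real \<Rightarrow> ('x \<Rightarrow> 'x \<Rightarrow> real) \<Rightarrow>
     ereal" where
  "S_cover G X \<alpha> \<epsilon> \<rho> =
     Lim (left_invariance G)
       (\<lambda>F. log_card (enat (min_cover X (rho_set \<alpha> \<rho> F) \<epsilon>)) / ereal (real (card F)))"

definition mdim_metric ::
    "('g, 'm) monoid_scheme \<Rightarrow> 'x topology \<Rightarrow> ('g \<Rightarrow> 'x \<Rightarrow> 'x) \<Rightarrow> ('x \<Rightarrow> 'x \<Rightarrow> real) \<Rightarrow> ereal" where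
  "mdim_metric G X \<alpha> \<rho> = Liminf (at_right 0) (\<lambda>\<epsilon>. S_cover G X \<alpha> \<epsilon> \<rho> / ereal \<bar>ln \<epsilon>\<bar>)"

definition mdim ::
    "('g, 'm) monoid_scheme \<Rightarrow> 'x topology \<Rightarrow> ('g \<Rightarrow> 'x \<Rightarrow> 'x) \<Rightarrow> ereal" where
  "mdim G X \<alpha> = (INF \<rho>\<in>{\<rho>. compatible_metric X \<rho>}. mdim_metric G X \<alpha> \<rho>)"

end

theory Submission
  imports Defs
begin

text \<open>
  Both left translations restricted to an almost invariant finite set and sofic approximations are
  partial actions to which the Ornstein--Weiss greedy argument applies: if \<open>T\<^sub>1, \<dots>, T\<^sub>k\<close> are increasingly
  invariant, then almost all of the underlying set is covered by almost disjoint copies \<open>\<sigma>(T\<^sub>j) c\<close>.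

  For almost invariant sets this yields the convergence of \<open>log min_cover / |F|\<close>.  For sofic
  approximations it compares \<open>h\<^sup>\<epsilon>\<close> with \<open>S(X, \<epsilon>, \<rho>)\<close> up to a constant factor in \<open>\<epsilon>\<close>.  An almost
  equivariant map is determined, up to a small error, by its values at the centres of the tiles, so
  \<open>h\<^bsup>2\<epsilon>\<^esup> \<le> S(X, \<epsilon>, \<rho>)\<close>.  Conversely, prescribing at every centre a point of a maximal
  \<open>\<epsilon>\<close>-separated set for the tile and spreading it over the tile by the action gives separated almost
  equivariant maps, so \<open>S(X, 3\<epsilon>, \<rho>) \<le> h\<^sup>\<epsilon>\<close>.  Constant factors in \<open>\<epsilon>\<close> disappear after division by
  \<open>|log \<epsilon>|\<close>.
\<close>

text \<open>Separation is measured by \<open>rho_inf\<close>, so one coordinate suffices to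
  distinguish two maps, whereas equivariance is controlled only on average, by \<open>rho2\<close>.
  In the upper bound every map therefore has its own exceptional set, and all possible positions of
  that set have to be counted: they are few by Chernoff's bound, and an exceptional or uncovered
  point costs only a cover for \<open>{\<one>}\<close>. In the lower bound the two norms work
  together: \<open>rho_inf\<close> sees every choice made on a tile, while \<open>rho2\<close>
  hardly notices the tile boundaries because \<open>\<rho>\<close> is bounded. Full and trimmed
  tiles are both recorded: invariance and covering densities are known for the full tiles, but
  disjointness, and with it counting and independent choices, holds for the trimmed ones. The scale
  \<open>2 * \<epsilon>\<close> is \<open>\<epsilon>/2 + \<epsilon> + \<epsilon>/2\<close>, two
  equivariance errors and one cover element; \<open>3 * \<epsilon>\<close> lies strictly above the
  diameter bound \<open>2 * \<epsilon>\<close> of balls of radius \<open>\<epsilon>\<close>. The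
  empty space, where both sides come from values -infinity, is treated apart.\<close>

section \<open>Quasi-tilings\<close>

text \<open>Near the points of \<open>B\<close> the maps \<open>\<sigma> t\<close> behave like a free action.  This covers both left translations
  of a Folner set and sofic approximations.\<close>

definition partial_action ::
    "('g, 'm) monoid_scheme \<Rightarrow> 'g set \<Rightarrow> 'v set \<Rightarrow> 'v set \<Rightarrow> ('g \<Rightarrow> 'v \<Rightarrow> 'v) \<Rightarrow> bool" where
  "partial_action G K D B \<sigma> \<longleftrightarrow> finite D \<and> B \<subseteq> D \<and>
     (\<forall>c\<in>B. \<forall>t\<in>K. \<sigma> t c \<in> D) \<and> (\<forall>c\<in>B. inj_on (\<lambda>t. \<sigma> t c) K) \<and> (\<forall>t\<in>K. inj_on (\<sigma> t) B) \<and>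
     (\<forall>t\<in>K. \<forall>s\<in>K. \<forall>c\<in>B. \<forall>c'\<in>B. \<sigma> t c = \<sigma> s c' \<longrightarrow> c = \<sigma> (inv\<^bsub>G\<^esub> t \<otimes>\<^bsub>G\<^esub> s) c')"

definition tile_union :: "('g \<Rightarrow> 'v \<Rightarrow> 'v) \<Rightarrow> ('g set \<times> 'v \<times> 'g set) set \<Rightarrow> 'v set" where
  "tile_union \<sigma> P = (\<Union>(T, c, S)\<in>P. (\<lambda>s. \<sigma> s c) ` S)"

text \<open>A triple \<open>(T, c, S)\<close> stands for the tile \<open>T\<close> placed at the centre \<open>c\<close>, with the part \<open>T - S\<close>
  that overlaps other tiles trimmed off.\<close>

definition tile_family ::
    "'g set set \<Rightarrow> 'v set \<Rightarrow> ('g \<Rightarrow> 'v \<Rightarrow> 'v) \<Rightarrow> real \<Rightarrow> ('g set \<times> 'v \<times> 'g set) set \<Rightarrow> bool" where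
  "tile_family \<T> B \<sigma> \<eta> P \<longleftrightarrow> finite P \<and>
     (\<forall>(T, c, S)\<in>P. T \<in> \<T> \<and> c \<in> B \<and> S \<subseteq> T \<and> (1 - \<eta>) * real (card T) \<le> real (card S)) \<and>
     disjoint_family_on (\<lambda>(T, c, S). (\<lambda>s. \<sigma> s c) ` S) P \<and>
     (\<forall>(T, c, S)\<in>P. \<forall>t\<in>T. \<sigma> t c \<in> tile_union \<sigma> P)"

section \<open>Counting the points of tile families\<close>

lemma tile_familyD:
  assumes "tile_family \<T> B \<sigma> \<eta> P"
  shows "finite P"
    and "\<And>T c S. (T, c, S) \<in> P \<Longrightarrow> T \<in> \<T>"
    and "\<And>T c S. (T, c, S) \<in> P \<Longrightarrow> c \<in> B"
    and "\<And>T c S. (T, c, S) \<in> P \<Longrightarrow> S \<subseteq> T"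
    and "\<And>T c S. (T, c, S) \<in> P \<Longrightarrow> (1 - \<eta>) * real (card T) \<le> real (card S)"
    and "disjoint_family_on (\<lambda>(T, c, S). (\<lambda>s. \<sigma> s c) ` S) P"
    and "\<And>T c S t. (T, c, S) \<in> P \<Longrightarrow> t \<in> T \<Longrightarrow> \<sigma> t c \<in> tile_union \<sigma> P"
  using assms unfolding tile_family_def by auto

lemma partial_actionD:
  assumes "partial_action G K D B \<sigma>"
  shows "finite D" "B \<subseteq> D"
    and "\<And>c t. c \<in> B \<Longrightarrow> t \<in> K \<Longrightarrow> \<sigma> t c \<in> D"
    and "\<And>c. c \<in> B \<Longrightarrow> inj_on (\<lambda>t. \<sigma> t c) K"
    and "\<And>t. t \<in> K \<Longrightarrow> inj_on (\<sigma> t) B"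
    and "\<And>t s c c'. t \<in> K \<Longrightarrow> s \<in> K \<Longrightarrow> c \<in> B \<Longrightarrow> c' \<in> B \<Longrightarrow> \<sigma> t c = \<sigma> s c' \<Longrightarrow>
           c = \<sigma> (inv\<^bsub>G\<^esub> t \<otimes>\<^bsub>G\<^esub> s) c'"
  using assms unfolding partial_action_def by simp_all

text \<open>Trimmed tiles are pairwise disjoint, and freeness of the partial action on
  \<open>K\<close> gives each of them exactly \<open>card S\<close> points.\<close>

lemma card_tile_union:
  assumes act: "partial_action G K D B \<sigma>" and fam: "tile_family \<T> B \<sigma> \<eta> P"
    and \<T>: "\<And>T. T \<in> \<T> \<Longrightarrow> T \<subseteq> K \<and> finite T"
  shows "tile_union \<sigma> P \<subseteq> D" "card (tile_union \<sigma> P) = (\<Sum>(T, c, S)\<in>P. card S)"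
proof -
  note a = partial_actionD[OF act] and f = tile_familyD[OF fam]
  show "tile_union \<sigma> P \<subseteq> D"
  proof
    fix v assume "v \<in> tile_union \<sigma> P"
    then obtain T c S s where P: "(T, c, S) \<in> P" and "s \<in> S" "v = \<sigma> s c"
      by (auto simp: tile_union_def)
    then have "s \<in> K" using f(2,4)[OF P] \<T>[of T] by auto
    with f(3)[OF P] \<open>v = \<sigma> s c\<close> show "v \<in> D" by (simp add: a(3))
  qed
  have "card (tile_union \<sigma> P) = (\<Sum>x\<in>P. card ((\<lambda>(T, c, S). (\<lambda>s. \<sigma> s c) ` S) x))"
    unfolding tile_union_def
  proof (rule card_UN_disjoint)
    show "finite P" by (rule f(1))
    show "\<forall>x\<in>P. finite ((\<lambda>(T, c, S). (\<lambda>s. \<sigma> s c) ` S) x)"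
    proof clarify
      fix T c S assume "(T, c, S) \<in> P"
      then have "finite S" using f(2,4) \<T> by (meson finite_subset)
      then show "finite ((\<lambda>s. \<sigma> s c) ` S)" by simp
    qed
    show "\<forall>x\<in>P. \<forall>y\<in>P. x \<noteq> y \<longrightarrow> (\<lambda>(T, c, S). (\<lambda>s. \<sigma> s c) ` S) x \<inter>
       (\<lambda>(T, c, S). (\<lambda>s. \<sigma> s c) ` S) y = {}"
      using f(6) by (simp add: disjoint_family_on_def)
  qed
  also have "\<dots> = (\<Sum>(T, c, S)\<in>P. card S)"
  proof (rule sum.cong[OF refl], clarify)
    fix T c S assume "(T, c, S) \<in> P"
    then have "inj_on (\<lambda>t. \<sigma> t c) S"
      using f(2-4) \<T> a(4) by (meson inj_on_subset)
    then show "card ((\<lambda>s. \<sigma> s c) ` S) = card S" by (rule card_image)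
  qed
  finally show "card (tile_union \<sigma> P) = (\<Sum>(T, c, S)\<in>P. card S)" .
qed

text \<open>A maximal family cannot be enlarged at \<open>c\<close>, so its union meets the tile at \<open>c\<close> in a
  proportion at least \<open>\<eta>\<close>; averaging over \<open>c\<close> bounds the union from below.\<close>

lemma greedy_tile_family:
  assumes act: "partial_action G K D B \<sigma>" and C: "C \<subseteq> B"
    and T: "T \<subseteq> K" "finite T" "T \<noteq> {}" and \<eta>: "0 < \<eta>" "\<eta> < 1"
  obtains Q where "tile_family {T} C \<sigma> \<eta> Q" "\<eta> * real (card C) \<le> real (card (tile_union \<sigma> Q))"
proof -
  note a = partial_actionD[OF act]
  have finC: "finite C" by (rule finite_subset[OF subset_trans[OF C a(2)] a(1)])
  have actC: "partial_action G K D C \<sigma>"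
    unfolding partial_action_def
  proof (intro conjI ballI impI)
    show "inj_on (\<sigma> t) C" if "t \<in> K" for t using a(5)[OF that] C by (rule inj_on_subset)
    show "c = \<sigma> (inv\<^bsub>G\<^esub> t \<otimes>\<^bsub>G\<^esub> s) c'"
      if "t \<in> K" "s \<in> K" "c \<in> C" "c' \<in> C" "\<sigma> t c = \<sigma> s c'" for t s c c'
      using a(6)[OF that(1,2) _ _ that(5)] that(3,4) C by blast
  qed (use a C in auto)
  let ?fams = "{Q. tile_family {T} C \<sigma> \<eta> Q}"
  have "?fams \<subseteq> Pow ({T} \<times> C \<times> Pow T)"
    by (auto dest: tile_familyD(2-4) subsetD)
  then have fin: "finite ?fams"
    by (rule finite_subset) (simp add: T finC)
  have "{} \<in> ?fams" by (simp add: tile_family_def disjoint_family_on_def)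
  then obtain Q where Q: "tile_family {T} C \<sigma> \<eta> Q"
    and max: "\<And>Q'. tile_family {T} C \<sigma> \<eta> Q' \<Longrightarrow> Q \<subseteq> Q' \<Longrightarrow> Q' = Q"
    using finite_has_maximal[OF fin] by blast
  note f = tile_familyD[OF Q]
  define V where "V = tile_union \<sigma> Q"
  have Vsub: "V \<subseteq> D"
    unfolding V_def by (rule card_tile_union[OF actC Q]) (use T in auto)
  have finV: "finite V" by (rule finite_subset[OF Vsub a(1)])
  have meet: "\<eta> * real (card T) \<le> real (card {t\<in>T. \<sigma> t c \<in> V})" if c: "c \<in> C" for c
  proof (rule ccontr)
    assume less: "\<not> ?thesis"
    define S where "S = {t\<in>T. \<sigma> t c \<notin> V}"
    have "T = {t\<in>T. \<sigma> t c \<in> V} \<union> S" by (auto simp: S_def)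
    moreover have "card ({t\<in>T. \<sigma> t c \<in> V} \<union> S) = card {t\<in>T. \<sigma> t c \<in> V} + card S"
      using T by (intro card_Un_disjoint) (auto simp: S_def)
    ultimately have "card T = card {t\<in>T. \<sigma> t c \<in> V} + card S" by simp
    then have S: "(1 - \<eta>) * real (card T) \<le> real (card S)"
      using less by (simp add: algebra_simps)
    moreover have "0 < (1 - \<eta>) * real (card T)" using \<eta> T by (simp add: card_gt_0_iff)
    \<comment> \<open>Only a nonempty \<open>S\<close> makes the new triple differ from those in
      \<open>Q\<close>: its points avoid \<open>V\<close>, so it cannot already be a member.\<close>
    ultimately have "S \<noteq> {}" by auto
    let ?Q = "insert (T, c, S) Q"
    have new: "(\<lambda>s. \<sigma> s c) ` S \<inter> V = {}" by (auto simp: S_def)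
    have U: "tile_union \<sigma> ?Q = (\<lambda>s. \<sigma> s c) ` S \<union> V" by (simp add: tile_union_def V_def)
    have notin: "(T, c, S) \<notin> Q"
    proof
      assume "(T, c, S) \<in> Q"
      then have "(\<lambda>s. \<sigma> s c) ` S \<subseteq> V" by (force simp: V_def tile_union_def)
      then show False using new \<open>S \<noteq> {}\<close> by auto
    qed
    have "disjoint_family_on (\<lambda>(T, c, S). (\<lambda>s. \<sigma> s c) ` S) ?Q"
      using f(6) new notin unfolding V_def tile_union_def by (subst disjoint_family_on_insert) auto
    moreover have "\<forall>(T', c', S')\<in>?Q. \<forall>t\<in>T'. \<sigma> t c' \<in> tile_union \<sigma> ?Q"
      using f(7) unfolding U by (auto simp: S_def V_def)
    moreover have "S \<subseteq> T" by (auto simp: S_def)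
    ultimately have "tile_family {T} C \<sigma> \<eta> ?Q"
      using Q c S by (simp add: tile_family_def)
    then have "?Q = Q" by (rule max) auto
    with notin show False by auto
  qed
  \<comment> \<open>Double counting of the pairs \<open>(c, t)\<close> with
    \<open>\<sigma> t c \<in> V\<close>: each \<open>c\<close> contributes at least
    \<open>\<eta> * card T\<close> of them, each \<open>t\<close> at most \<open>card V\<close>,
    since \<open>\<sigma> t\<close> is injective on \<open>C\<close>.\<close>
  have "\<eta> * real (card T) * real (card C) \<le> (\<Sum>c\<in>C. real (card {t\<in>T. \<sigma> t c \<in> V}))"
    using sum_mono[of C "\<lambda>_. \<eta> * real (card T)", OF meet] by (simp add: mult.commute)
  also have "\<dots> = real (\<Sum>c\<in>C. \<Sum>t\<in>T. if \<sigma> t c \<in> V then 1 else 0)"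
    using T by (simp add: sum.If_cases Int_def)
  also have "(\<Sum>c\<in>C. \<Sum>t\<in>T. if \<sigma> t c \<in> V then 1 else 0) = (\<Sum>t\<in>T. card {c\<in>C. \<sigma> t c \<in> V})"
    using finC by (subst sum.swap) (simp add: sum.If_cases Int_def)
  also have "\<dots> \<le> (\<Sum>t\<in>T. card V)"
  proof (rule sum_mono)
    fix t assume "t \<in> T"
    then have "inj_on (\<sigma> t) {c\<in>C. \<sigma> t c \<in> V}"
      using a(5) T C by (blast intro: inj_on_subset)
    then show "card {c\<in>C. \<sigma> t c \<in> V} \<le> card V"
      by (rule card_inj_on_le) (auto simp: finV)
  qed
  finally have "\<eta> * real (card T) * real (card C) \<le> real (card T) * real (card V)" by simp
  then have "real (card T) * (\<eta> * real (card C)) \<le> real (card T) * real (card V)"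
    by (simp add: algebra_simps)
  then have "\<eta> * real (card C) \<le> real (card V)"
    using T by (simp add: card_gt_0_iff)
  with Q that show thesis by (simp add: V_def)
qed

text \<open>Trimming loses at most the factor \<open>1 - \<eta>\<close>, and the trimmed tiles are
  disjoint inside \<open>D\<close>. Every cost proportional to the sizes of the full tiles is
  bounded through this.\<close>

lemma sum_tile_card_le:
  assumes act: "partial_action G K D B \<sigma>" and fam: "tile_family \<T> B \<sigma> \<eta> P"
    and \<T>: "\<And>T. T \<in> \<T> \<Longrightarrow> T \<subseteq> K \<and> finite T"
  shows "(1 - \<eta>) * (\<Sum>(T, c, S)\<in>P. real (card T)) \<le> real (card D)"
proof -
  have "(1 - \<eta>) * (\<Sum>(T, c, S)\<in>P. real (card T)) = (\<Sum>(T, c, S)\<in>P. (1 - \<eta>) * real (card T))"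
    by (simp add: sum_distrib_left case_prod_beta)
  also have "\<dots> \<le> (\<Sum>(T, c, S)\<in>P. real (card S))"
    using tile_familyD(5)[OF fam] by (intro sum_mono) auto
  also have "\<dots> = real (card (tile_union \<sigma> P))"
    by (simp add: card_tile_union(2)[OF act fam \<T>] case_prod_beta)
  also have "\<dots> \<le> real (card D)"
    using card_mono[OF partial_actionD(1)[OF act] card_tile_union(1)[OF act fam \<T>]] by simp
  finally show ?thesis .
qed

text \<open>Glues the family for a new tile shape to the one already built. Apart from disjointness
  all conditions concern single members, and the covering clause survives when the union
  grows.\<close>

lemma tile_family_Un:
  assumes P: "tile_family \<T> B \<sigma> \<eta> P" and Q: "tile_family \<T>' C \<sigma> \<eta> Q"
    and sub: "\<T> \<subseteq> \<U>" "\<T>' \<subseteq> \<U>" "C \<subseteq> B" and disj: "tile_union \<sigma> P \<inter> tile_union \<sigma> Q = {}"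
  shows "tile_family \<U> B \<sigma> \<eta> (P \<union> Q)" "tile_union \<sigma> (P \<union> Q) = tile_union \<sigma> P \<union> tile_union \<sigma> Q"
proof -
  show U: "tile_union \<sigma> (P \<union> Q) = tile_union \<sigma> P \<union> tile_union \<sigma> Q"
    by (auto simp: tile_union_def)
  note f = tile_familyD[OF P] and g = tile_familyD[OF Q]
  let ?A = "\<lambda>(T, c, S). (\<lambda>s. \<sigma> s c) ` S"
  have "disjoint_family_on ?A (P \<union> Q)"
    unfolding disjoint_family_on_def
  proof (intro ballI impI)
    fix x y assume xy: "x \<in> P \<union> Q" "y \<in> P \<union> Q" "x \<noteq> y"
    have cross: "?A x \<inter> ?A y = {}" if "x \<in> P" "y \<in> Q" for x y
      using that disj unfolding tile_union_def by fastforce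
    from xy consider "x \<in> P" "y \<in> P" | "x \<in> Q" "y \<in> Q" | "x \<in> P" "y \<in> Q" | "x \<in> Q" "y \<in> P"
      by blast
    then show "?A x \<inter> ?A y = {}"
    proof cases
      case 1 with f(6) xy show ?thesis by (simp add: disjoint_family_on_def)
    next
      case 2 with g(6) xy show ?thesis by (simp add: disjoint_family_on_def)
    next
      case 3 then show ?thesis by (rule cross)
    next
      case 4 then show ?thesis using cross[of y x] by blast
    qed
  qed
  moreover have "\<forall>(T, c, S)\<in>P \<union> Q. T \<in> \<U> \<and> c \<in> B \<and> S \<subseteq> T \<and> (1 - \<eta>) * real (card T) \<le> real (card S)"
  proof (clarify, elim UnE)
    show "T \<in> \<U> \<and> c \<in> B \<and> S \<subseteq> T \<and> (1 - \<eta>) * real (card T) \<le> real (card S)"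
      if "(T, c, S) \<in> P" for T c S using f(2-5)[OF that] sub by blast
    show "T \<in> \<U> \<and> c \<in> B \<and> S \<subseteq> T \<and> (1 - \<eta>) * real (card T) \<le> real (card S)"
      if "(T, c, S) \<in> Q" for T c S using g(2-5)[OF that] sub by blast
  qed
  ultimately show "tile_family \<U> B \<sigma> \<eta> (P \<union> Q)"
    using f(1,7) g(1,7) unfolding tile_family_def U by auto
qed

text \<open>Ornstein--Weiss: the largest tile comes first in the list.  What it leaves uncovered is nearly
  invariant under the smaller tiles, each of which then covers a proportion \<open>\<eta>\<close> of the rest.\<close>

lemma exists_quasi_tiling:
  assumes act: "partial_action G K D B \<sigma>" and G: "group G"
    and Ts: "\<And>T. T \<in> set Ts \<Longrightarrow> T \<subseteq> K \<and> finite T \<and> T \<noteq> {}" and K: "K \<subseteq> carrier G"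
    and inv: "sorted_wrt (\<lambda>T' T. real (card (((m_inv G ` T) <#>\<^bsub>G\<^esub> T') - T')) \<le> \<beta> * real (card T')) Ts"
    and \<eta>: "0 < \<eta>" "\<eta> \<le> 1/2" and \<beta>: "0 \<le> \<beta>"
    and B: "real (card (D - B)) \<le> \<beta> * real (card D)"
  shows "\<exists>P. tile_family (set Ts) B \<sigma> \<eta> P \<and>
    real (card (D - tile_union \<sigma> P)) \<le> ((1 - \<eta>) ^ length Ts + 3 * \<beta>) * real (card D)"
  using Ts inv
\<comment> \<open>Induction from the end of the list: the last tile is the one under whose inverses
  all earlier tiles are almost invariant.\<close>
proof (induction Ts rule: rev_induct)
  case Nil
  have "tile_family (set []) B \<sigma> \<eta> {}" by (simp add: tile_family_def disjoint_family_on_def)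
  moreover have "real (card D) \<le> (1 + 3 * \<beta>) * real (card D)"
    using \<beta> by (simp add: algebra_simps)
  ultimately show ?case by (intro exI[of _ "{}"]) (simp add: tile_union_def)
next
  case (snoc T Ts)
  note a = partial_actionD[OF act]
  interpret group G by fact
  have Ts: "\<And>T'. T' \<in> set Ts \<Longrightarrow> T' \<subseteq> K \<and> finite T' \<and> T' \<noteq> {}" and T: "T \<subseteq> K" "finite T" "T \<noteq> {}"
    using snoc.prems(1) by auto
  obtain P where P: "tile_family (set Ts) B \<sigma> \<eta> P"
    and Pbd: "real (card (D - tile_union \<sigma> P)) \<le> ((1 - \<eta>) ^ length Ts + 3 * \<beta>) * real (card D)"
    using snoc.IH[OF Ts] snoc.prems(2) by (auto simp: sorted_wrt_append)
  have Tinv: "real (card (((m_inv G ` T) <#>\<^bsub>G\<^esub> T') - T')) \<le> \<beta> * real (card T')" if "T' \<in> set Ts" for T'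
    using snoc.prems(2) that by (auto simp: sorted_wrt_append)
  note f = tile_familyD[OF P]
  define U where "U = tile_union \<sigma> P"
  define A where "A = D - U"
  \<comment> \<open>Centres whose whole tile is still uncovered, so that the new tiles cannot touch
    the old ones.\<close>
  define C where "C = {c\<in>B. (\<lambda>t. \<sigma> t c) ` T \<subseteq> A}"
  obtain Q where Q: "tile_family {T} C \<sigma> \<eta> Q"
    and Qbd: "\<eta> * real (card C) \<le> real (card (tile_union \<sigma> Q))"
    using greedy_tile_family[OF act, of C T \<eta>] T \<eta> by (auto simp: C_def)
  define V where "V = tile_union \<sigma> Q"
  have finA: "finite A" using a(1) by (simp add: A_def)
  have VA: "V \<subseteq> A"
    using tile_familyD(2-4)[OF Q] unfolding V_def tile_union_def C_def by fast
  let ?Y = "\<lambda>T'. (m_inv G ` T <#>\<^bsub>G\<^esub> T') - T'"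
  define W where "W = (\<Union>(T', c', S')\<in>P. (\<lambda>g. \<sigma> g c') ` ?Y T')"
  have finY: "finite (?Y T')" if "T' \<in> set Ts" for T'
    using T Ts[OF that] by (auto simp: set_mult_def)
  have finW: "finite W"
    unfolding W_def using f(1,2) finY by auto
  \<comment> \<open>If the tile \<open>T\<close> at \<open>c\<close> hits a placed tile, then
    \<open>\<sigma> t c = \<sigma> s c'\<close>, and \<open>c\<close> is the image of
    \<open>c'\<close> under the inverse of \<open>t\<close> times \<open>s\<close>. That element is
    not in \<open>T'\<close>, because full tiles are covered and \<open>c\<close> is not. So
    \<open>c\<close> lies in \<open>W\<close>, which is small as \<open>T'\<close> is almost
    invariant under the inverses of \<open>T\<close>.\<close>
  have "A \<subseteq> C \<union> (D - B) \<union> W"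
  proof
    fix c assume c: "c \<in> A"
    show "c \<in> C \<union> (D - B) \<union> W"
    proof (rule ccontr)
      assume nc: "\<not> ?thesis"
      then have cB: "c \<in> B" using c by (auto simp: A_def)
      with nc obtain t where t: "t \<in> T" "\<sigma> t c \<notin> A" by (auto simp: C_def)
      then have "\<sigma> t c \<in> U" using a(3) cB T by (auto simp: A_def)
      then obtain T' c' S' s where P': "(T', c', S') \<in> P" and s: "s \<in> S'" "\<sigma> t c = \<sigma> s c'"
        unfolding U_def tile_union_def by auto
      have sT: "s \<in> T'" "T' \<subseteq> K" "c' \<in> B" using f(2-4)[OF P'] s Ts by auto
      have eq: "c = \<sigma> (inv\<^bsub>G\<^esub> t \<otimes>\<^bsub>G\<^esub> s) c'"
        using a(6)[of t s c c'] t T sT cB s by auto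
      have "inv\<^bsub>G\<^esub> t \<otimes>\<^bsub>G\<^esub> s \<notin> T'"
        using f(7)[OF P'] eq c by (auto simp: A_def U_def)
      then have "inv\<^bsub>G\<^esub> t \<otimes>\<^bsub>G\<^esub> s \<in> ?Y T'"
        using t sT by (auto simp: set_mult_def)
      then have "c \<in> W" unfolding W_def using P' eq by force
      with nc show False by auto
    qed
  qed
  then have "card A \<le> card (C \<union> (D - B) \<union> W)"
    using finW a(1,2) by (intro card_mono) (auto simp: C_def intro: finite_subset)
  also have "\<dots> \<le> card C + card (D - B) + card W"
    by (meson card_Un_le le_trans add_le_mono1)
  finally have cA: "real (card A) \<le> real (card C) + real (card (D - B)) + real (card W)" by linarith
  have "card W \<le> (\<Sum>x\<in>P. card (case x of (T', c', S') \<Rightarrow> (\<lambda>g. \<sigma> g c') ` ?Y T'))"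
    unfolding W_def by (rule card_UN_le[OF f(1)])
  also have "\<dots> \<le> (\<Sum>x\<in>P. card (case x of (T', c', S') \<Rightarrow> ?Y T'))"
    using f(2) finY by (intro sum_mono) (auto intro!: card_image_le)
  finally have "real (card W) \<le> (\<Sum>x\<in>P. real (card (case x of (T', c', S') \<Rightarrow> ?Y T')))"
    by (simp flip: of_nat_sum)
  also have "\<dots> \<le> (\<Sum>(T', c', S')\<in>P. \<beta> * real (card T'))"
    using f(2) Tinv by (intro sum_mono) auto
  also have "\<dots> = \<beta> * (\<Sum>(T', c', S')\<in>P. real (card T'))"
    by (simp add: sum_distrib_left case_prod_beta)
  also have "\<dots> \<le> \<beta> * (2 * real (card D))"
  proof (rule mult_left_mono[OF _ \<beta>])
    let ?s = "\<Sum>(T', c', S')\<in>P. real (card T')"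
    have "0 \<le> ?s" by (intro sum_nonneg) auto
    then have "1/2 * ?s \<le> (1 - \<eta>) * ?s" using \<eta> by (intro mult_right_mono) auto
    also have "\<dots> \<le> real (card D)" by (rule sum_tile_card_le[OF act P]) (use Ts in auto)
    finally show "?s \<le> 2 * real (card D)" by simp
  qed
  finally have "real (card W) \<le> \<beta> * (2 * real (card D))" .
  \<comment> \<open>One \<open>\<beta>\<close> pays for \<open>D - B\<close> and two for
    \<open>W\<close>, the 2 being a bound for \<open>1 / (1 - \<eta>)\<close>.\<close>
  with cA B have cC: "real (card A) - 3 * \<beta> * real (card D) \<le> real (card C)" by simp
  have "real (card (A - V)) = real (card A) - real (card V)"
    using VA finA card_mono[OF finA VA] by (simp add: card_Diff_subset finite_subset of_nat_diff)
  also have "\<dots> \<le> real (card A) - \<eta> * (real (card A) - 3 * \<beta> * real (card D))"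
    using Qbd mult_left_mono[OF cC, of \<eta>] \<eta> unfolding V_def by linarith
  also have "\<dots> = (1 - \<eta>) * real (card A) + 3 * \<eta> * \<beta> * real (card D)" by (simp add: algebra_simps)
  also have "\<dots> \<le> (1 - \<eta>) * (((1 - \<eta>) ^ length Ts + 3 * \<beta>) * real (card D)) + 3 * \<eta> * \<beta> * real (card D)"
    using Pbd \<eta> by (intro add_right_mono mult_left_mono) (auto simp: A_def U_def)
  \<comment> \<open>The error \<open>3 * \<beta>\<close> is a fixed point of the recursion and does
    not grow with the number of tiles.\<close>
  also have "\<dots> = ((1 - \<eta>) ^ length (Ts @ [T]) + 3 * \<beta>) * real (card D)"
    by (simp add: algebra_simps)
  finally have bd: "real (card (A - V)) \<le> ((1 - \<eta>) ^ length (Ts @ [T]) + 3 * \<beta>) * real (card D)" .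
  have PQ: "tile_family (set (Ts @ [T])) B \<sigma> \<eta> (P \<union> Q)" "tile_union \<sigma> (P \<union> Q) = U \<union> V"
    using tile_family_Un[OF P Q, of "set (Ts @ [T])"] VA
    by (auto simp: C_def A_def U_def V_def)
  moreover have "D - (U \<union> V) = A - V" by (auto simp: A_def)
  ultimately show ?case using bd by (intro exI[of _ "P \<union> Q"]) simp
qed

text \<open>The tiles and \<open>\<beta>\<close> are fixed before \<open>D\<close> and
  \<open>\<sigma>\<close>, so the same tiles serve all sufficiently invariant sets or all late
  members of a sofic approximation. \<open>Q\<close> carries the density information wanted for the
  tiles.\<close>

lemma exists_quasi_tiling_frequently:
  assumes G: "group G"
    and Q: "\<And>K \<delta>. finite K \<Longrightarrow> K \<subseteq> carrier G \<Longrightarrow> \<delta> > 0 \<Longrightarrow> \<exists>T\<in>left_invariant_sets G K \<delta>. Q T"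
    and \<eta>: "0 < \<eta>" "\<eta> \<le> 1/2" and \<kappa>: "0 < \<kappa>"
  obtains \<T> \<beta> where "finite \<T>" "0 < \<beta>" "\<Union>\<T> \<noteq> {}"
    "\<And>T. T \<in> \<T> \<Longrightarrow> finite T \<and> T \<noteq> {} \<and> T \<subseteq> carrier G \<and> Q T"
    "\<And>(D::'v set) B \<sigma>. partial_action G (\<Union>\<T>) D B \<sigma> \<Longrightarrow> real (card (D - B)) \<le> \<beta> * real (card D) \<Longrightarrow>
       \<exists>P. tile_family \<T> B \<sigma> \<eta> P \<and> real (card (D - tile_union \<sigma> P)) \<le> \<kappa> * real (card D)"
proof -
  \<comment> \<open>Then \<open>3 * \<beta>\<close> is half of \<open>\<kappa>\<close>; the other
    half is left for the power of \<open>1 - \<eta>\<close>.\<close>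
  define \<beta> where "\<beta> = \<kappa> / 6"
  have \<beta>: "0 < \<beta>" using \<kappa> by (simp add: \<beta>_def)
  have "(\<lambda>k. (1 - \<eta>) ^ k) \<longlonglongrightarrow> 0" using \<eta> by (intro LIMSEQ_realpow_zero) auto
  then have "eventually (\<lambda>k. (1 - \<eta>) ^ k < \<kappa> / 2) sequentially"
    using \<kappa> by (intro order_tendstoD) auto
  \<comment> \<open>The exponent \<open>Suc k\<close> will be the number of tiles and keeps their
    list nonempty.\<close>
  then obtain k where k: "(1 - \<eta>) ^ Suc k < \<kappa> / 2"
    using eventually_sequentially by (metis le_Suc_eq le_refl)
  have "\<exists>Ts. length Ts = n \<and> (\<forall>T\<in>set Ts. finite T \<and> T \<noteq> {} \<and> T \<subseteq> carrier G \<and> Q T) \<and>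
      sorted_wrt (\<lambda>T' T. real (card (((m_inv G ` T) <#>\<^bsub>G\<^esub> T') - T')) \<le> \<beta> * real (card T')) Ts" for n
  proof (induction n)
    case 0
    then show ?case by simp
  next
    case (Suc n)
    then obtain Ts where Ts: "length Ts = n" "\<And>T. T \<in> set Ts \<Longrightarrow> finite T \<and> T \<noteq> {} \<and> T \<subseteq> carrier G \<and> Q T"
      "sorted_wrt (\<lambda>T' T. real (card (((m_inv G ` T) <#>\<^bsub>G\<^esub> T') - T')) \<le> \<beta> * real (card T')) Ts"
      by blast
    \<comment> \<open>The next tile goes to the front of the list, so it must be almost invariant
      under the inverses of all tiles chosen so far.\<close>
    define K where "K = (\<Union>T\<in>set Ts. m_inv G ` T)"
    have "finite K" "K \<subseteq> carrier G"
      using Ts(2) group.inv_closed[OF G] by (fastforce simp: K_def)+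
    then obtain T' where T': "T' \<in> left_invariant_sets G K \<beta>" "Q T'"
      using Q \<beta> by blast
    then have T'2: "finite T'" "T' \<noteq> {}" "T' \<subseteq> carrier G"
      "real (card ((K <#>\<^bsub>G\<^esub> T') - T')) < \<beta> * real (card T')"
      by (auto simp: left_invariant_sets_def)
    have "real (card (((m_inv G ` T) <#>\<^bsub>G\<^esub> T') - T')) \<le> \<beta> * real (card T')" if "T \<in> set Ts" for T
    proof -
      have "((m_inv G ` T) <#>\<^bsub>G\<^esub> T') - T' \<subseteq> (K <#>\<^bsub>G\<^esub> T') - T'"
        using that by (auto simp: K_def set_mult_def)
      moreover have "finite ((K <#>\<^bsub>G\<^esub> T') - T')"
        using \<open>finite K\<close> T'2 by (auto simp: set_mult_def)
      ultimately have "card (((m_inv G ` T) <#>\<^bsub>G\<^esub> T') - T') \<le> card ((K <#>\<^bsub>G\<^esub> T') - T')"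
        by (intro card_mono)
      then show ?thesis using T'2(4) by linarith
    qed
    then show ?case using Ts T' T'2 by (intro exI[of _ "T' # Ts"]) auto
  qed
  then obtain Ts where Ts: "length Ts = Suc k" "\<And>T. T \<in> set Ts \<Longrightarrow> finite T \<and> T \<noteq> {} \<and> T \<subseteq> carrier G \<and> Q T"
      "sorted_wrt (\<lambda>T' T. real (card (((m_inv G ` T) <#>\<^bsub>G\<^esub> T') - T')) \<le> \<beta> * real (card T')) Ts"
    by blast
  show thesis
  proof (rule that[of "set Ts" \<beta>])
    have "hd Ts \<in> set Ts" using Ts(1) by (cases Ts) auto
    then show "\<Union>(set Ts) \<noteq> {}" using Ts(2) by blast
    fix D :: "'v set" and B \<sigma>
    assume act: "partial_action G (\<Union>(set Ts)) D B \<sigma>"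
      and B: "real (card (D - B)) \<le> \<beta> * real (card D)"
    obtain P where P: "tile_family (set Ts) B \<sigma> \<eta> P"
      "real (card (D - tile_union \<sigma> P)) \<le> ((1 - \<eta>) ^ length Ts + 3 * \<beta>) * real (card D)"
      using exists_quasi_tiling[OF act G _ _ Ts(3) \<eta> _ B] \<beta> Ts(2) by (meson Sup_least Sup_upper less_imp_le)
    have "((1 - \<eta>) ^ length Ts + 3 * \<beta>) * real (card D) \<le> \<kappa> * real (card D)"
      using k Ts(1) by (intro mult_right_mono) (auto simp: \<beta>_def)
    with P show "\<exists>P. tile_family (set Ts) B \<sigma> \<eta> P \<and> real (card (D - tile_union \<sigma> P)) \<le> \<kappa> * real (card D)"
      by force
  qed (use Ts \<beta> in auto)
qed

section \<open>Convergence of subadditive set functions\<close>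

lemma finite_set_mult: "finite A \<Longrightarrow> finite B \<Longrightarrow> finite (A <#>\<^bsub>G\<^esub> B)"
  by (simp add: set_mult_def)

text \<open>Makes quasi-tilings available inside an almost invariant set itself; freeness and the
  recovery of a centre are cancellation in the group.\<close>

lemma translation_partial_action:
  assumes G: "group G" and K: "K \<subseteq> carrier G" and F: "finite F" "F \<subseteq> carrier G"
  shows "partial_action G K F {c\<in>F. \<forall>t\<in>K. t \<otimes>\<^bsub>G\<^esub> c \<in> F} (\<lambda>t c. t \<otimes>\<^bsub>G\<^esub> c)"
proof -
  interpret group G by fact
  show ?thesis
    unfolding partial_action_def
  proof (intro conjI ballI impI)
    fix t s c c'
    assume "t \<in> K" "s \<in> K" "c \<in> {c \<in> F. \<forall>t\<in>K. t \<otimes>\<^bsub>G\<^esub> c \<in> F}" "c' \<in> {c \<in> F. \<forall>t\<in>K. t \<otimes>\<^bsub>G\<^esub> c \<in> F}"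
      and eq: "t \<otimes>\<^bsub>G\<^esub> c = s \<otimes>\<^bsub>G\<^esub> c'"
    then have car: "t \<in> carrier G" "s \<in> carrier G" "c \<in> carrier G" "c' \<in> carrier G" using K F by auto
    then show "c = inv\<^bsub>G\<^esub> t \<otimes>\<^bsub>G\<^esub> s \<otimes>\<^bsub>G\<^esub> c'"
      using eq by (metis inv_solve_left m_assoc inv_closed m_closed)
  next
    fix c assume "c \<in> {c \<in> F. \<forall>t\<in>K. t \<otimes>\<^bsub>G\<^esub> c \<in> F}"
    then show "inj_on (\<lambda>t. t \<otimes>\<^bsub>G\<^esub> c) K" using K F by (auto intro!: inj_onI simp: subset_iff)
  next
    fix t assume "t \<in> K"
    then show "inj_on (\<lambda>c. t \<otimes>\<^bsub>G\<^esub> c) {c \<in> F. \<forall>t\<in>K. t \<otimes>\<^bsub>G\<^esub> c \<in> F}"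
      using K F by (auto intro!: inj_onI simp: subset_iff)
  qed (use F in auto)
qed

text \<open>A point leaving \<open>F\<close> under some \<open>t\<close> in \<open>K\<close> is sent
  by this \<open>t\<close>, injectively, into \<open>K F - F\<close>; sum over
  \<open>t\<close>.\<close>

lemma card_translation_boundary:
  assumes G: "group G" and K: "K \<subseteq> carrier G" "finite K" and F: "finite F" "F \<subseteq> carrier G"
  shows "card (F - {c\<in>F. \<forall>t\<in>K. t \<otimes>\<^bsub>G\<^esub> c \<in> F}) \<le> card K * card ((K <#>\<^bsub>G\<^esub> F) - F)"
proof -
  interpret group G by fact
  have "F - {c\<in>F. \<forall>t\<in>K. t \<otimes>\<^bsub>G\<^esub> c \<in> F} = (\<Union>t\<in>K. {c\<in>F. t \<otimes>\<^bsub>G\<^esub> c \<notin> F})" by auto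
  also have "card \<dots> \<le> (\<Sum>t\<in>K. card {c\<in>F. t \<otimes>\<^bsub>G\<^esub> c \<notin> F})" by (rule card_UN_le[OF K(2)])
  also have "\<dots> \<le> (\<Sum>t\<in>K. card ((K <#>\<^bsub>G\<^esub> F) - F))"
  proof (rule sum_mono)
    fix t assume t: "t \<in> K"
    show "card {c\<in>F. t \<otimes>\<^bsub>G\<^esub> c \<notin> F} \<le> card ((K <#>\<^bsub>G\<^esub> F) - F)"
    proof (rule card_inj_on_le)
      show "inj_on (\<lambda>c. t \<otimes>\<^bsub>G\<^esub> c) {c\<in>F. t \<otimes>\<^bsub>G\<^esub> c \<notin> F}"
        using t K F by (auto intro!: inj_onI simp: subset_iff)
      show "(\<lambda>c. t \<otimes>\<^bsub>G\<^esub> c) ` {c\<in>F. t \<otimes>\<^bsub>G\<^esub> c \<notin> F} \<subseteq> (K <#>\<^bsub>G\<^esub> F) - F"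
        using t by (auto simp: set_mult_def)
      show "finite ((K <#>\<^bsub>G\<^esub> F) - F)" using K F by (simp add: finite_set_mult)
    qed
  qed
  finally show ?thesis by simp
qed

text \<open>The factor \<open>1 / (1 - \<eta>)\<close> is the price of overlapping tiles and
  \<open>a * \<eta>\<close> that of small exceptional sets; both effects vanish with the tiling
  parameter.\<close>

lemma perturbed_density_tendsto:
  fixes l a :: real
  shows "((\<lambda>\<eta>. l / (1 - \<eta>) + a * \<eta>) \<longlongrightarrow> l) (at_right 0)"
  by (rule tendsto_eq_intros refl | simp)+

lemma small_parameter: "eventually (\<lambda>\<eta>. 0 < \<eta> \<and> \<eta> \<le> (1/2 :: real)) (at_right 0)"
  by (rule eventually_at_rightI[of 0 "1/2"]) auto

text \<open>The hypotheses of the Ornstein--Weiss lemma. Invariance concerns right translations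
  because a tile placed at \<open>b\<close> is \<open>T b\<close>; the inequality applied to the
  inverse of \<open>g\<close> gives equality.\<close>

locale subadditive_set_function =
  fixes G :: "('g, 'm) monoid_scheme" (structure) and c :: "'g set \<Rightarrow> real"
  assumes amenable: "amenable_group G"
    and empty: "c {} = 0"
    and nonneg: "\<lbrakk>finite A; A \<subseteq> carrier G\<rbrakk> \<Longrightarrow> 0 \<le> c A"
    and mono: "\<lbrakk>finite B; B \<subseteq> carrier G; A \<subseteq> B\<rbrakk> \<Longrightarrow> c A \<le> c B"
    and subadd: "\<lbrakk>finite A; A \<subseteq> carrier G; finite B; B \<subseteq> carrier G\<rbrakk> \<Longrightarrow> c (A \<union> B) \<le> c A + c B"
    and right_invariant: "\<lbrakk>finite A; A \<subseteq> carrier G; g \<in> carrier G\<rbrakk> \<Longrightarrow> c ((\<lambda>t. t \<otimes>\<^bsub>G\<^esub> g) ` A) \<le> c A"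
begin

sublocale group G
  using amenable by (simp add: amenable_group_def)

lemma exists_invariant:
  assumes "finite K" "K \<subseteq> carrier G" "\<delta> > 0"
  shows "\<exists>F. F \<in> left_invariant_sets G K \<delta>"
  using amenable assms unfolding amenable_group_def left_invariant_sets_def by blast

text \<open>Amenability says that no basic set of the filter is empty. This makes limits unique and
  turns eventual properties into frequent ones.\<close>

lemma left_invariance_neq_bot: "left_invariance G \<noteq> bot"
proof
  assume "left_invariance G = bot"
  then have "eventually (\<lambda>_. False) (left_invariance G)" by simp
  then show False
    unfolding eventually_left_invariance[OF is_group]
    using exists_invariant unfolding left_invariant_sets_def mem_Collect_eq by metis
qed

text \<open>Extends the base of the filter to empty \<open>K\<close>. For \<open>K = {}\<close> and
  bound 1, membership says just that \<open>F\<close> is a nonempty finite subset of the group, and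
  this is how that fact is obtained later.\<close>

lemma eventually_left_invariant_sets:
  assumes "finite K" "K \<subseteq> carrier G" "\<delta> > 0"
  shows "eventually (\<lambda>F. F \<in> left_invariant_sets G K \<delta>) (left_invariance G)"
proof (cases "K = {}")
  case True
  then show ?thesis
    unfolding eventually_left_invariance[OF is_group]
    using assms by (intro exI[of _ "{\<one>}"] exI[of _ 1])
      (auto simp: left_invariant_sets_def set_mult_def card_gt_0_iff)
next
  case False
  with assms show ?thesis
    unfolding eventually_left_invariance[OF is_group] left_invariant_sets_def by blast
qed

lemma frequently_left_invariance:
  assumes "frequently Q (left_invariance G)" "finite K" "K \<subseteq> carrier G" "\<delta> > 0"
  shows "\<exists>T\<in>left_invariant_sets G K \<delta>. Q T"
  using frequently_ex[OF frequently_eventually_frequently[OF assms(1) eventually_left_invariant_sets[OF assms(2-4)]]]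
  by blast

lemma UN_le:
  assumes "finite I" "\<And>i. i \<in> I \<Longrightarrow> finite (A i) \<and> A i \<subseteq> carrier G"
  shows "c (\<Union>i\<in>I. A i) \<le> (\<Sum>i\<in>I. c (A i))"
  using assms
proof (induction I rule: finite_induct)
  case (insert i I)
  have "c (\<Union>i\<in>insert i I. A i) = c (A i \<union> (\<Union>i\<in>I. A i))" by simp
  also have "\<dots> \<le> c (A i) + c (\<Union>i\<in>I. A i)" using insert by (intro subadd) auto
  finally show ?case using insert by simp
qed (simp add: empty)

lemma singleton_le:
  assumes "g \<in> carrier G"
  shows "c {g} \<le> c {\<one>}"
  using right_invariant[of "{\<one>}" g] assms by simp

text \<open>By subadditivity a set costs at most \<open>c {\<one>}\<close> per point. This pays for
  points left uncovered or trimmed off.\<close>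

lemma le_card:
  assumes "finite A" "A \<subseteq> carrier G"
  shows "c A \<le> c {\<one>} * real (card A)"
proof -
  have "c A = c (\<Union>a\<in>A. {a})" by simp
  also have "\<dots> \<le> (\<Sum>a\<in>A. c {a})" using assms by (intro UN_le) auto
  also have "\<dots> \<le> (\<Sum>a\<in>A. c {\<one>})" using assms singleton_le by (intro sum_mono) auto
  finally show ?thesis by (simp add: mult.commute)
qed

text \<open>The type of the tiled points stays arbitrary: tilings are needed inside the group and
  inside \<open>{1..n}\<close>.\<close>

lemma obtain_tiles:
  assumes "frequently Q (left_invariance G)" "0 < \<eta>" "\<eta> \<le> 1/2" "0 < \<kappa>"
  obtains \<T> \<beta> where "finite \<T>" "0 < \<beta>" "\<Union>\<T> \<noteq> {}"
    "\<And>T. T \<in> \<T> \<Longrightarrow> finite T \<and> T \<noteq> {} \<and> T \<subseteq> carrier G \<and> Q T"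
    "\<And>(D::'v set) B \<sigma>. partial_action G (\<Union>\<T>) D B \<sigma> \<Longrightarrow> real (card (D - B)) \<le> \<beta> * real (card D) \<Longrightarrow>
       \<exists>P. tile_family \<T> B \<sigma> \<eta> P \<and> real (card (D - tile_union \<sigma> P)) \<le> \<kappa> * real (card D)"
proof (rule exists_quasi_tiling_frequently[OF is_group _ assms(2-4), of Q])
  show "\<exists>T\<in>left_invariant_sets G K \<delta>. Q T" if "finite K" "K \<subseteq> carrier G" "\<delta> > 0" for K \<delta>
    using frequently_left_invariance[OF assms(1) that] .
qed (rule that)

text \<open>Tiles of density below \<open>l\<close> can be found as invariant as desired. Translates
  of them nearly cover every sufficiently invariant \<open>F\<close>: with overlaps they cost at
  most \<open>l / (1 - \<eta>)\<close> per point of \<open>F\<close>, and the uncovered proportion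
  \<open>\<eta>\<close> costs \<open>c {\<one>}\<close> per point.\<close>

lemma eventually_density_le:
  assumes freq: "frequently (\<lambda>T. c T < l * real (card T)) (left_invariance G)"
    and \<eta>: "0 < \<eta>" "\<eta> \<le> 1/2"
  shows "eventually (\<lambda>F. c F / real (card F) \<le> l / (1 - \<eta>) + c {\<one>} * \<eta>) (left_invariance G)"
proof -
  obtain \<T> \<beta> where \<T>: "finite \<T>" "0 < \<beta>" "\<Union>\<T> \<noteq> {}"
    "\<And>T. T \<in> \<T> \<Longrightarrow> finite T \<and> T \<noteq> {} \<and> T \<subseteq> carrier G \<and> c T < l * real (card T)"
    "\<And>(D::'g set) B \<sigma>. partial_action G (\<Union>\<T>) D B \<sigma> \<Longrightarrow> real (card (D - B)) \<le> \<beta> * real (card D) \<Longrightarrow>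
       \<exists>P. tile_family \<T> B \<sigma> \<eta> P \<and> real (card (D - tile_union \<sigma> P)) \<le> \<eta> * real (card D)"
    by (rule obtain_tiles[OF freq \<eta> \<eta>(1)]) (rule that)
  define K where "K = \<Union>\<T>"
  have K: "finite K" "K \<subseteq> carrier G" "K \<noteq> {}" using \<T>(1,3,4) by (auto simp: K_def)
  \<comment> \<open>Compensates the factor \<open>card K\<close> lost in
    \<open>card_translation_boundary\<close>.\<close>
  then have pos: "0 < \<beta> / real (card K)" using \<T>(2) by (simp add: card_gt_0_iff)
  obtain T0 where "T0 \<in> \<T>" using \<T>(3) by auto
  then have "0 \<le> c T0" "c T0 < l * real (card T0)" using \<T>(4) nonneg by auto
  then have l: "0 \<le> l" by (meson less_le_trans less_imp_le mult_nonpos_nonneg not_le of_nat_0_le_iff)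
  show ?thesis
  proof (rule eventually_mono[OF eventually_left_invariant_sets[OF K(1,2) pos]])
    fix F assume "F \<in> left_invariant_sets G K (\<beta> / real (card K))"
    then have F: "finite F" "F \<noteq> {}" "F \<subseteq> carrier G"
      and Finv: "real (card ((K <#>\<^bsub>G\<^esub> F) - F)) < \<beta> / real (card K) * real (card F)"
      by (auto simp: left_invariant_sets_def)
    define B where "B = {c\<in>F. \<forall>t\<in>K. t \<otimes>\<^bsub>G\<^esub> c \<in> F}"
    let ?\<sigma> = "\<lambda>t c. t \<otimes>\<^bsub>G\<^esub> c"
    have act: "partial_action G K F B ?\<sigma>"
      unfolding B_def by (rule translation_partial_action[OF is_group K(2) F(1,3)])
    have "real (card (F - B)) \<le> real (card K) * real (card ((K <#>\<^bsub>G\<^esub> F) - F))"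
      using card_translation_boundary[OF is_group K(2,1) F(1,3)] unfolding B_def
      by (simp flip: of_nat_mult)
    also have "\<dots> \<le> real (card K) * (\<beta> / real (card K) * real (card F))"
      using Finv by (intro mult_left_mono) auto
    also have "\<dots> = \<beta> * real (card F)" using K by (simp add: card_gt_0_iff)
    finally obtain P where P: "tile_family \<T> B ?\<sigma> \<eta> P"
      and rest: "real (card (F - tile_union ?\<sigma> P)) \<le> \<eta> * real (card F)"
      using \<T>(5)[of F B ?\<sigma>] act unfolding K_def by blast
    have \<T>': "\<And>T. T \<in> \<T> \<Longrightarrow> T \<subseteq> K \<and> finite T" using \<T>(4) by (auto simp: K_def)
    note f = tile_familyD[OF P]
    \<comment> \<open>Full translates, since the density bound is known for \<open>T\<close> and not
      for the trimmed \<open>S\<close>; subadditivity tolerates the overlaps.\<close>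
    define A :: "'g set \<times> 'g \<times> 'g set \<Rightarrow> 'g set" where "A = (\<lambda>(T, b, S). (\<lambda>t. t \<otimes>\<^bsub>G\<^esub> b) ` T)"
    have A: "finite (A x) \<and> A x \<subseteq> carrier G \<and> c (A x) \<le> l * real (card (fst x))" if "x \<in> P" for x
    proof -
      obtain T b S where x: "x = (T, b, S)" by (metis surj_pair)
      have b: "b \<in> carrier G" using f(3) that F unfolding x B_def by blast
      have T: "finite T" "T \<subseteq> carrier G" "c T < l * real (card T)"
        using f(2) that \<T>(4) unfolding x by auto
      show ?thesis
        using right_invariant[OF T(1,2) b] T b by (auto simp: x A_def)
    qed
    have AP: "finite (\<Union>x\<in>P. A x)" "(\<Union>x\<in>P. A x) \<subseteq> carrier G"
      using A f(1) by (blast, blast)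
    have "F \<subseteq> (\<Union>x\<in>P. A x) \<union> (F - tile_union ?\<sigma> P)"
      using f(4) by (fastforce simp: tile_union_def A_def)
    then have "c F \<le> c ((\<Union>x\<in>P. A x) \<union> (F - tile_union ?\<sigma> P))"
      using AP F by (intro mono) auto
    also have "\<dots> \<le> c (\<Union>x\<in>P. A x) + c (F - tile_union ?\<sigma> P)"
      using AP F by (intro subadd) auto
    also have "c (\<Union>x\<in>P. A x) \<le> (\<Sum>x\<in>P. c (A x))" using A f(1) by (intro UN_le) auto
    also have "\<dots> \<le> (\<Sum>x\<in>P. l * real (card (fst x)))" using A by (intro sum_mono) auto
    also have "\<dots> = l * (\<Sum>(T, b, S)\<in>P. real (card T))" by (simp add: sum_distrib_left case_prod_beta)
    also have "\<dots> \<le> l * (real (card F) / (1 - \<eta>))"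
      using sum_tile_card_le[OF act P \<T>'] \<eta> l by (intro mult_left_mono) (auto simp: field_simps)
    also have "c (F - tile_union ?\<sigma> P) \<le> c {\<one>} * real (card (F - tile_union ?\<sigma> P))"
      using F by (intro le_card) auto
    also have "\<dots> \<le> c {\<one>} * (\<eta> * real (card F))"
      using rest nonneg[of "{\<one>}"] by (intro mult_left_mono) auto
    finally have "c F \<le> (l / (1 - \<eta>) + c {\<one>} * \<eta>) * real (card F)" by (simp add: algebra_simps)
    then show "c F / real (card F) \<le> l / (1 - \<eta>) + c {\<one>} * \<eta>"
      using F by (simp add: divide_le_eq card_gt_0_iff)
  qed
qed

text \<open>The Ornstein--Weiss lemma: a number above the lower limit is undercut frequently, hence
  bounds the upper limit by \<open>eventually_density_le\<close>.\<close>

theorem density_converges: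
  obtains s where "0 \<le> s" "((\<lambda>F. c F / real (card F)) \<longlongrightarrow> s) (left_invariance G)"
proof -
  define f where "f F = ereal (c F / real (card F))" for F
  define L where "L = Liminf (left_invariance G) f"
  have ev: "eventually (\<lambda>F. F \<in> left_invariant_sets G {} 1) (left_invariance G)"
    by (rule eventually_left_invariant_sets) auto
  have f0: "eventually (\<lambda>F. 0 \<le> f F) (left_invariance G)"
    using ev by eventually_elim (auto simp: f_def left_invariant_sets_def intro!: divide_nonneg_nonneg nonneg)
  have f1: "eventually (\<lambda>F. f F \<le> ereal (c {\<one>})) (left_invariance G)"
    using ev by eventually_elim (auto simp: f_def left_invariant_sets_def divide_le_eq card_gt_0_iff intro!: le_card)
  have L0: "0 \<le> L" unfolding L_def by (rule Liminf_bounded[OF f0])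
  have LL: "L \<le> Limsup (left_invariance G) f"
    unfolding L_def by (rule Liminf_le_Limsup[OF left_invariance_neq_bot])
  also have "\<dots> \<le> ereal (c {\<one>})" by (rule Limsup_bounded[OF f1])
  finally have L1: "L \<le> ereal (c {\<one>})" .
  obtain s where s: "L = ereal s" using L0 L1 by (cases L) auto
  have upper: "Limsup (left_invariance G) f \<le> ereal l" if "s < l" for l
  proof -
    have freq: "frequently (\<lambda>T. c T < l * real (card T)) (left_invariance G)"
    proof (rule ccontr)
      assume "\<not> ?thesis"
      then have "eventually (\<lambda>T. l * real (card T) \<le> c T) (left_invariance G)"
        by (simp add: not_frequently not_less)
      with ev have "eventually (\<lambda>T. ereal l \<le> f T) (left_invariance G)"
        by eventually_elim (auto simp: f_def left_invariant_sets_def le_divide_eq card_gt_0_iff)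
      then have "ereal l \<le> L" unfolding L_def by (rule Liminf_bounded)
      with that s show False by simp
    qed
    \<comment> \<open>First the tiling parameter tends to 0 with \<open>l\<close> fixed;
      \<open>l\<close> decreases to \<open>s\<close> afterwards.\<close>
    have "eventually (\<lambda>\<eta>. Limsup (left_invariance G) f \<le> ereal (l / (1 - \<eta>) + c {\<one>} * \<eta>)) (at_right 0)"
      using small_parameter
    proof eventually_elim
      case (elim \<eta>)
      show ?case
        by (rule Limsup_bounded, rule eventually_mono[OF eventually_density_le[OF freq]])
          (use elim in \<open>auto simp: f_def\<close>)
    qed
    then show ?thesis
      by (rule tendsto_lowerbound[OF tendsto_ereal[OF perturbed_density_tendsto[of l "c {\<one>}"]]]) simp
  qed
  have "Limsup (left_invariance G) f \<le> L"
    unfolding s by (rule ereal_le_epsilon2) (simp add: upper)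
  with LL have "Limsup (left_invariance G) f = L" by simp
  then have "(f \<longlongrightarrow> ereal s) (left_invariance G)"
    using s L_def by (simp add: tendsto_iff_Liminf_eq_Limsup[OF left_invariance_neq_bot])
  then have "((\<lambda>F. c F / real (card F)) \<longlongrightarrow> s) (left_invariance G)" by (simp add: f_def[abs_def])
  with L0 s show thesis by (intro that[of s]) auto
qed

end

section \<open>Good points of sofic approximations\<close>

definition good_points ::
    "('g, 'm) monoid_scheme \<Rightarrow> 'g set \<Rightarrow> nat \<Rightarrow> ('g \<Rightarrow> nat \<Rightarrow> nat) \<Rightarrow> nat set" where
  "good_points G K n \<sigma> =
     {a\<in>{1..n}. (\<forall>s\<in>K. \<forall>t\<in>K. \<sigma> s (\<sigma> t a) = \<sigma> (s \<otimes>\<^bsub>G\<^esub> t) a) \<and> (\<forall>s\<in>K. \<forall>t\<in>K. s \<noteq> t \<longrightarrow> \<sigma> s a \<noteq> \<sigma> t a)}"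

text \<open>\<open>L\<close> must contain \<open>\<one>\<close> and the inverses from
  \<open>K\<close>, because a centre is recovered by applying \<open>\<sigma>\<close> of an inverse
  and using multiplicativity at the two centres.\<close>

lemma good_points_partial_action:
  assumes G: "group G" and perm: "\<And>s. s \<in> carrier G \<Longrightarrow> \<sigma> s permutes {1..n}"
    and L: "L \<subseteq> carrier G" "\<one>\<^bsub>G\<^esub> \<in> L" "K \<subseteq> L" "m_inv G ` K \<subseteq> L"
  shows "partial_action G K {1..n} (good_points G L n \<sigma>) \<sigma>"
proof -
  interpret group G by fact
  let ?B = "good_points G L n \<sigma>"
  have one: "\<sigma> \<one>\<^bsub>G\<^esub> c = c" if "c \<in> ?B" for c
  proof -
    \<comment> \<open>The approximation need not send \<open>\<one>\<close> to the identity; at a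
      good point \<open>\<sigma> \<one>\<close> is idempotent, and it is injective
      everywhere.\<close>
    have "\<sigma> \<one>\<^bsub>G\<^esub> (\<sigma> \<one>\<^bsub>G\<^esub> c) = \<sigma> \<one>\<^bsub>G\<^esub> c" using that L by (force simp: good_points_def)
    then show ?thesis using permutes_inj[OF perm[OF one_closed]] by (auto dest: injD)
  qed
  have mult: "\<sigma> s (\<sigma> t c) = \<sigma> (s \<otimes>\<^bsub>G\<^esub> t) c" if "c \<in> ?B" "s \<in> L" "t \<in> L" for s t c
    using that by (simp add: good_points_def)
  show ?thesis
    unfolding partial_action_def
  proof (intro conjI ballI impI)
    fix t s c c'
    assume h: "t \<in> K" "s \<in> K" "c \<in> ?B" "c' \<in> ?B" and eq: "\<sigma> t c = \<sigma> s c'"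
    then have car: "inv\<^bsub>G\<^esub> t \<in> L" "t \<in> L" "s \<in> L" "t \<in> carrier G" using L by auto
    have "\<sigma> (inv\<^bsub>G\<^esub> t) (\<sigma> t c) = c"
      using mult[OF h(3) car(1,2)] one[OF h(3)] car(4) by simp
    moreover have "\<sigma> (inv\<^bsub>G\<^esub> t) (\<sigma> s c') = \<sigma> (inv\<^bsub>G\<^esub> t \<otimes>\<^bsub>G\<^esub> s) c'"
      using mult[OF h(4) car(1,3)] .
    ultimately show "c = \<sigma> (inv\<^bsub>G\<^esub> t \<otimes>\<^bsub>G\<^esub> s) c'" using eq by simp
  next
    fix c t assume "c \<in> ?B" "t \<in> K"
    then have "c \<in> {1..n}" "t \<in> carrier G" using L by (auto simp: good_points_def)
    then show "\<sigma> t c \<in> {1..n}" using permutes_in_image[OF perm] by blast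
  next
    fix c assume c: "c \<in> ?B"
    show "inj_on (\<lambda>t. \<sigma> t c) K"
    proof (rule inj_onI, rule ccontr)
      fix s t assume "s \<in> K" "t \<in> K" "\<sigma> s c = \<sigma> t c" "s \<noteq> t"
      moreover from this have "s \<in> L" "t \<in> L" using L(3) by auto
      ultimately show False using c by (simp add: good_points_def)
    qed
  next
    fix t assume "t \<in> K"
    then have "inj (\<sigma> t)" using perm L permutes_inj by blast
    then show "inj_on (\<sigma> t) ?B" by (rule inj_on_subset) auto
  qed (auto simp: good_points_def)
qed

text \<open>A union bound over the finitely many pairs from \<open>L\<close> in the first two sofic
  axioms. With empty \<open>L\<close> it still yields that \<open>d i\<close> is eventually
  positive.\<close>

lemma eventually_good_points:
  assumes G: "group G" and sofic: "sofic_approximation G d \<sigma>"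
    and L: "finite L" "L \<subseteq> carrier G" and \<beta>: "0 < \<beta>"
  shows "eventually (\<lambda>i. 0 < d i \<and>
    real (card ({1..d i} - good_points G L (d i) (\<sigma> i))) \<le> \<beta> * real (d i)) sequentially"
proof -
  interpret group G by fact
  \<comment> \<open>Two exceptional sets for each pair; the added 1 keeps \<open>m\<close> positive
    when \<open>L\<close> is empty.\<close>
  define m where "m = 2 * real (card L * card L) + 1"
  have m: "0 < m" by (simp add: m_def add_nonneg_pos)
  have dpos: "eventually (\<lambda>i. 0 < d i) sequentially"
    using sofic unfolding sofic_approximation_def filterlim_at_top
    by (auto elim!: allE[of _ 1] simp: Suc_le_eq)
  let ?M = "\<lambda>i (s, t). {a\<in>{1..d i}. \<sigma> i s (\<sigma> i t a) \<noteq> \<sigma> i (s \<otimes>\<^bsub>G\<^esub> t) a}"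
  let ?E = "\<lambda>i (s, t). {a\<in>{1..d i}. s \<noteq> t \<and> \<sigma> i s a = \<sigma> i t a}"
  have M: "eventually (\<lambda>i. real (card (?M i x)) \<le> \<beta> / m * real (d i)) sequentially" if xL: "x \<in> L \<times> L" for x
  proof -
    obtain s t where x: "x = (s, t)" "s \<in> carrier G" "t \<in> carrier G" using xL L by auto
    have "(\<lambda>i. real (card {a\<in>{1..d i}. \<sigma> i s (\<sigma> i t a) = \<sigma> i (s \<otimes>\<^bsub>G\<^esub> t) a}) / real (d i)) \<longlonglongrightarrow> 1"
      using sofic x unfolding sofic_approximation_def by blast
    then have "eventually (\<lambda>i. 1 - \<beta> / m <
        real (card {a\<in>{1..d i}. \<sigma> i s (\<sigma> i t a) = \<sigma> i (s \<otimes>\<^bsub>G\<^esub> t) a}) / real (d i)) sequentially"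
      using \<beta> m by (intro order_tendstoD(1)) auto
    with dpos show ?thesis
    proof eventually_elim
      case (elim i)
      let ?A = "{a\<in>{1..d i}. \<sigma> i s (\<sigma> i t a) = \<sigma> i (s \<otimes>\<^bsub>G\<^esub> t) a}"
      have "{1..d i} = ?A \<union> ?M i x" by (auto simp: x)
      then have "d i = card (?A \<union> ?M i x)" by (metis card_atLeastAtMost diff_Suc_1)
      also have "\<dots> = card ?A + card (?M i x)" by (intro card_Un_disjoint) (auto simp: x)
      finally have "real (d i) = real (card ?A) + real (card (?M i x))" by linarith
      moreover have "(1 - \<beta> / m) * real (d i) < real (card ?A)"
        using elim by (simp add: less_divide_eq)
      ultimately show ?case by (simp add: algebra_simps)
    qed
  qed
  have E: "eventually (\<lambda>i. real (card (?E i x)) \<le> \<beta> / m * real (d i)) sequentially" if xL: "x \<in> L \<times> L" for x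
  proof -
    obtain s t where x: "x = (s, t)" "s \<in> carrier G" "t \<in> carrier G" using xL L by auto
    show ?thesis
    proof (cases "s = t")
      case True
      then show ?thesis using \<beta> m by (simp add: x)
    next
      case False
      then have "(\<lambda>i. real (card {a\<in>{1..d i}. \<sigma> i s a = \<sigma> i t a}) / real (d i)) \<longlonglongrightarrow> 0"
        using sofic x unfolding sofic_approximation_def by blast
      then have "eventually (\<lambda>i. real (card {a\<in>{1..d i}. \<sigma> i s a = \<sigma> i t a}) / real (d i) < \<beta> / m) sequentially"
        using \<beta> m by (intro order_tendstoD(2)) auto
      with dpos show ?thesis
        by eventually_elim (auto simp: x False divide_less_eq)
    qed
  qed
  have "eventually (\<lambda>i. \<forall>x\<in>L \<times> L. real (card (?M i x)) \<le> \<beta> / m * real (d i) \<and>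
      real (card (?E i x)) \<le> \<beta> / m * real (d i)) sequentially"
    using L M E by (intro eventually_ball_finite) (auto intro!: eventually_conj)
  with dpos show ?thesis
  proof eventually_elim
    case (elim i)
    have "{1..d i} - good_points G L (d i) (\<sigma> i) \<subseteq> (\<Union>x\<in>L \<times> L. ?M i x) \<union> (\<Union>x\<in>L \<times> L. ?E i x)"
      by (auto simp: good_points_def)
    then have "card ({1..d i} - good_points G L (d i) (\<sigma> i)) \<le>
        card ((\<Union>x\<in>L \<times> L. ?M i x) \<union> (\<Union>x\<in>L \<times> L. ?E i x))"
      using L by (intro card_mono) auto
    also have "\<dots> \<le> card (\<Union>x\<in>L \<times> L. ?M i x) + card (\<Union>x\<in>L \<times> L. ?E i x)" by (rule card_Un_le)
    also have "\<dots> \<le> (\<Sum>x\<in>L \<times> L. card (?M i x)) + (\<Sum>x\<in>L \<times> L. card (?E i x))"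
      using L by (intro add_mono card_UN_le) auto
    finally have "real (card ({1..d i} - good_points G L (d i) (\<sigma> i))) \<le>
        (\<Sum>x\<in>L \<times> L. real (card (?M i x))) + (\<Sum>x\<in>L \<times> L. real (card (?E i x)))"
      by (simp flip: of_nat_sum of_nat_add)
    also have "\<dots> \<le> (\<Sum>x\<in>L \<times> L. \<beta> / m * real (d i)) + (\<Sum>x\<in>L \<times> L. \<beta> / m * real (d i))"
      using elim by (intro add_mono sum_mono) auto
    also have "\<dots> = (m - 1) * (\<beta> / m * real (d i))" by (simp add: m_def card_cartesian_product)
    also have "\<dots> \<le> m * (\<beta> / m * real (d i))" using \<beta> m by (intro mult_right_mono) auto
    also have "\<dots> = \<beta> * real (d i)" using m by simp
    finally show ?case using elim by simp
  qed
qed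

section \<open>Covering numbers\<close>

text \<open>Nonemptiness of the space makes all covering numbers positive, so that their logarithms
  are real.\<close>

locale pseudometric_action =
  fixes G :: "('g, 'm) monoid_scheme" (structure) and X :: "'x topology"
    and \<alpha> :: "'g \<Rightarrow> 'x \<Rightarrow> 'x" and \<rho> :: "'x \<Rightarrow> 'x \<Rightarrow> real"
  assumes amenable: "amenable_group G" and compact: "compact_space X"
    and action: "continuous_action G X \<alpha>" and pseudometric: "continuous_pseudometric X \<rho>"
    and nonempty: "topspace X \<noteq> {}"
begin

sublocale group G
  using amenable by (simp add: amenable_group_def)

lemma act_closed [simp]: "\<lbrakk>s \<in> carrier G; x \<in> topspace X\<rbrakk> \<Longrightarrow> \<alpha> s x \<in> topspace X"
  using action unfolding continuous_action_def by (blast intro: group_action.element_image)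

lemma act_mult: "\<lbrakk>s \<in> carrier G; t \<in> carrier G; x \<in> topspace X\<rbrakk> \<Longrightarrow> \<alpha> (s \<otimes> t) x = \<alpha> s (\<alpha> t x)"
  using action unfolding continuous_action_def by (blast intro: group_action.composition_rule)

lemma act_one [simp]: "x \<in> topspace X \<Longrightarrow> \<alpha> \<one> x = x"
  using action unfolding continuous_action_def by (metis group_action.id_eq_one restrict_apply)

lemma rho_nonneg [simp]: "\<lbrakk>x \<in> topspace X; y \<in> topspace X\<rbrakk> \<Longrightarrow> 0 \<le> \<rho> x y"
  and rho_refl [simp]: "x \<in> topspace X \<Longrightarrow> \<rho> x x = 0"
  and rho_sym: "\<lbrakk>x \<in> topspace X; y \<in> topspace X\<rbrakk> \<Longrightarrow> \<rho> x y = \<rho> y x"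
  and rho_triangle: "\<lbrakk>x \<in> topspace X; y \<in> topspace X; z \<in> topspace X\<rbrakk> \<Longrightarrow> \<rho> x z \<le> \<rho> x y + \<rho> y z"
  using pseudometric unfolding continuous_pseudometric_def by blast+

text \<open>Compactness of the product space. The bound limits what one point of failing
  equivariance contributes to \<open>rho2\<close>.\<close>

lemma rho_bounded:
  obtains M where "0 < M" "\<And>x y. \<lbrakk>x \<in> topspace X; y \<in> topspace X\<rbrakk> \<Longrightarrow> \<rho> x y \<le> M"
proof -
  have cont: "continuous_map (prod_topology X X) euclideanreal (\<lambda>(x, y). \<rho> x y)"
    using pseudometric by (simp add: continuous_pseudometric_def)
  have "compactin (prod_topology X X) (topspace X \<times> topspace X)"
    using compact by (simp add: compactin_Times compact_space_def)
  from image_compactin[OF this cont]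
  have "bounded ((\<lambda>(x, y). \<rho> x y) ` (topspace X \<times> topspace X))"
    by (simp add: compact_imp_bounded)
  then obtain M where M: "0 < M" "\<forall>v\<in>(\<lambda>(x, y). \<rho> x y) ` (topspace X \<times> topspace X). norm v \<le> M"
    unfolding bounded_pos by blast
  then show thesis by (intro that[of M]) force+
qed

text \<open>The Bowen ball, written without the maximum of \<open>rho_set\<close> so that it also
  makes sense for empty \<open>F\<close>, where the induction in \<open>openin_dyn_ball\<close>
  starts.\<close>

definition dyn_ball :: "'g set \<Rightarrow> 'x \<Rightarrow> real \<Rightarrow> 'x set" where
  "dyn_ball F x r = {y\<in>topspace X. \<forall>s\<in>F. \<rho> (\<alpha> s x) (\<alpha> s y) < r}"

lemma openin_dyn_ball:
  assumes F: "finite F" "F \<subseteq> carrier G" and x: "x \<in> topspace X"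
  shows "openin X (dyn_ball F x r)"
proof -
  have one: "openin X {y\<in>topspace X. \<rho> (\<alpha> s x) (\<alpha> s y) < r}" if s: "s \<in> carrier G" for s
  proof -
    have "continuous_map X X (\<alpha> s)" using action s by (simp add: continuous_action_def)
    then have "continuous_map X (prod_topology X X) (\<lambda>y. (\<alpha> s x, \<alpha> s y))"
      using x s by (intro continuous_map_pairedI) auto
    then have "continuous_map X euclideanreal ((\<lambda>(x, y). \<rho> x y) \<circ> (\<lambda>y. (\<alpha> s x, \<alpha> s y)))"
      using pseudometric by (intro continuous_map_compose) (auto simp: continuous_pseudometric_def)
    then have c: "continuous_map X euclideanreal (\<lambda>y. \<rho> (\<alpha> s x) (\<alpha> s y))" by (simp add: o_def)
    have "openin X {y\<in>topspace X. \<rho> (\<alpha> s x) (\<alpha> s y) \<in> {..<r}}"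
      by (rule openin_continuous_map_preimage[OF c]) simp
    then show ?thesis by simp
  qed
  show ?thesis
    using F
  proof (induction F rule: finite_induct)
    case (insert s F)
    have "dyn_ball (insert s F) x r = {y\<in>topspace X. \<rho> (\<alpha> s x) (\<alpha> s y) < r} \<inter> dyn_ball F x r"
      by (auto simp: dyn_ball_def)
    then show ?case using insert one by (simp add: openin_Int)
  qed (simp add: dyn_ball_def)
qed

lemma dyn_ball_diameter:
  assumes F: "F \<subseteq> carrier G" and x: "x \<in> topspace X" and y: "y \<in> dyn_ball F x r" and z: "z \<in> dyn_ball F x r"
    and s: "s \<in> F"
  shows "\<rho> (\<alpha> s y) (\<alpha> s z) \<le> 2 * r"
proof -
  have c: "\<alpha> s x \<in> topspace X" "\<alpha> s y \<in> topspace X" "\<alpha> s z \<in> topspace X"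
    using assms by (auto simp: dyn_ball_def)
  have "\<rho> (\<alpha> s x) (\<alpha> s y) < r" "\<rho> (\<alpha> s x) (\<alpha> s z) < r" using y z s by (auto simp: dyn_ball_def)
  then show ?thesis using rho_triangle[OF c(2,1,3)] rho_sym[OF c(1,2)] by linarith
qed

text \<open>A uniform \<open>r\<close> below \<open>\<epsilon>\<close> expresses a strict bound on
  suprema without mentioning them; \<open>0 \<le> r\<close> accounts for the value 0 of
  \<open>pdiam {}\<close>.\<close>

definition fine_cover :: "'g set \<Rightarrow> real \<Rightarrow> 'x set set \<Rightarrow> bool" where
  "fine_cover F \<epsilon> \<U> \<longleftrightarrow> finite_open_cover X \<U> \<and>
     (\<exists>r\<ge>0. r < \<epsilon> \<and> (\<forall>V\<in>\<U>. \<forall>x\<in>V. \<forall>y\<in>V. \<forall>s\<in>F. \<rho> (\<alpha> s x) (\<alpha> s y) \<le> r))"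

lemma fine_cover_iff_mesh:
  assumes F: "finite F" "F \<noteq> {}" "F \<subseteq> carrier G" and \<epsilon>: "0 < \<epsilon>"
  shows "fine_cover F \<epsilon> \<U> \<longleftrightarrow> finite_open_cover X \<U> \<and> mesh \<U> (rho_set \<alpha> \<rho> F) < \<epsilon>"
proof (cases "finite_open_cover X \<U>")
  case True
  then have fin: "finite \<U>" and sub: "\<And>V. V \<in> \<U> \<Longrightarrow> V \<subseteq> topspace X" and ne: "\<U> \<noteq> {}"
    using nonempty unfolding finite_open_cover_def by blast+
  obtain M where M: "0 < M" "\<And>x y. \<lbrakk>x \<in> topspace X; y \<in> topspace X\<rbrakk> \<Longrightarrow> \<rho> x y \<le> M"
    by (rule rho_bounded) blast
  \<comment> \<open>Boundedness is what makes the real supremum in \<open>pdiam\<close> an upper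
    bound.\<close>
  have bdd: "bdd_above ((\<lambda>(x, y). rho_set \<alpha> \<rho> F x y) ` (V \<times> V))" if V: "V \<in> \<U>" for V
  proof (rule bdd_aboveI2)
    fix p assume "p \<in> V \<times> V"
    then obtain x y where p: "p = (x, y)" "x \<in> topspace X" "y \<in> topspace X" using sub[OF V] by auto
    then have "\<forall>s\<in>F. \<rho> (\<alpha> s x) (\<alpha> s y) \<le> M" using F(3) M(2) by (simp add: subset_iff)
    then show "(case p of (x, y) \<Rightarrow> rho_set \<alpha> \<rho> F x y) \<le> M"
      using F(1,2) by (simp add: rho_set_def p)
  qed
  have le_diam: "\<rho> (\<alpha> s x) (\<alpha> s y) \<le> pdiam (rho_set \<alpha> \<rho> F) V"
    if "V \<in> \<U>" "x \<in> V" "y \<in> V" "s \<in> F" for V x y s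
  proof -
    have "\<rho> (\<alpha> s x) (\<alpha> s y) \<le> rho_set \<alpha> \<rho> F x y" using F that by (auto simp: rho_set_def)
    also have "\<dots> \<le> (SUP (x, y)\<in>V \<times> V. rho_set \<alpha> \<rho> F x y)"
      using cSUP_upper[OF _ bdd[OF that(1)], of "(x, y)"] that by simp
    finally show ?thesis using that by (auto simp: pdiam_def)
  qed
  have "mesh \<U> (rho_set \<alpha> \<rho> F) < \<epsilon> \<longleftrightarrow> (\<forall>V\<in>\<U>. pdiam (rho_set \<alpha> \<rho> F) V < \<epsilon>)"
    using fin ne by (simp add: mesh_def)
  moreover have "\<exists>r\<ge>0. r < \<epsilon> \<and> (\<forall>V\<in>\<U>. \<forall>x\<in>V. \<forall>y\<in>V. \<forall>s\<in>F. \<rho> (\<alpha> s x) (\<alpha> s y) \<le> r)"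
    if m: "mesh \<U> (rho_set \<alpha> \<rho> F) < \<epsilon>"
  proof (intro exI[of _ "max 0 (mesh \<U> (rho_set \<alpha> \<rho> F))"] conjI ballI)
    fix V x y s assume h: "V \<in> \<U>" "x \<in> V" "y \<in> V" "s \<in> F"
    have "pdiam (rho_set \<alpha> \<rho> F) V \<le> mesh \<U> (rho_set \<alpha> \<rho> F)"
      using fin ne h by (simp add: mesh_def)
    with le_diam[OF h] show "\<rho> (\<alpha> s x) (\<alpha> s y) \<le> max 0 (mesh \<U> (rho_set \<alpha> \<rho> F))" by simp
  qed (use \<epsilon> m in auto)
  moreover have "pdiam (rho_set \<alpha> \<rho> F) V \<le> r"
    if "r \<ge> 0" "\<forall>V\<in>\<U>. \<forall>x\<in>V. \<forall>y\<in>V. \<forall>s\<in>F. \<rho> (\<alpha> s x) (\<alpha> s y) \<le> r" "V \<in> \<U>" for r V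
  proof (cases "V = {}")
    case False
    have "rho_set \<alpha> \<rho> F x y \<le> r" if "x \<in> V" "y \<in> V" for x y
      using F(1,2) that \<open>V \<in> \<U>\<close> \<open>\<forall>V\<in>\<U>. \<forall>x\<in>V. \<forall>y\<in>V. \<forall>s\<in>F. \<rho> (\<alpha> s x) (\<alpha> s y) \<le> r\<close>
      by (simp add: rho_set_def)
    then show ?thesis using False unfolding pdiam_def by (auto intro!: cSUP_least)
  qed (simp add: pdiam_def \<open>0 \<le> r\<close>)
  ultimately show ?thesis using True unfolding fine_cover_def by (meson le_less_trans)
qed (simp add: fine_cover_def)

lemma exists_fine_cover:
  assumes F: "finite F" "F \<subseteq> carrier G" and \<epsilon>: "0 < \<epsilon>"
  shows "\<exists>\<U>. fine_cover F \<epsilon> \<U>"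
proof -
  \<comment> \<open>Balls of radius \<open>\<epsilon>/3\<close> have diameter at most
    \<open>2 * (\<epsilon>/3)\<close>, strictly below \<open>\<epsilon>\<close>.\<close>
  let ?\<B> = "(\<lambda>x. dyn_ball F x (\<epsilon>/3)) ` topspace X"
  have "x \<in> dyn_ball F x (\<epsilon>/3)" if "x \<in> topspace X" for x
    using that F \<epsilon> by (auto simp: dyn_ball_def subset_iff)
  then have cov: "topspace X \<subseteq> \<Union>?\<B>" by blast
  have "\<forall>U\<in>?\<B>. openin X U" using openin_dyn_ball[OF F] by auto
  then obtain \<U> where \<U>: "finite \<U>" "\<U> \<subseteq> ?\<B>" "topspace X \<subseteq> \<Union>\<U>"
    using compact[unfolded compact_space_alt, rule_format, of ?\<B>] cov by auto
  have op: "openin X U" if "U \<in> \<U>" for U using that \<U>(2) openin_dyn_ball[OF F] by auto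
  then have "\<Union>\<U> \<subseteq> topspace X" using openin_subset by blast
  with \<U> op have "finite_open_cover X \<U>" by (auto simp: finite_open_cover_def)
  moreover have "\<rho> (\<alpha> s x) (\<alpha> s y) \<le> 2 * (\<epsilon>/3)" if "V \<in> \<U>" "x \<in> V" "y \<in> V" "s \<in> F" for V x y s
    using that \<U>(2) dyn_ball_diameter[OF F(2)] by blast
  ultimately show ?thesis using \<epsilon> unfolding fine_cover_def
    by (intro exI[of _ \<U>] conjI exI[of _ "2 * (\<epsilon>/3)"]) auto
qed

section \<open>Covering numbers as a subadditive set function\<close>

abbreviation cov_num :: "real \<Rightarrow> 'g set \<Rightarrow> nat" where
  "cov_num \<epsilon> F \<equiv> min_cover X (rho_set \<alpha> \<rho> F) \<epsilon>"

lemma cov_num_le: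
  assumes "finite F" "F \<noteq> {}" "F \<subseteq> carrier G" "0 < \<epsilon>" "fine_cover F \<epsilon> \<U>"
  shows "cov_num \<epsilon> F \<le> card \<U>"
  unfolding min_cover_def using assms by (intro Least_le) (auto simp: fine_cover_iff_mesh)

lemma cov_num_attained:
  assumes F: "finite F" "F \<noteq> {}" "F \<subseteq> carrier G" and \<epsilon>: "0 < \<epsilon>"
  obtains \<U> where "fine_cover F \<epsilon> \<U>" "card \<U> = cov_num \<epsilon> F"
proof -
  have "\<exists>n \<U>. finite_open_cover X \<U> \<and> mesh \<U> (rho_set \<alpha> \<rho> F) < \<epsilon> \<and> card \<U> = n"
    using exists_fine_cover[OF F(1,3) \<epsilon>] by (simp add: fine_cover_iff_mesh[OF F \<epsilon>])
  from LeastI_ex[OF this] show thesis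
    using that unfolding min_cover_def[symmetric] by (auto simp: fine_cover_iff_mesh[OF F \<epsilon>])
qed

lemma cov_num_pos:
  assumes F: "finite F" "F \<noteq> {}" "F \<subseteq> carrier G" and \<epsilon>: "0 < \<epsilon>"
  shows "0 < cov_num \<epsilon> F"
proof -
  obtain \<U> where \<U>: "fine_cover F \<epsilon> \<U>" "card \<U> = cov_num \<epsilon> F" by (rule cov_num_attained[OF F \<epsilon>])
  then have "finite \<U>" "\<U> \<noteq> {}"
    using nonempty unfolding fine_cover_def finite_open_cover_def by blast+
  then show ?thesis using \<U>(2) by (metis card_gt_0_iff)
qed

lemma cov_num_mono:
  assumes "finite B" "B \<subseteq> carrier G" "A \<subseteq> B" "A \<noteq> {}" and \<epsilon>: "0 < \<epsilon>"
  shows "cov_num \<epsilon> A \<le> cov_num \<epsilon> B"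
proof -
  obtain \<U> where \<U>: "fine_cover B \<epsilon> \<U>" "card \<U> = cov_num \<epsilon> B"
    by (rule cov_num_attained[of B \<epsilon>]) (use assms in auto)
  then obtain r where "0 \<le> r" "r < \<epsilon>" "finite_open_cover X \<U>"
    "\<And>V x y s. \<lbrakk>V \<in> \<U>; x \<in> V; y \<in> V; s \<in> B\<rbrakk> \<Longrightarrow> \<rho> (\<alpha> s x) (\<alpha> s y) \<le> r"
    unfolding fine_cover_def by auto
  with assms(3) have "fine_cover A \<epsilon> \<U>"
    unfolding fine_cover_def by (intro conjI exI[of _ r]) auto
  then show ?thesis using cov_num_le[of A \<epsilon> \<U>] assms \<U>(2) finite_subset[of A B] by auto
qed

text \<open>The common refinement of a cover for \<open>A\<close> and a cover for \<open>B\<close>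
  is fine for the union.\<close>

lemma cov_num_submult:
  assumes A: "finite A" "A \<noteq> {}" "A \<subseteq> carrier G" and B: "finite B" "B \<noteq> {}" "B \<subseteq> carrier G"
    and \<epsilon>: "0 < \<epsilon>"
  shows "cov_num \<epsilon> (A \<union> B) \<le> cov_num \<epsilon> A * cov_num \<epsilon> B"
proof -
  obtain \<U> where \<U>: "fine_cover A \<epsilon> \<U>" "card \<U> = cov_num \<epsilon> A" by (rule cov_num_attained[OF A \<epsilon>])
  obtain \<V> where \<V>: "fine_cover B \<epsilon> \<V>" "card \<V> = cov_num \<epsilon> B" by (rule cov_num_attained[OF B \<epsilon>])
  obtain r where r: "0 \<le> r" "r < \<epsilon>" "\<forall>V\<in>\<U>. \<forall>x\<in>V. \<forall>y\<in>V. \<forall>s\<in>A. \<rho> (\<alpha> s x) (\<alpha> s y) \<le> r"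
    using \<U>(1) unfolding fine_cover_def by blast
  obtain r' where r': "0 \<le> r'" "r' < \<epsilon>" "\<forall>V\<in>\<V>. \<forall>x\<in>V. \<forall>y\<in>V. \<forall>s\<in>B. \<rho> (\<alpha> s x) (\<alpha> s y) \<le> r'"
    using \<V>(1) unfolding fine_cover_def by blast
  have oU: "finite \<U>" "\<And>U. U \<in> \<U> \<Longrightarrow> openin X U" "\<Union>\<U> = topspace X"
    and oV: "finite \<V>" "\<And>U. U \<in> \<V> \<Longrightarrow> openin X U" "\<Union>\<V> = topspace X"
    using \<U>(1) \<V>(1) by (auto simp: fine_cover_def finite_open_cover_def)
  let ?W = "(\<lambda>(U, V). U \<inter> V) ` (\<U> \<times> \<V>)"
  have "\<Union>?W = \<Union>\<U> \<inter> \<Union>\<V>" by auto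
  then have cov: "finite_open_cover X ?W"
    using oU oV by (auto simp: finite_open_cover_def)
  have small: "\<rho> (\<alpha> s x) (\<alpha> s y) \<le> max r r'" if W: "W \<in> ?W" "x \<in> W" "y \<in> W" "s \<in> A \<union> B" for W x y s
  proof -
    obtain U V where "U \<in> \<U>" "V \<in> \<V>" "W = U \<inter> V" using W(1) by auto
    then show ?thesis using W(2-4) r(3) r'(3) by (auto simp: le_max_iff_disj)
  qed
  have "fine_cover (A \<union> B) \<epsilon> ?W"
    unfolding fine_cover_def
  proof (intro conjI cov exI[of _ "max r r'"] ballI)
  qed (use r r' small in auto)
  then have "cov_num \<epsilon> (A \<union> B) \<le> card ?W" using A B \<epsilon> by (intro cov_num_le) auto
  also have "\<dots> \<le> card \<U> * card \<V>"
    using card_image_le[of "\<U> \<times> \<V>"] oU oV by (simp add: card_cartesian_product)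
  finally show ?thesis by (simp add: \<U> \<V>)
qed

text \<open>Pull a cover back along \<open>\<alpha> g\<close>: moving \<open>x\<close> by
  \<open>t \<otimes> g\<close> is moving \<open>\<alpha> g x\<close> by \<open>t\<close>.\<close>

lemma cov_num_translate:
  assumes A: "finite A" "A \<noteq> {}" "A \<subseteq> carrier G" and g: "g \<in> carrier G" and \<epsilon>: "0 < \<epsilon>"
  shows "cov_num \<epsilon> ((\<lambda>t. t \<otimes> g) ` A) \<le> cov_num \<epsilon> A"
proof -
  obtain \<U> where \<U>: "fine_cover A \<epsilon> \<U>" "card \<U> = cov_num \<epsilon> A" by (rule cov_num_attained[OF A \<epsilon>])
  obtain r where r: "0 \<le> r" "r < \<epsilon>" "\<forall>V\<in>\<U>. \<forall>x\<in>V. \<forall>y\<in>V. \<forall>s\<in>A. \<rho> (\<alpha> s x) (\<alpha> s y) \<le> r"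
    using \<U>(1) unfolding fine_cover_def by blast
  have oU: "finite \<U>" "\<And>U. U \<in> \<U> \<Longrightarrow> openin X U" "\<Union>\<U> = topspace X"
    using \<U>(1) by (auto simp: fine_cover_def finite_open_cover_def)
  let ?W = "(\<lambda>U. {x\<in>topspace X. \<alpha> g x \<in> U}) ` \<U>"
  have cont: "continuous_map X X (\<alpha> g)" using action g by (simp add: continuous_action_def)
  have "\<Union>?W = {x\<in>topspace X. \<alpha> g x \<in> \<Union>\<U>}" by auto
  then have cov: "finite_open_cover X ?W"
    using oU g openin_continuous_map_preimage[OF cont] by (auto simp: finite_open_cover_def)
  have "fine_cover ((\<lambda>t. t \<otimes> g) ` A) \<epsilon> ?W"
    unfolding fine_cover_def
  proof (intro conjI cov exI[of _ r] ballI)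
    fix W x y s assume h: "W \<in> ?W" "x \<in> W" "y \<in> W" "s \<in> (\<lambda>t. t \<otimes> g) ` A"
    then obtain U t where U: "U \<in> \<U>" "W = {x\<in>topspace X. \<alpha> g x \<in> U}" "t \<in> A" "s = t \<otimes> g" by auto
    then have "\<alpha> s x = \<alpha> t (\<alpha> g x)" "\<alpha> s y = \<alpha> t (\<alpha> g y)" using h g A by (auto simp: act_mult subset_iff)
    moreover have "\<alpha> g x \<in> U" "\<alpha> g y \<in> U" using U h by auto
    ultimately show "\<rho> (\<alpha> s x) (\<alpha> s y) \<le> r" using r(3) U by simp
  qed (use r in auto)
  then have "cov_num \<epsilon> ((\<lambda>t. t \<otimes> g) ` A) \<le> card ?W" using A \<epsilon> g by (intro cov_num_le) auto
  also have "\<dots> \<le> card \<U>" using oU by (intro card_image_le)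
  finally show ?thesis by (simp add: \<U>)
qed

text \<open>The value at the empty set is prescribed because \<open>rho_set\<close> would take a
  maximum over it.\<close>

definition cov_log :: "real \<Rightarrow> 'g set \<Rightarrow> real" where
  "cov_log \<epsilon> F = (if F = {} then 0 else ln (real (cov_num \<epsilon> F)))"

lemma cov_log_subadditive:
  assumes \<epsilon>: "0 < \<epsilon>"
  shows "subadditive_set_function G (cov_log \<epsilon>)"
proof
  show "amenable_group G" by (rule amenable)
  show "cov_log \<epsilon> {} = 0" by (simp add: cov_log_def)
  have pos: "1 \<le> real (cov_num \<epsilon> A)" if "finite A" "A \<noteq> {}" "A \<subseteq> carrier G" for A
    using cov_num_pos[OF that \<epsilon>] by linarith
  show nn: "0 \<le> cov_log \<epsilon> A" if "finite A" "A \<subseteq> carrier G" for A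
    using pos[of A] that by (auto simp: cov_log_def)
  show "cov_log \<epsilon> A \<le> cov_log \<epsilon> B" if h: "finite B" "B \<subseteq> carrier G" "A \<subseteq> B" for A B
  proof (cases "A = {}")
    case True
    then show ?thesis using nn[OF h(1,2)] by (simp add: cov_log_def)
  next
    case False
    then have "1 \<le> real (cov_num \<epsilon> A)" "B \<noteq> {}" using h pos[of A] finite_subset[of A B] by auto
    then show ?thesis using cov_num_mono[OF h False \<epsilon>] False by (auto simp: cov_log_def)
  qed
  show "cov_log \<epsilon> (A \<union> B) \<le> cov_log \<epsilon> A + cov_log \<epsilon> B"
    if h: "finite A" "A \<subseteq> carrier G" "finite B" "B \<subseteq> carrier G" for A B
  proof (cases "A = {} \<or> B = {}")
    case True
    then show ?thesis by (auto simp: cov_log_def)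
  next
    case False
    then have p: "1 \<le> real (cov_num \<epsilon> A)" "1 \<le> real (cov_num \<epsilon> B)" "1 \<le> real (cov_num \<epsilon> (A \<union> B))"
      using h pos[of A] pos[of B] pos[of "A \<union> B"] by auto
    have "real (cov_num \<epsilon> (A \<union> B)) \<le> real (cov_num \<epsilon> A) * real (cov_num \<epsilon> B)"
      using cov_num_submult[of A B \<epsilon>] False h \<epsilon> by (simp flip: of_nat_mult)
    then have "ln (real (cov_num \<epsilon> (A \<union> B))) \<le> ln (real (cov_num \<epsilon> A) * real (cov_num \<epsilon> B))"
      using p by (subst ln_le_cancel_iff) (auto intro: less_le_trans)
    also have "\<dots> = ln (real (cov_num \<epsilon> A)) + ln (real (cov_num \<epsilon> B))" using p by (intro ln_mult_pos) auto
    finally show ?thesis using False by (simp add: cov_log_def)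
  qed
  show "cov_log \<epsilon> ((\<lambda>t. t \<otimes> g) ` A) \<le> cov_log \<epsilon> A"
    if h: "finite A" "A \<subseteq> carrier G" "g \<in> carrier G" for A g
  proof (cases "A = {}")
    case False
    then have "1 \<le> real (cov_num \<epsilon> ((\<lambda>t. t \<otimes> g) ` A))" using h by (intro pos) auto
    then show ?thesis using cov_num_translate[of A g \<epsilon>] False h \<epsilon> by (auto simp: cov_log_def)
  qed (simp add: cov_log_def)
qed

text \<open>Connects \<open>Lim\<close> in the extended reals with the real limit from
  \<open>density_converges\<close>; uniqueness of limits needs the filter to be proper.\<close>

lemma S_cover_eq_limit:
  assumes \<epsilon>: "0 < \<epsilon>"
  obtains s where "0 \<le> s" "S_cover G X \<alpha> \<epsilon> \<rho> = ereal s"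
    "((\<lambda>F. cov_log \<epsilon> F / real (card F)) \<longlongrightarrow> s) (left_invariance G)"
proof -
  interpret c: subadditive_set_function G "cov_log \<epsilon>" by (rule cov_log_subadditive[OF \<epsilon>])
  obtain s where s: "0 \<le> s" "((\<lambda>F. cov_log \<epsilon> F / real (card F)) \<longlongrightarrow> s) (left_invariance G)"
    by (rule c.density_converges)
  have "eventually (\<lambda>F. F \<in> left_invariant_sets G {} 1) (left_invariance G)"
    by (rule c.eventually_left_invariant_sets) auto
  then have "eventually (\<lambda>F. ereal (cov_log \<epsilon> F / real (card F)) =
      log_card (enat (cov_num \<epsilon> F)) / ereal (real (card F))) (left_invariance G)"
  proof eventually_elim
    case (elim F)
    then have F: "finite F" "F \<noteq> {}" "F \<subseteq> carrier G" by (auto simp: left_invariant_sets_def)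
    then show ?case using cov_num_pos[OF F \<epsilon>] by (simp add: cov_log_def log_card_def)
  qed
  moreover have "((\<lambda>F. ereal (cov_log \<epsilon> F / real (card F))) \<longlongrightarrow> ereal s) (left_invariance G)"
    using s(2) by simp
  ultimately have "((\<lambda>F. log_card (enat (cov_num \<epsilon> F)) / ereal (real (card F))) \<longlongrightarrow> ereal s) (left_invariance G)"
    by (rule Lim_transform_eventually[rotated])
  then have "S_cover G X \<alpha> \<epsilon> \<rho> = ereal s"
    unfolding S_cover_def by (intro tendsto_Lim c.left_invariance_neq_bot)
  with s show thesis by (intro that)
qed

end

section \<open>Upper bound for the sofic quantity\<close>

lemma log_card_mono: "m \<le> n \<Longrightarrow> log_card m \<le> log_card n"
  by (cases m; cases n) (auto simp: log_card_def)

lemma log_card_sep_number_le: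
  assumes "\<And>Z. \<lbrakk>Z \<subseteq> Y; finite Z; separated_set \<rho> \<epsilon> Z\<rbrakk> \<Longrightarrow> real (card Z) \<le> exp b"
  shows "log_card (sep_number Y \<rho> \<epsilon>) \<le> ereal b"
proof -
  \<comment> \<open>\<open>sep_number\<close> is a supremum of natural numbers, so the real bound is
    rounded down; \<open>k = 0\<close> leads to the value -infinity.\<close>
  define k where "k = nat \<lfloor>exp b\<rfloor>"
  have k: "real k \<le> exp b" by (simp add: k_def)
  have "sep_number Y \<rho> \<epsilon> \<le> enat k"
    unfolding sep_number_def
  proof (rule SUP_least)
    fix Z assume "Z \<in> {Z. Z \<subseteq> Y \<and> finite Z \<and> separated_set \<rho> \<epsilon> Z}"
    then have "real (card Z) \<le> exp b" using assms by blast
    then show "enat (card Z) \<le> enat k" by (simp add: k_def le_nat_floor)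
  qed
  then have "log_card (sep_number Y \<rho> \<epsilon>) \<le> log_card (enat k)" by (rule log_card_mono)
  also have "\<dots> \<le> ereal b"
  proof (cases "k = 0")
    case False
    then have "ln (real k) \<le> ln (exp b)" using k by (subst ln_le_cancel_iff) auto
    then show ?thesis by (simp add: log_card_def False)
  qed (simp add: log_card_def)
  finally show ?thesis .
qed

lemma log_card_sep_number_ge:
  assumes "Z \<subseteq> Y" "finite Z" "Z \<noteq> {}" "separated_set \<rho> \<epsilon> Z"
  shows "ereal (ln (real (card Z))) \<le> log_card (sep_number Y \<rho> \<epsilon>)"
proof -
  have "enat (card Z) \<le> sep_number Y \<rho> \<epsilon>"
    unfolding sep_number_def using assms by (intro SUP_upper) auto
  from log_card_mono[OF this] show ?thesis
    using assms by (simp add: log_card_def)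
qed

text \<open>Chernoff's bound: weigh every subset \<open>\<Lambda>\<close> by \<open>exp (u * (m - card \<Lambda>))\<close>.\<close>

lemma card_small_subsets_le:
  assumes D: "finite D" and u: "0 \<le> u"
  shows "real (card {\<Lambda>. \<Lambda> \<subseteq> D \<and> real (card \<Lambda>) \<le> m}) \<le> exp (u * m + exp (-u) * real (card D))"
proof -
  let ?s = "{\<Lambda>. \<Lambda> \<subseteq> D \<and> real (card \<Lambda>) \<le> m}"
  have "real (card ?s) = (\<Sum>\<Lambda>\<in>?s. 1)" by simp
  also have "\<dots> \<le> (\<Sum>\<Lambda>\<in>?s. exp (u * m) * exp (-u) ^ card \<Lambda>)"
  proof (rule sum_mono)
    fix \<Lambda> assume "\<Lambda> \<in> ?s"
    then have "0 \<le> u * (m - real (card \<Lambda>))" using u by simp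
    then have "1 \<le> exp (u * m - u * real (card \<Lambda>))" by (simp add: algebra_simps)
    also have "\<dots> = exp (u * m) * exp (-u) ^ card \<Lambda>"
      by (simp add: exp_diff exp_minus field_simps flip: exp_of_nat_mult)
    finally show "1 \<le> exp (u * m) * exp (-u) ^ card \<Lambda>" .
  qed
  also have "\<dots> \<le> (\<Sum>\<Lambda>\<in>Pow D. exp (u * m) * exp (-u) ^ card \<Lambda>)"
    using D by (intro sum_mono2) auto
  \<comment> \<open>Expanding \<open>(exp (-u) + 1) ^ card D\<close> produces one term for every
    subset of \<open>D\<close>.\<close>
  also have "\<dots> = exp (u * m) * (exp (-u) + 1) ^ card D"
    using prod_add[OF D, of "\<lambda>_. exp (-u)" "\<lambda>_. 1"] by (simp add: sum_distrib_left)
  also have "\<dots> \<le> exp (u * m) * exp (exp (-u)) ^ card D"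
    by (intro mult_left_mono power_mono) (auto simp: add.commute add_nonneg_nonneg)
  also have "\<dots> = exp (u * m + exp (-u) * real (card D))"
    by (simp add: exp_add mult.commute flip: exp_of_nat_mult)
  finally show ?thesis .
qed

section \<open>Coding separated maps by cover elements\<close>

context pseudometric_action
begin

definition bad_points :: "'g set \<Rightarrow> real \<Rightarrow> nat \<Rightarrow> ('g \<Rightarrow> nat \<Rightarrow> nat) \<Rightarrow> (nat \<Rightarrow> 'x) \<Rightarrow> nat set" where
  "bad_points K r n \<sigma> \<phi> = {a\<in>{1..n}. \<exists>s\<in>K. r < \<rho> (\<phi> (\<sigma> s a)) (\<alpha> s (\<phi> a))}"

text \<open>Chebyshev's inequality for the mean square \<open>rho2\<close>, summed over
  \<open>K\<close>.\<close>

lemma card_bad_points_le: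
  assumes \<phi>: "\<phi> \<in> Map_space X \<alpha> \<rho> K \<delta> n \<sigma>" and K: "finite K" and n: "0 < n" and r: "0 < r"
  shows "real (card (bad_points K r n \<sigma> \<phi>)) \<le> real (card K) * (\<delta>\<^sup>2 / r\<^sup>2) * real n"
proof -
  let ?A = "\<lambda>s. {a\<in>{1..n}. r < \<rho> (\<phi> (\<sigma> s a)) (\<alpha> s (\<phi> a))}"
  have single: "real (card (?A s)) \<le> \<delta>\<^sup>2 / r\<^sup>2 * real n" if s: "s \<in> K" for s
  proof -
    have "rho2 \<rho> n (\<phi> \<circ> \<sigma> s) (\<alpha> s \<circ> \<phi>) \<le> \<delta>" using \<phi> s by (simp add: Map_space_def)
    then have "1 / real n * (\<Sum>a\<in>{1..n}. (\<rho> (\<phi> (\<sigma> s a)) (\<alpha> s (\<phi> a)))\<^sup>2) \<le> \<delta>\<^sup>2"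
      unfolding rho2_def o_def by (rule sqrt_le_D)
    then have "(\<Sum>a\<in>{1..n}. (\<rho> (\<phi> (\<sigma> s a)) (\<alpha> s (\<phi> a)))\<^sup>2) \<le> \<delta>\<^sup>2 * real n"
      using n by (simp add: field_simps)
    moreover have "(\<Sum>a\<in>?A s. r\<^sup>2) \<le> (\<Sum>a\<in>?A s. (\<rho> (\<phi> (\<sigma> s a)) (\<alpha> s (\<phi> a)))\<^sup>2)"
      using r by (intro sum_mono power_mono) auto
    moreover have "\<dots> \<le> (\<Sum>a\<in>{1..n}. (\<rho> (\<phi> (\<sigma> s a)) (\<alpha> s (\<phi> a)))\<^sup>2)"
      by (intro sum_mono2) auto
    ultimately have "real (card (?A s)) * r\<^sup>2 \<le> \<delta>\<^sup>2 * real n" by simp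
    then show ?thesis using r by (simp add: field_simps)
  qed
  have "bad_points K r n \<sigma> \<phi> = (\<Union>s\<in>K. ?A s)" by (auto simp: bad_points_def)
  then have "card (bad_points K r n \<sigma> \<phi>) \<le> (\<Sum>s\<in>K. card (?A s))" using card_UN_le[OF K] by simp
  then have "real (card (bad_points K r n \<sigma> \<phi>)) \<le> (\<Sum>s\<in>K. real (card (?A s)))"
    by (simp flip: of_nat_sum)
  also have "\<dots> \<le> (\<Sum>s\<in>K. \<delta>\<^sup>2 / r\<^sup>2 * real n)" by (intro sum_mono single)
  finally show ?thesis by simp
qed

lemma exp_cov_log:
  assumes "finite F" "F \<noteq> {}" "F \<subseteq> carrier G" "0 < \<epsilon>"
  shows "exp (cov_log \<epsilon> F) = real (cov_num \<epsilon> F)"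
  using cov_num_pos[OF assms] assms(2) by (simp add: cov_log_def)

lemma rho_inf_ge_iff:
  assumes "0 < n"
  shows "\<epsilon> \<le> rho_inf \<rho> n \<phi> \<psi> \<longleftrightarrow> (\<exists>a\<in>{1..n}. \<epsilon> \<le> \<rho> (\<phi> a) (\<psi> a))"
  unfolding rho_inf_def using assms by (subst Max_ge_iff) auto

text \<open>Turns an optimal cover into a colouring of the space: points of equal colour stay close
  along \<open>F\<close>, so separated objects receive different colours.\<close>

lemma obtain_cover_index:
  assumes F: "finite F" "F \<noteq> {}" "F \<subseteq> carrier G" and \<epsilon>: "0 < \<epsilon>"
  obtains \<U> and q :: "'x \<Rightarrow> 'x set" where "finite \<U>" "card \<U> = cov_num \<epsilon> F"
    "\<And>x. x \<in> topspace X \<Longrightarrow> q x \<in> \<U>"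
    "\<And>x y s. \<lbrakk>x \<in> topspace X; y \<in> topspace X; q x = q y; s \<in> F\<rbrakk> \<Longrightarrow> \<rho> (\<alpha> s x) (\<alpha> s y) < \<epsilon>"
proof -
  obtain \<U> where \<U>: "fine_cover F \<epsilon> \<U>" "card \<U> = cov_num \<epsilon> F" by (rule cov_num_attained[OF F \<epsilon>])
  then have fin: "finite \<U>" and cov: "\<Union>\<U> = topspace X" by (auto simp: fine_cover_def finite_open_cover_def)
  obtain r where r: "r < \<epsilon>" "\<And>V x y s. \<lbrakk>V \<in> \<U>; x \<in> V; y \<in> V; s \<in> F\<rbrakk> \<Longrightarrow> \<rho> (\<alpha> s x) (\<alpha> s y) \<le> r"
    using \<U>(1) unfolding fine_cover_def by auto
  define q where "q x = (SOME V. V \<in> \<U> \<and> x \<in> V)" for x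
  have q: "q x \<in> \<U> \<and> x \<in> q x" if "x \<in> topspace X" for x
    unfolding q_def by (rule someI_ex) (use that cov in blast)
  show thesis
  proof (rule that[of \<U> q])
    show "\<rho> (\<alpha> s x) (\<alpha> s y) < \<epsilon>" if "x \<in> topspace X" "y \<in> topspace X" "q x = q y" "s \<in> F" for x y s
      using r(2)[of "q x" x y s] q[OF that(1)] q[OF that(2)] that(3,4) r(1) by simp
  qed (use fin \<U>(2) q in auto)
qed

text \<open>A separated map is determined, given the set \<open>\<Lambda>\<close> of points where equivariance fails, by
  one cover element for each tile whose centre avoids \<open>\<Lambda>\<close>, and one for each remaining point.\<close>

lemma card_separated_le:
  assumes n: "0 < n" and act: "partial_action G (\<Union>\<T>) {1..n} B \<sigma>" and P: "tile_family \<T> B \<sigma> \<eta> P"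
    and \<T>: "finite \<T>" "\<And>T. T \<in> \<T> \<Longrightarrow> finite T \<and> T \<noteq> {} \<and> T \<subseteq> carrier G"
    and Z: "Z \<subseteq> {1..n} \<rightarrow>\<^sub>E topspace X" "separated_set (rho_inf \<rho> n) (2 * \<epsilon>) Z"
    and \<Lambda>: "\<Lambda> \<subseteq> {1..n}" "\<And>\<phi>. \<phi> \<in> Z \<Longrightarrow> bad_points (\<Union>\<T>) (\<epsilon>/2) n \<sigma> \<phi> = \<Lambda>" and \<epsilon>: "0 < \<epsilon>"
  shows "real (card Z) \<le> exp ((\<Sum>(T, c, S)\<in>P. cov_log \<epsilon> T) +
    cov_log \<epsilon> {\<one>} * (real (card ({1..n} - tile_union \<sigma> P)) + real (card (\<Union>\<T>)) * real (card \<Lambda>)))"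
proof -
  interpret c: subadditive_set_function G "cov_log \<epsilon>" by (rule cov_log_subadditive[OF \<epsilon>])
  note f = tile_familyD[OF P]
  have finK: "finite (\<Union>\<T>)" using \<T> by auto
  \<comment> \<open>Only tiles whose centre is not exceptional transport information from the
    centre; \<open>R\<close> collects the points that need their own code.\<close>
  define Pg where "Pg = {p\<in>P. fst (snd p) \<notin> \<Lambda>}"
  define R where "R = {1..n} - tile_union \<sigma> Pg"
  have finPg: "finite Pg" and finR: "finite R" using f(1) by (auto simp: Pg_def R_def)
  have "\<forall>T\<in>\<T>. \<exists>p :: 'x set set \<times> ('x \<Rightarrow> 'x set). finite (fst p) \<and> card (fst p) = cov_num \<epsilon> T \<and> (\<forall>x\<in>topspace X. snd p x \<in> fst p) \<and>
      (\<forall>x\<in>topspace X. \<forall>y\<in>topspace X. snd p x = snd p y \<longrightarrow> (\<forall>s\<in>T. \<rho> (\<alpha> s x) (\<alpha> s y) < \<epsilon>))"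
  proof
    fix T assume "T \<in> \<T>"
    then have T: "finite T" "T \<noteq> {}" "T \<subseteq> carrier G" using \<T>(2) by auto
    obtain \<U> and q :: "'x \<Rightarrow> 'x set" where "finite \<U>" "card \<U> = cov_num \<epsilon> T"
      "\<And>x. x \<in> topspace X \<Longrightarrow> q x \<in> \<U>"
      "\<And>x y s. \<lbrakk>x \<in> topspace X; y \<in> topspace X; q x = q y; s \<in> T\<rbrakk> \<Longrightarrow> \<rho> (\<alpha> s x) (\<alpha> s y) < \<epsilon>"
      by (rule obtain_cover_index[OF T \<epsilon>]) (rule that)
    then show "\<exists>p :: 'x set set \<times> ('x \<Rightarrow> 'x set). finite (fst p) \<and> card (fst p) = cov_num \<epsilon> T \<and> (\<forall>x\<in>topspace X. snd p x \<in> fst p) \<and>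
      (\<forall>x\<in>topspace X. \<forall>y\<in>topspace X. snd p x = snd p y \<longrightarrow> (\<forall>s\<in>T. \<rho> (\<alpha> s x) (\<alpha> s y) < \<epsilon>))"
      by (intro exI[of _ "(\<U>, q)"]) auto
  qed
  then obtain C :: "'g set \<Rightarrow> 'x set set \<times> ('x \<Rightarrow> 'x set)" where C: "\<forall>T\<in>\<T>. finite (fst (C T)) \<and> card (fst (C T)) = cov_num \<epsilon> T \<and>
      (\<forall>x\<in>topspace X. snd (C T) x \<in> fst (C T)) \<and>
      (\<forall>x\<in>topspace X. \<forall>y\<in>topspace X. snd (C T) x = snd (C T) y \<longrightarrow> (\<forall>s\<in>T. \<rho> (\<alpha> s x) (\<alpha> s y) < \<epsilon>))"
    unfolding bchoice_iff by (elim exE) (rule that)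
  obtain \<U>0 and q0 :: "'x \<Rightarrow> 'x set" where C0: "finite \<U>0" "card \<U>0 = cov_num \<epsilon> {\<one>}"
      "\<And>x. x \<in> topspace X \<Longrightarrow> q0 x \<in> \<U>0"
      "\<And>x y s. \<lbrakk>x \<in> topspace X; y \<in> topspace X; q0 x = q0 y; s \<in> {\<one>}\<rbrakk> \<Longrightarrow> \<rho> (\<alpha> s x) (\<alpha> s y) < \<epsilon>"
    by (rule obtain_cover_index[of "{\<one>}" \<epsilon>, OF _ _ _ \<epsilon>]) (simp, simp, simp, rule that)
  define code where "code \<phi> = (restrict (\<lambda>p. snd (C (fst p)) (\<phi> (fst (snd p)))) Pg,
    restrict (\<lambda>b. q0 (\<phi> b)) R)" for \<phi>
  define W where "W = (\<Pi>\<^sub>E p\<in>Pg. fst (C (fst p))) \<times> (\<Pi>\<^sub>E b\<in>R. \<U>0)"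
  have \<phi>X: "\<phi> a \<in> topspace X" if "\<phi> \<in> Z" "a \<in> {1..n}" for \<phi> a using that Z(1) by (auto simp: PiE_iff subset_iff)
  have BD: "c \<in> {1..n}" if "(T, c, S) \<in> P" for T c S
    using f(3)[OF that] partial_actionD(2)[OF act] by auto
  have "code ` Z \<subseteq> W"
  proof
    fix w assume "w \<in> code ` Z"
    then obtain \<phi> where \<phi>: "\<phi> \<in> Z" "w = code \<phi>" by auto
    have "snd (C (fst p)) (\<phi> (fst (snd p))) \<in> fst (C (fst p))" if "p \<in> Pg" for p
    proof -
      obtain T c S where p: "p = (T, c, S)" by (metis surj_pair)
      have "T \<in> \<T>" "\<phi> c \<in> topspace X" using that f(2) BD \<phi>X[OF \<phi>(1)] by (auto simp: p Pg_def)
      then show ?thesis using C by (simp add: p)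
    qed
    moreover have "q0 (\<phi> b) \<in> \<U>0" if "b \<in> R" for b using C0(3) \<phi>X[OF \<phi>(1)] that by (simp add: R_def)
    ultimately show "w \<in> W" by (auto simp: \<phi> code_def W_def)
  qed
  moreover have "inj_on code Z"
  proof (rule inj_onI, rule ccontr)
    fix \<phi> \<psi> assume h: "\<phi> \<in> Z" "\<psi> \<in> Z" "code \<phi> = code \<psi>" "\<phi> \<noteq> \<psi>"
    then have code: "restrict (\<lambda>p. snd (C (fst p)) (\<phi> (fst (snd p)))) Pg = restrict (\<lambda>p. snd (C (fst p)) (\<psi> (fst (snd p)))) Pg"
      "restrict (\<lambda>b. q0 (\<phi> b)) R = restrict (\<lambda>b. q0 (\<psi> b)) R"
      by (simp_all add: code_def)
    have "2 * \<epsilon> \<le> rho_inf \<rho> n \<phi> \<psi>" using h Z(2) by (simp add: separated_set_def)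
    then obtain a where a: "a \<in> {1..n}" "2 * \<epsilon> \<le> \<rho> (\<phi> a) (\<psi> a)" using rho_inf_ge_iff[OF n] by blast
    show False
    proof (cases "a \<in> R")
      case True
      then have "q0 (\<phi> a) = q0 (\<psi> a)"
        using fun_cong[OF code(2), of a] by simp
      then have "\<rho> (\<phi> a) (\<psi> a) < \<epsilon>" using C0(4)[of "\<phi> a" "\<psi> a" \<one>] \<phi>X[OF h(1) a(1)] \<phi>X[OF h(2) a(1)] by simp
      with a \<epsilon> show False by simp
    next
      case False
      with a have "a \<in> tile_union \<sigma> Pg" by (simp add: R_def)
      then obtain T c S s where p: "(T, c, S) \<in> Pg" and s: "s \<in> S" "a = \<sigma> s c"
        by (auto simp: tile_union_def)
      then have pP: "(T, c, S) \<in> P" "c \<notin> \<Lambda>" by (auto simp: Pg_def)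
      have T: "T \<in> \<T>" "s \<in> T" "s \<in> \<Union>\<T>" "s \<in> carrier G" using f(2,4)[OF pP(1)] s \<T>(2) by auto
      have cn: "c \<in> {1..n}" by (rule BD[OF pP(1)])
      have "snd (C T) (\<phi> c) = snd (C T) (\<psi> c)"
        using fun_cong[OF code(1), of "(T, c, S)"] p by simp
      then have 1: "\<rho> (\<alpha> s (\<phi> c)) (\<alpha> s (\<psi> c)) < \<epsilon>"
        using C T \<phi>X[OF h(1) cn] \<phi>X[OF h(2) cn] by blast
      \<comment> \<open>All maps in \<open>Z\<close> have the same bad set \<open>\<Lambda>\<close>,
        so the centre \<open>c\<close> is good for each of them.\<close>
      have near: "\<rho> (w a) (\<alpha> s (w c)) \<le> \<epsilon>/2" if "w \<in> Z" for w
        using \<Lambda>(2)[OF that] pP(2) cn T(3) unfolding bad_points_def s(2) by force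
      have X: "\<phi> a \<in> topspace X" "\<psi> a \<in> topspace X" "\<alpha> s (\<phi> c) \<in> topspace X" "\<alpha> s (\<psi> c) \<in> topspace X"
        using \<phi>X h(1,2) a(1) cn T(4) by auto
      have "\<rho> (\<phi> a) (\<psi> a) \<le> \<rho> (\<phi> a) (\<alpha> s (\<phi> c)) + \<rho> (\<alpha> s (\<phi> c)) (\<psi> a)"
        by (rule rho_triangle[OF X(1,3,2)])
      also have "\<rho> (\<alpha> s (\<phi> c)) (\<psi> a) \<le> \<rho> (\<alpha> s (\<phi> c)) (\<alpha> s (\<psi> c)) + \<rho> (\<alpha> s (\<psi> c)) (\<psi> a)"
        by (rule rho_triangle[OF X(3,4,2)])
      finally have "\<rho> (\<phi> a) (\<psi> a) < 2 * \<epsilon>"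
        using 1 near[OF h(1)] near[OF h(2)] rho_sym[OF X(4,2)] by linarith
      with a show False by simp
    qed
  qed
  moreover have finW: "finite W"
    unfolding W_def using C C0(1) finPg finR f(2) by (intro finite_cartesian_product finite_PiE) (auto simp: Pg_def)
  ultimately have "card Z \<le> card W" by (metis card_inj_on_le)
  then have "real (card Z) \<le> real (card W)" by simp
  also have "real (card W) = (\<Prod>p\<in>Pg. real (cov_num \<epsilon> (fst p))) * real (cov_num \<epsilon> {\<one>}) ^ card R"
  proof -
    have "(\<Prod>p\<in>Pg. card (fst (C (fst p)))) = (\<Prod>p\<in>Pg. cov_num \<epsilon> (fst p))"
      using C f(2) by (intro prod.cong) (auto simp: Pg_def)
    then show ?thesis
      using finPg finR by (simp add: W_def card_cartesian_product card_PiE C0(2))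
  qed
  also have "\<dots> = (\<Prod>p\<in>Pg. exp (cov_log \<epsilon> (fst p))) * exp (cov_log \<epsilon> {\<one>}) ^ card R"
  proof -
    have "exp (cov_log \<epsilon> (fst p)) = real (cov_num \<epsilon> (fst p))" if "p \<in> Pg" for p
    proof -
      have "fst p \<in> \<T>" using that f(2)[of "fst p" "fst (snd p)" "snd (snd p)"] by (simp add: Pg_def)
      then show ?thesis using \<T>(2) \<epsilon> by (simp add: exp_cov_log)
    qed
    then show ?thesis using \<epsilon> by (simp add: exp_cov_log)
  qed
  also have "\<dots> = exp ((\<Sum>p\<in>Pg. cov_log \<epsilon> (fst p)) + cov_log \<epsilon> {\<one>} * real (card R))"
    using finPg by (simp add: exp_add exp_sum mult.commute flip: exp_of_nat_mult)
  also have "\<dots> \<le> exp ((\<Sum>(T, c, S)\<in>P. cov_log \<epsilon> T) +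
    cov_log \<epsilon> {\<one>} * (real (card ({1..n} - tile_union \<sigma> P)) + real (card (\<Union>\<T>)) * real (card \<Lambda>)))"
  proof (subst exp_le_cancel_iff, intro add_mono mult_left_mono)
    have "(\<Sum>p\<in>Pg. cov_log \<epsilon> (fst p)) \<le> (\<Sum>p\<in>P. cov_log \<epsilon> (fst p))"
    proof (rule sum_mono2[OF f(1)])
      fix p assume "p \<in> P - Pg"
      then have "fst p \<in> \<T>" using f(2)[of "fst p" "fst (snd p)" "snd (snd p)"] by simp
      then show "0 \<le> cov_log \<epsilon> (fst p)" using \<T>(2) by (simp add: c.nonneg)
    qed (simp add: Pg_def)
    then show "(\<Sum>p\<in>Pg. cov_log \<epsilon> (fst p)) \<le> (\<Sum>(T, c, S)\<in>P. cov_log \<epsilon> T)"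
      by (simp add: case_prod_beta)
    show "0 \<le> cov_log \<epsilon> {\<one>}" by (simp add: c.nonneg)
    \<comment> \<open>A discarded tile has its centre in \<open>\<Lambda>\<close>, and a single
      centre reaches at most \<open>card (\<Union>\<T>)\<close> points.\<close>
    have "R \<subseteq> ({1..n} - tile_union \<sigma> P) \<union> (\<lambda>(t, a). \<sigma> t a) ` (\<Union>\<T> \<times> \<Lambda>)"
    proof
      fix a assume a: "a \<in> R"
      show "a \<in> ({1..n} - tile_union \<sigma> P) \<union> (\<lambda>(t, a). \<sigma> t a) ` (\<Union>\<T> \<times> \<Lambda>)"
      proof (cases "a \<in> tile_union \<sigma> P")
        case True
        then obtain T c S s where p: "(T, c, S) \<in> P" and s: "s \<in> S" "a = \<sigma> s c"
          by (auto simp: tile_union_def)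
        have "c \<in> \<Lambda>"
        proof (rule ccontr)
          assume "c \<notin> \<Lambda>"
          then have "(T, c, S) \<in> Pg" using p by (simp add: Pg_def)
          then have "a \<in> tile_union \<sigma> Pg" using s unfolding tile_union_def by force
          with a show False by (simp add: R_def)
        qed
        moreover have "s \<in> \<Union>\<T>" using f(2,4)[OF p] s by auto
        ultimately show ?thesis using s(2) by force
      qed (use a in \<open>auto simp: R_def\<close>)
    qed
    then have "card R \<le> card (({1..n} - tile_union \<sigma> P) \<union> (\<lambda>(t, a). \<sigma> t a) ` (\<Union>\<T> \<times> \<Lambda>))"
      using finK finite_subset[OF \<Lambda>(1)] by (intro card_mono) auto
    also have "\<dots> \<le> card ({1..n} - tile_union \<sigma> P) + card ((\<lambda>(t, a). \<sigma> t a) ` (\<Union>\<T> \<times> \<Lambda>))"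
      by (rule card_Un_le)
    also have "card ((\<lambda>(t, a). \<sigma> t a) ` (\<Union>\<T> \<times> \<Lambda>)) \<le> card (\<Union>\<T>) * card \<Lambda>"
      using card_image_le[of "\<Union>\<T> \<times> \<Lambda>"] finK finite_subset[OF \<Lambda>(1)] by (simp add: card_cartesian_product)
    finally show "real (card R) \<le> real (card ({1..n} - tile_union \<sigma> P)) + real (card (\<Union>\<T>)) * real (card \<Lambda>)"
      by (simp flip: of_nat_mult of_nat_add)
  qed
  finally show ?thesis .
qed

text \<open>Per point, the tiles cost \<open>l / (1 - \<kappa>)\<close> and the uncovered part
  \<open>cov_log \<epsilon> {\<one>} * \<kappa>\<close>. The remaining \<open>2 * \<kappa>\<close>
  pays for exceptional sets: their number and the points reached from them. That the chosen
  \<open>K\<close> and \<open>\<delta>\<close> depend on \<open>\<kappa>\<close> is harmless, as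
  \<open>sofic_h\<close> is an infimum.\<close>

lemma sofic_h_le_density:
  assumes sofic: "sofic_approximation G d \<sigma>" and \<epsilon>: "0 < \<epsilon>"
    and freq: "frequently (\<lambda>T. cov_log \<epsilon> T < l * real (card T)) (left_invariance G)"
    and \<kappa>: "0 < \<kappa>" "\<kappa> \<le> 1/2"
  shows "sofic_h G X \<alpha> d \<sigma> (2 * \<epsilon>) \<rho> \<le> ereal (l / (1 - \<kappa>) + (cov_log \<epsilon> {\<one>} + 2) * \<kappa>)"
proof -
  interpret c: subadditive_set_function G "cov_log \<epsilon>" by (rule cov_log_subadditive[OF \<epsilon>])
  obtain \<T> \<beta> where \<T>: "finite \<T>" "0 < \<beta>" "\<Union>\<T> \<noteq> {}"
    "\<And>T. T \<in> \<T> \<Longrightarrow> finite T \<and> T \<noteq> {} \<and> T \<subseteq> carrier G \<and> cov_log \<epsilon> T < l * real (card T)"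
    "\<And>(D::nat set) B \<sigma>. partial_action G (\<Union>\<T>) D B \<sigma> \<Longrightarrow> real (card (D - B)) \<le> \<beta> * real (card D) \<Longrightarrow>
       \<exists>P. tile_family \<T> B \<sigma> \<kappa> P \<and> real (card (D - tile_union \<sigma> P)) \<le> \<kappa> * real (card D)"
    by (rule c.obtain_tiles[OF freq \<kappa> \<kappa>(1)]) (rule that)
  define K where "K = \<Union>\<T>"
  have K: "finite K" "K \<subseteq> carrier G" "K \<noteq> {}" using \<T>(1,3,4) by (auto simp: K_def)
  have \<T>': "\<And>T. T \<in> \<T> \<Longrightarrow> T \<subseteq> K \<and> finite T" using \<T>(4) by (auto simp: K_def)
  obtain T0 where "T0 \<in> \<T>" using \<T>(3) by auto
  then have "0 \<le> cov_log \<epsilon> T0" "cov_log \<epsilon> T0 < l * real (card T0)" using \<T>(4) c.nonneg by auto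
  then have l: "0 \<le> l" by (meson less_le_trans less_imp_le mult_nonpos_nonneg not_le of_nat_0_le_iff)
  define c0 where "c0 = cov_log \<epsilon> {\<one>}"
  have c0: "0 \<le> c0" by (simp add: c0_def c.nonneg)
  \<comment> \<open>Makes the term \<open>exp (-u)\<close> of the Chernoff bound equal to
    \<open>\<kappa>\<close>.\<close>
  define u where "u = - ln \<kappa>"
  have u: "0 \<le> u" "exp (-u) = \<kappa>" using \<kappa> by (auto simp: u_def)
  \<comment> \<open>With \<open>\<gamma> = \<kappa> / m\<close> the terms
    \<open>u * \<gamma>\<close> and \<open>c0 * card K * \<gamma>\<close> together stay below
    \<open>\<kappa>\<close>; the added 1 keeps \<open>m\<close> positive.\<close>
  define m where "m = u + c0 * real (card K) + 1"
  have m: "0 < m" using u c0 by (simp add: m_def add_nonneg_pos)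
  define \<gamma> where "\<gamma> = \<kappa> / m"
  have \<gamma>: "0 < \<gamma>" using \<kappa> m by (simp add: \<gamma>_def)
  have "(u + c0 * real (card K)) * \<gamma> \<le> m * \<gamma>" using \<gamma> by (intro mult_right_mono) (auto simp: m_def)
  then have \<gamma>m: "u * \<gamma> + c0 * real (card K) * \<gamma> \<le> \<kappa>" using m by (simp add: \<gamma>_def algebra_simps)
  \<comment> \<open>Solved from the Chebyshev bound at distance \<open>\<epsilon>/2\<close>, so that
    at most \<open>\<gamma> * n\<close> points are bad.\<close>
  define \<delta> where "\<delta> = sqrt (\<gamma> / real (card K)) * (\<epsilon>/2)"
  have cK: "0 < real (card K)" using K by (simp add: card_gt_0_iff)
  have \<delta>: "0 < \<delta>" using \<gamma> cK \<epsilon> by (simp add: \<delta>_def)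
  have \<delta>2: "real (card K) * (\<delta>\<^sup>2 / (\<epsilon>/2)\<^sup>2) = \<gamma>"
  proof -
    have "\<delta> / (\<epsilon>/2) = sqrt (\<gamma> / real (card K))" using \<epsilon> by (simp add: \<delta>_def)
    then have "\<delta>\<^sup>2 / (\<epsilon>/2)\<^sup>2 = \<gamma> / real (card K)" using \<gamma> cK by (simp flip: power_divide)
    then show ?thesis using cK by simp
  qed
  define L where "L = K \<union> m_inv G ` K \<union> {\<one>}"
  have L: "finite L" "L \<subseteq> carrier G" "\<one> \<in> L" "K \<subseteq> L" "m_inv G ` K \<subseteq> L" using K by (auto simp: L_def)
  have "sofic_h G X \<alpha> d \<sigma> (2 * \<epsilon>) \<rho> \<le> sofic_h_loc X \<alpha> d \<sigma> (2 * \<epsilon>) \<rho> K \<delta>"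
    unfolding sofic_h_def using K \<delta> by (intro INF_lower2[of K] INF_lower) auto
  also have "\<dots> \<le> ereal (l / (1 - \<kappa>) + (c0 + 2) * \<kappa>)"
    unfolding sofic_h_loc_def
  proof (rule Limsup_bounded, rule eventually_mono[OF eventually_good_points[OF is_group sofic L(1,2) \<T>(2)]])
    fix i
    assume i: "0 < d i \<and> real (card ({1..d i} - good_points G L (d i) (\<sigma> i))) \<le> \<beta> * real (d i)"
    define n where "n = d i"
    define B where "B = good_points G L n (\<sigma> i)"
    have n: "0 < n" using i by (simp add: n_def)
    have perm: "\<sigma> i s permutes {1..n}" if "s \<in> carrier G" for s
      using sofic that by (simp add: sofic_approximation_def n_def)
    have act: "partial_action G K {1..n} B (\<sigma> i)"
      unfolding B_def by (rule good_points_partial_action[OF is_group perm L(2-5)])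
    obtain P where P: "tile_family \<T> B (\<sigma> i) \<kappa> P"
      and rest: "real (card ({1..n} - tile_union (\<sigma> i) P)) \<le> \<kappa> * real n"
      using \<T>(5)[of "{1..n}" B "\<sigma> i"] act i by (auto simp: K_def B_def n_def)
    note f = tile_familyD[OF P]
    have "(\<Sum>(T, c, S)\<in>P. cov_log \<epsilon> T) \<le> (\<Sum>(T, c, S)\<in>P. l * real (card T))"
      using f(2) \<T>(4) by (intro sum_mono) (auto intro: less_imp_le)
    also have "\<dots> = l * (\<Sum>(T, c, S)\<in>P. real (card T))" by (simp add: sum_distrib_left case_prod_beta)
    also have "\<dots> \<le> l * (real n / (1 - \<kappa>))"
      using sum_tile_card_le[OF act P \<T>'] \<kappa> l by (intro mult_left_mono) (auto simp: field_simps)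
    finally have tiles: "(\<Sum>(T, c, S)\<in>P. cov_log \<epsilon> T) \<le> l * (real n / (1 - \<kappa>))" .
    define b where "b = (l / (1 - \<kappa>) + (c0 + 2) * \<kappa>) * real n"
    have "real (card Z) \<le> exp b"
      if Z: "Z \<subseteq> Map_space X \<alpha> \<rho> K \<delta> n (\<sigma> i)" "finite Z" "separated_set (rho_inf \<rho> n) (2 * \<epsilon>) Z" for Z
    proof -
      define small where "small = {\<Lambda>. \<Lambda> \<subseteq> {1..n} \<and> real (card \<Lambda>) \<le> \<gamma> * real n}"
      have finsmall: "finite small" by (rule finite_subset[of _ "Pow {1..n}"]) (auto simp: small_def)
      define bad where "bad = bad_points K (\<epsilon>/2) n (\<sigma> i)"
      have bad: "bad \<phi> \<in> small" if "\<phi> \<in> Z" for \<phi>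
        using card_bad_points_le[of \<phi> K \<delta> n "\<sigma> i" "\<epsilon>/2"] that Z(1) K n \<epsilon> \<delta>2
        by (auto simp: small_def bad_def bad_points_def)
      define e where "e = l * (real n / (1 - \<kappa>)) + c0 * (\<kappa> * real n + real (card K) * (\<gamma> * real n))"
      have fibre: "real (card {\<phi>\<in>Z. bad \<phi> = \<Lambda>}) \<le> exp e" if \<Lambda>: "\<Lambda> \<in> small" for \<Lambda>
      proof -
        have "real (card {\<phi>\<in>Z. bad \<phi> = \<Lambda>}) \<le> exp ((\<Sum>(T, c, S)\<in>P. cov_log \<epsilon> T) +
          cov_log \<epsilon> {\<one>} * (real (card ({1..n} - tile_union (\<sigma> i) P)) + real (card (\<Union>\<T>)) * real (card \<Lambda>)))"
        proof (rule card_separated_le[OF n _ P \<T>(1) _ _ _ _ _ \<epsilon>])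
          show "partial_action G (\<Union>\<T>) {1..n} B (\<sigma> i)" using act by (simp add: K_def)
          show "{\<phi>\<in>Z. bad \<phi> = \<Lambda>} \<subseteq> {1..n} \<rightarrow>\<^sub>E topspace X" using Z(1) by (auto simp: Map_space_def)
          show "separated_set (rho_inf \<rho> n) (2 * \<epsilon>) {\<phi>\<in>Z. bad \<phi> = \<Lambda>}"
            using Z(3) by (simp add: separated_set_def)
        qed (use \<T>(4) \<Lambda> in \<open>auto simp: small_def bad_def K_def\<close>)
        also have "\<dots> \<le> exp e"
          unfolding e_def c0_def[symmetric] K_def[symmetric] exp_le_cancel_iff
          using tiles rest \<Lambda> c0 by (intro add_mono mult_left_mono) (auto simp: small_def)
        finally show ?thesis .
      qed
      \<comment> \<open>Split the separated set by its bad sets: few classes, each coded by the same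
        tiling.\<close>
      have "Z = (\<Union>\<Lambda>\<in>small. {\<phi>\<in>Z. bad \<phi> = \<Lambda>})" using bad by auto
      then have "card Z \<le> (\<Sum>\<Lambda>\<in>small. card {\<phi>\<in>Z. bad \<phi> = \<Lambda>})" using card_UN_le[OF finsmall] by metis
      then have "real (card Z) \<le> (\<Sum>\<Lambda>\<in>small. real (card {\<phi>\<in>Z. bad \<phi> = \<Lambda>}))" by (simp flip: of_nat_sum)
      also have "\<dots> \<le> (\<Sum>\<Lambda>\<in>small. exp e)" by (intro sum_mono fibre)
      also have "\<dots> = real (card small) * exp e" by simp
      also have "\<dots> \<le> exp (u * (\<gamma> * real n) + \<kappa> * real n) * exp e"
        using card_small_subsets_le[of "{1..n}" u "\<gamma> * real n"] u
        by (intro mult_right_mono) (auto simp: small_def)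
      also have "\<dots> = exp (u * (\<gamma> * real n) + \<kappa> * real n + e)" by (simp add: exp_add)
      also have "\<dots> \<le> exp b"
      proof -
        have "(u * \<gamma> + c0 * real (card K) * \<gamma>) * real n \<le> \<kappa> * real n"
          using \<gamma>m by (intro mult_right_mono) auto
        then show ?thesis by (simp add: b_def e_def algebra_simps)
      qed
      finally show ?thesis .
    qed
    then have "log_card (sep_number (Map_space X \<alpha> \<rho> K \<delta> n (\<sigma> i)) (rho_inf \<rho> n) (2 * \<epsilon>)) \<le> ereal b"
      by (rule log_card_sep_number_le)
    then have "log_card (sep_number (Map_space X \<alpha> \<rho> K \<delta> n (\<sigma> i)) (rho_inf \<rho> n) (2 * \<epsilon>)) / ereal (real n) \<le>
        ereal b / ereal (real n)"
      using n by (intro ereal_divide_right_mono) auto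
    also have "\<dots> = ereal (l / (1 - \<kappa>) + (c0 + 2) * \<kappa>)" using n by (simp add: b_def)
    finally show "log_card (sep_number (Map_space X \<alpha> \<rho> K \<delta> (d i) (\<sigma> i)) (rho_inf \<rho> (d i)) (2 * \<epsilon>)) /
        ereal (real (d i)) \<le> ereal (l / (1 - \<kappa>) + (c0 + 2) * \<kappa>)"
      by (simp add: n_def)
  qed
  finally show ?thesis by (simp add: c0_def)
qed

text \<open>Every \<open>l\<close> above the limit is a density bound for sufficiently invariant
  tiles; let \<open>\<kappa>\<close> tend to 0 and then \<open>l\<close> to the limit.\<close>

lemma sofic_h_le_S_cover:
  assumes sofic: "sofic_approximation G d \<sigma>" and \<epsilon>: "0 < \<epsilon>"
  shows "sofic_h G X \<alpha> d \<sigma> (2 * \<epsilon>) \<rho> \<le> S_cover G X \<alpha> \<epsilon> \<rho>"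
proof -
  interpret c: subadditive_set_function G "cov_log \<epsilon>" by (rule cov_log_subadditive[OF \<epsilon>])
  obtain s where s: "0 \<le> s" "S_cover G X \<alpha> \<epsilon> \<rho> = ereal s"
    "((\<lambda>F. cov_log \<epsilon> F / real (card F)) \<longlongrightarrow> s) (left_invariance G)"
    by (rule S_cover_eq_limit[OF \<epsilon>])
  have upper: "sofic_h G X \<alpha> d \<sigma> (2 * \<epsilon>) \<rho> \<le> ereal l" if l: "s < l" for l
  proof -
    have "eventually (\<lambda>F. F \<in> left_invariant_sets G {} 1) (left_invariance G)"
      by (rule c.eventually_left_invariant_sets) auto
    with order_tendstoD(2)[OF s(3) l]
    have "eventually (\<lambda>T. cov_log \<epsilon> T < l * real (card T)) (left_invariance G)"
      by eventually_elim (auto simp: left_invariant_sets_def divide_less_eq card_gt_0_iff)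
    then have freq: "frequently (\<lambda>T. cov_log \<epsilon> T < l * real (card T)) (left_invariance G)"
      by (rule eventually_frequently[OF c.left_invariance_neq_bot])
    have "eventually (\<lambda>\<kappa>. sofic_h G X \<alpha> d \<sigma> (2 * \<epsilon>) \<rho> \<le>
        ereal (l / (1 - \<kappa>) + (cov_log \<epsilon> {\<one>} + 2) * \<kappa>)) (at_right 0)"
      using small_parameter by eventually_elim (auto intro!: sofic_h_le_density[OF sofic \<epsilon> freq])
    then show ?thesis
      by (rule tendsto_lowerbound[OF tendsto_ereal[OF perturbed_density_tendsto[of l "cov_log \<epsilon> {\<one>} + 2"]]]) simp
  qed
  show ?thesis unfolding s(2) by (rule ereal_le_epsilon2) (simp add: upper)
qed

end

section \<open>Lower bound for the sofic quantity\<close>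

context pseudometric_action
begin

text \<open>A maximal separated set spans; the balls around it form a cover.\<close>

lemma obtain_separated_points:
  assumes F: "finite F" "F \<noteq> {}" "F \<subseteq> carrier G" and \<epsilon>: "0 < \<epsilon>"
  obtains E where "finite E" "E \<subseteq> topspace X" "cov_num (3 * \<epsilon>) F \<le> card E"
    "\<And>x y. \<lbrakk>x \<in> E; y \<in> E; x \<noteq> y\<rbrakk> \<Longrightarrow> \<exists>s\<in>F. \<epsilon> \<le> \<rho> (\<alpha> s x) (\<alpha> s y)"
proof -
  define sep where "sep E \<longleftrightarrow> finite E \<and> E \<subseteq> topspace X \<and>
    (\<forall>x\<in>E. \<forall>y\<in>E. x \<noteq> y \<longrightarrow> (\<exists>s\<in>F. \<epsilon> \<le> \<rho> (\<alpha> s x) (\<alpha> s y)))" for E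
  obtain \<U> and q :: "'x \<Rightarrow> 'x set" where q: "finite \<U>" "card \<U> = cov_num \<epsilon> F"
    "\<And>x. x \<in> topspace X \<Longrightarrow> q x \<in> \<U>"
    "\<And>x y s. \<lbrakk>x \<in> topspace X; y \<in> topspace X; q x = q y; s \<in> F\<rbrakk> \<Longrightarrow> \<rho> (\<alpha> s x) (\<alpha> s y) < \<epsilon>"
    by (rule obtain_cover_index[OF F \<epsilon>]) (rule that)
  \<comment> \<open>Separated points lie in different elements of a fine cover, so a separated set
    of greatest size exists.\<close>
  have bound: "card E \<le> cov_num \<epsilon> F" if E: "sep E" for E
  proof -
    have "inj_on q E"
    proof (rule inj_onI, rule ccontr)
      fix x y assume h: "x \<in> E" "y \<in> E" "q x = q y" "x \<noteq> y"
      then obtain s where "s \<in> F" "\<epsilon> \<le> \<rho> (\<alpha> s x) (\<alpha> s y)" using E unfolding sep_def by blast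
      with q(4)[of x y s] h E show False by (auto simp: sep_def)
    qed
    then have "card E \<le> card \<U>"
      by (rule card_inj_on_le) (use q E in \<open>auto simp: sep_def\<close>)
    then show ?thesis by (simp add: q)
  qed
  have "sep {}" by (simp add: sep_def)
  then obtain E where E: "sep E" and max: "\<And>E'. sep E' \<Longrightarrow> card E' \<le> card E"
    using ex_has_greatest_nat[of sep "{}" card "Suc (cov_num \<epsilon> F)"] bound by (auto simp: less_Suc_eq_le)
  have E': "finite E" "E \<subseteq> topspace X" using E by (auto simp: sep_def)
  let ?W = "(\<lambda>x. dyn_ball F x \<epsilon>) ` E"
  have "topspace X \<subseteq> \<Union>?W"
  proof (rule subsetI, rule ccontr)
    fix y assume y: "y \<in> topspace X" "y \<notin> \<Union>?W"
    then have far: "\<exists>s\<in>F. \<epsilon> \<le> \<rho> (\<alpha> s x) (\<alpha> s y)" if "x \<in> E" for x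
      using that by (auto simp: dyn_ball_def not_less)
    moreover have "\<exists>s\<in>F. \<epsilon> \<le> \<rho> (\<alpha> s y) (\<alpha> s x)" if "x \<in> E" for x
    proof -
      obtain s where "s \<in> F" "\<epsilon> \<le> \<rho> (\<alpha> s x) (\<alpha> s y)" using far[OF \<open>x \<in> E\<close>] by blast
      moreover from this have "\<rho> (\<alpha> s x) (\<alpha> s y) = \<rho> (\<alpha> s y) (\<alpha> s x)"
        using that E' y F by (intro rho_sym act_closed) auto
      ultimately show ?thesis by auto
    qed
    ultimately have "sep (insert y E)" using E y by (auto simp: sep_def)
    moreover have "y \<notin> E"
    proof
      assume "y \<in> E"
      then obtain s where "s \<in> F" "\<epsilon> \<le> \<rho> (\<alpha> s y) (\<alpha> s y)" using far by blast
      moreover from this have "\<alpha> s y \<in> topspace X" using F y by auto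
      ultimately show False using \<epsilon> by simp
    qed
    ultimately show False using max[of "insert y E"] E' by simp
  qed
  moreover have op: "openin X U" if "U \<in> ?W" for U
    using that openin_dyn_ball[OF F(1,3)] E' by auto
  then have "\<Union>?W \<subseteq> topspace X" using openin_subset by blast
  ultimately have cov: "finite_open_cover X ?W"
    using E' op unfolding finite_open_cover_def by blast
  have "fine_cover F (3 * \<epsilon>) ?W"
    unfolding fine_cover_def
  proof (intro conjI cov exI[of _ "2 * \<epsilon>"] ballI)
    fix V x y s assume "V \<in> ?W" "x \<in> V" "y \<in> V" "s \<in> F"
    then show "\<rho> (\<alpha> s x) (\<alpha> s y) \<le> 2 * \<epsilon>"
      using dyn_ball_diameter[OF F(3)] E' by blast
  qed (use \<epsilon> in auto)
  then have "cov_num (3 * \<epsilon>) F \<le> card ?W" using F \<epsilon> by (intro cov_num_le) auto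
  also have "\<dots> \<le> card E" using E' by (intro card_image_le)
  finally show thesis using E E' by (intro that[of E]) (auto simp: sep_def)
qed

text \<open>Independent choices of a point for every tile, moved along the tile by the action, give
  pairwise separated maps; they are equivariant except near the boundary of the tiles.\<close>

lemma exists_separated_maps:
  assumes n: "0 < n" and act: "partial_action G (\<Union>\<T>) {1..n} B \<sigma>" and P: "tile_family \<T> B \<sigma> \<kappa> P"
    and \<T>: "finite \<T>" "\<And>T. T \<in> \<T> \<Longrightarrow> finite T \<and> T \<noteq> {} \<and> T \<subseteq> carrier G \<and>
        real (card ((F <#>\<^bsub>G\<^esub> T) - T)) \<le> \<kappa> * real (card T)"
    and F: "finite F" "F \<subseteq> carrier G"
    and mult: "\<And>g t b. \<lbrakk>g \<in> F; t \<in> \<Union>\<T>; b \<in> B\<rbrakk> \<Longrightarrow> \<sigma> g (\<sigma> t b) = \<sigma> (g \<otimes> t) b"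
    and perm: "\<And>g. g \<in> F \<Longrightarrow> \<sigma> g permutes {1..n}"
    and rest: "real (card ({1..n} - tile_union \<sigma> P)) \<le> \<kappa> * real n"
    and \<kappa>: "0 < \<kappa>" "\<kappa> \<le> 1/2" and \<epsilon>: "0 < \<epsilon>" and \<delta>: "0 < \<delta>"
    and M: "\<And>x y. \<lbrakk>x \<in> topspace X; y \<in> topspace X\<rbrakk> \<Longrightarrow> \<rho> x y \<le> M" "M\<^sup>2 * (5 * \<kappa>) \<le> \<delta>\<^sup>2"
  shows "\<exists>Z. Z \<subseteq> Map_space X \<alpha> \<rho> F \<delta> n \<sigma> \<and> finite Z \<and> Z \<noteq> {} \<and> separated_set (rho_inf \<rho> n) \<epsilon> Z \<and>
    (\<Sum>(T, c, S)\<in>P. cov_log (3 * \<epsilon>) S) \<le> ln (real (card Z))"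
proof -
  note a = partial_actionD[OF act] and f = tile_familyD[OF P]
  have \<epsilon>3: "0 < 3 * \<epsilon>" using \<epsilon> by simp
  have S: "finite S" "S \<noteq> {}" "S \<subseteq> carrier G" "S \<subseteq> T" "T \<in> \<T>" "b \<in> B" if p: "(T, b, S) \<in> P" for T b S
  proof -
    show T: "T \<in> \<T>" "S \<subseteq> T" "b \<in> B" using f(2-4)[OF p] by auto
    then show "finite S" "S \<subseteq> carrier G" using \<T>(2)[OF T(1)] by (auto intro: finite_subset)
    have "0 < (1 - \<kappa>) * real (card T)" using \<kappa> \<T>(2)[OF T(1)] by (simp add: card_gt_0_iff)
    then show "S \<noteq> {}" using f(5)[OF p] by auto
  qed
  \<comment> \<open>Separation is required along the trimmed part only: there the values of a map
    can be chosen independently of the other tiles.\<close>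
  have "\<forall>p\<in>P. \<exists>E. finite E \<and> E \<subseteq> topspace X \<and> cov_num (3 * \<epsilon>) (snd (snd p)) \<le> card E \<and>
      (\<forall>x\<in>E. \<forall>y\<in>E. x \<noteq> y \<longrightarrow> (\<exists>s\<in>snd (snd p). \<epsilon> \<le> \<rho> (\<alpha> s x) (\<alpha> s y)))"
  proof
    fix p assume "p \<in> P"
    then have "(fst p, fst (snd p), snd (snd p)) \<in> P" by simp
    note S' = S(1-3)[OF this]
    obtain E where "finite E" "E \<subseteq> topspace X" "cov_num (3 * \<epsilon>) (snd (snd p)) \<le> card E"
      "\<And>x y. \<lbrakk>x \<in> E; y \<in> E; x \<noteq> y\<rbrakk> \<Longrightarrow> \<exists>s\<in>snd (snd p). \<epsilon> \<le> \<rho> (\<alpha> s x) (\<alpha> s y)"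
      by (rule obtain_separated_points[OF S' \<epsilon>]) (rule that)
    then show "\<exists>E. finite E \<and> E \<subseteq> topspace X \<and> cov_num (3 * \<epsilon>) (snd (snd p)) \<le> card E \<and>
      (\<forall>x\<in>E. \<forall>y\<in>E. x \<noteq> y \<longrightarrow> (\<exists>s\<in>snd (snd p). \<epsilon> \<le> \<rho> (\<alpha> s x) (\<alpha> s y)))" by blast
  qed
  then obtain E where E: "\<forall>p\<in>P. finite (E p) \<and> E p \<subseteq> topspace X \<and> cov_num (3 * \<epsilon>) (snd (snd p)) \<le> card (E p) \<and>
      (\<forall>x\<in>E p. \<forall>y\<in>E p. x \<noteq> y \<longrightarrow> (\<exists>s\<in>snd (snd p). \<epsilon> \<le> \<rho> (\<alpha> s x) (\<alpha> s y)))"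
    unfolding bchoice_iff by (elim exE) (rule that)
  obtain x0 where x0: "x0 \<in> topspace X" using nonempty by blast
  define located where "located b p s \<longleftrightarrow> p \<in> P \<and> s \<in> snd (snd p) \<and> b = \<sigma> s (fst (snd p))" for b p s
  \<comment> \<open>Disjointness determines the tile, freeness of the partial action the position in
    it.\<close>
  have uniq: "p = p' \<and> s = s'" if h: "located b p s" "located b p' s'" for b p s p' s'
  proof -
    have p: "(fst p, fst (snd p), snd (snd p)) \<in> P" "p \<in> P" "p' \<in> P" using h by (auto simp: located_def)
    let ?A = "\<lambda>(T, c, S). (\<lambda>s. \<sigma> s c) ` S"
    have "b \<in> ?A p" using h(1) by (auto simp: located_def case_prod_beta)
    moreover have "b \<in> ?A p'" using h(2) by (auto simp: located_def case_prod_beta)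
    ultimately have eq: "p = p'" using disjoint_family_onD[OF f(6) p(2,3)] by auto
    have "inj_on (\<lambda>t. \<sigma> t (fst (snd p))) (\<Union>\<T>)" by (rule a(4)[OF S(6)[OF p(1)]])
    moreover have "s \<in> \<Union>\<T>" "s' \<in> \<Union>\<T>" using S(4,5)[OF p(1)] h eq by (auto simp: located_def)
    ultimately show ?thesis using h eq by (auto simp: located_def dest: inj_onD)
  qed
  \<comment> \<open>\<open>x0\<close> fills the uncovered points; \<open>undefined\<close> outside
    \<open>{1..n}\<close> makes the map extensional, as \<open>Map_space\<close> demands.\<close>
  define \<phi> where "\<phi> \<omega> b = (if b \<in> {1..n} then
      if \<exists>p s. located b p s then case (SOME (p, s). located b p s) of (p, s) \<Rightarrow> \<alpha> s (\<omega> p) else x0 else undefined)"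
    for \<omega> :: "('g set \<times> nat \<times> 'g set) \<Rightarrow> 'x" and b
  have atD: "b \<in> {1..n}" "fst (snd p) \<in> B" "s \<in> carrier G" "s \<in> \<Union>\<T>" if "located b p s" for b p s
  proof -
    have p: "(fst p, fst (snd p), snd (snd p)) \<in> P" using that by (auto simp: located_def)
    show "fst (snd p) \<in> B" "s \<in> carrier G" "s \<in> \<Union>\<T>" using S(3-6)[OF p] that by (auto simp: located_def)
    then show "b \<in> {1..n}" using a(3)[of "fst (snd p)" s] that by (simp add: located_def)
  qed
  have \<phi>at: "\<phi> \<omega> b = \<alpha> s (\<omega> p)" if h: "located b p s" for \<omega> b p s
  proof -
    have "(SOME (p, s). located b p s) = (p, s)"
    proof (rule some_equality)
      show "x = (p, s)" if "case x of (p, s) \<Rightarrow> located b p s" for x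
        using uniq[OF _ h, of "fst x" "snd x"] that by (cases x) auto
    qed (simp add: h)
    moreover have "\<exists>p s. located b p s" using h by (intro exI)
    ultimately show ?thesis using atD(1)[OF h] unfolding \<phi>_def by (simp only: if_True) simp
  qed
  define \<Omega> where "\<Omega> = (\<Pi>\<^sub>E p\<in>P. E p)"
  have \<omega>X: "\<omega> p \<in> topspace X" if "\<omega> \<in> \<Omega>" "p \<in> P" for \<omega> p 
    using E[rule_format, OF that(2)] PiE_mem[OF that(1)[unfolded \<Omega>_def] that(2)] by blast
  have \<phi>X: "\<phi> \<omega> b \<in> topspace X" if "\<omega> \<in> \<Omega>" "b \<in> {1..n}" for \<omega> b
  proof (cases "\<exists>p s. located b p s")
    case True
    then obtain p s where at: "located b p s" by blast
    then have "p \<in> P" by (simp add: located_def)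
    then show ?thesis using \<phi>at[OF at] atD(3)[OF at] \<omega>X[OF that(1)] by simp
  next
    case False
    then show ?thesis using that x0 unfolding \<phi>_def by (simp only: if_True if_False)
  qed
  have sep: "\<epsilon> \<le> rho_inf \<rho> n (\<phi> \<omega>) (\<phi> \<omega>')" if h: "\<omega> \<in> \<Omega>" "\<omega>' \<in> \<Omega>" "\<omega> \<noteq> \<omega>'" for \<omega> \<omega>'
  proof -
    obtain p where p: "p \<in> P" "\<omega> p \<noteq> \<omega>' p" using h unfolding \<Omega>_def by (meson PiE_ext)
    moreover have "\<omega> p \<in> E p" "\<omega>' p \<in> E p" using h p by (auto simp: \<Omega>_def)
    ultimately obtain s where s: "s \<in> snd (snd p)" "\<epsilon> \<le> \<rho> (\<alpha> s (\<omega> p)) (\<alpha> s (\<omega>' p))" using E by meson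
    have at: "located (\<sigma> s (fst (snd p))) p s" using p s by (simp add: located_def)
    show ?thesis
      unfolding rho_inf_ge_iff[OF n] using s(2) atD(1)[OF at] \<phi>at[OF at] by metis
  qed
  have inj: "inj_on \<phi> \<Omega>"
  proof (rule inj_onI, rule ccontr)
    fix \<omega> \<omega>' assume h: "\<omega> \<in> \<Omega>" "\<omega>' \<in> \<Omega>" "\<phi> \<omega> = \<phi> \<omega>'" "\<omega> \<noteq> \<omega>'"
    then obtain b where "b \<in> {1..n}" "\<epsilon> \<le> \<rho> (\<phi> \<omega> b) (\<phi> \<omega>' b)"
      using sep[OF h(1,2,4)] rho_inf_ge_iff[OF n] by blast
    then show False using h(3) \<phi>X[OF h(1)] \<epsilon> by simp
  qed
  have map: "\<phi> \<omega> \<in> Map_space X \<alpha> \<rho> F \<delta> n \<sigma>" if \<omega>: "\<omega> \<in> \<Omega>" for \<omega>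
    unfolding Map_space_def
  proof (intro CollectI conjI ballI)
    show "\<phi> \<omega> \<in> {1..n} \<rightarrow>\<^sub>E topspace X" using \<phi>X[OF \<omega>] by (auto simp: PiE_iff extensional_def \<phi>_def)
    fix g assume g: "g \<in> F"
    have gG: "g \<in> carrier G" using g F by auto
    let ?r = "\<lambda>b. \<rho> (\<phi> \<omega> (\<sigma> g b)) (\<alpha> g (\<phi> \<omega> b))"
    define bad where "bad = {b\<in>{1..n}. ?r b \<noteq> 0}"
    \<comment> \<open>If \<open>b\<close> and its translate by \<open>g\<close> lie in the same
      trimmed tile, both values are moved copies of one point and equivariance is exact.\<close>
    have good: "?r b = 0" if h: "located b p s" "g \<otimes> s \<in> snd (snd p)" for b p s
    proof -
      have "\<sigma> g b = \<sigma> (g \<otimes> s) (fst (snd p))"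
        using mult[OF g atD(4,2)[OF h(1)]] h(1) by (simp add: located_def)
      then have at: "located (\<sigma> g b) p (g \<otimes> s)" using h by (simp add: located_def)
      have "p \<in> P" using h by (simp add: located_def)
      then have "\<phi> \<omega> (\<sigma> g b) = \<alpha> g (\<phi> \<omega> b)"
        using \<phi>at[OF at] \<phi>at[OF h(1)] act_mult[OF gG atD(3)[OF h(1)]] \<omega>X[OF \<omega>] by simp
      then show ?thesis using gG \<phi>X[OF \<omega> atD(1)[OF h(1)]] by simp
    qed
    let ?Y = "\<lambda>p. {s\<in>snd (snd p). g \<otimes> s \<notin> snd (snd p)}"
    have "bad \<subseteq> ({1..n} - tile_union \<sigma> P) \<union> (\<Union>p\<in>P. (\<lambda>s. \<sigma> s (fst (snd p))) ` ?Y p)"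
    proof
      fix b assume b: "b \<in> bad"
      show "b \<in> ({1..n} - tile_union \<sigma> P) \<union> (\<Union>p\<in>P. (\<lambda>s. \<sigma> s (fst (snd p))) ` ?Y p)"
      proof (cases "b \<in> tile_union \<sigma> P")
        case True
        then obtain p s where at: "located b p s" by (force simp: tile_union_def located_def)
        have "g \<otimes> s \<notin> snd (snd p)" using good[OF at] b by (auto simp: bad_def)
        then have "b \<in> (\<lambda>s. \<sigma> s (fst (snd p))) ` ?Y p" using at by (simp add: located_def)
        then show ?thesis using at unfolding located_def by blast
      qed (use b in \<open>auto simp: bad_def\<close>)
    qed
    moreover have finY: "finite (?Y p)" if "p \<in> P" for p using S(1)[of "fst p" "fst (snd p)" "snd (snd p)"] that by simp
    ultimately have "card bad \<le> card (({1..n} - tile_union \<sigma> P) \<union> (\<Union>p\<in>P. (\<lambda>s. \<sigma> s (fst (snd p))) ` ?Y p))"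
      using f(1) by (intro card_mono) auto
    also have "\<dots> \<le> card ({1..n} - tile_union \<sigma> P) + card (\<Union>p\<in>P. (\<lambda>s. \<sigma> s (fst (snd p))) ` ?Y p)"
      by (rule card_Un_le)
    also have "card (\<Union>p\<in>P. (\<lambda>s. \<sigma> s (fst (snd p))) ` ?Y p) \<le> (\<Sum>p\<in>P. card ((\<lambda>s. \<sigma> s (fst (snd p))) ` ?Y p))"
      by (rule card_UN_le[OF f(1)])
    also have "\<dots> \<le> (\<Sum>p\<in>P. card (?Y p))" using finY by (intro sum_mono card_image_le)
    finally have "real (card bad) \<le> real (card ({1..n} - tile_union \<sigma> P)) + (\<Sum>p\<in>P. real (card (?Y p)))"
      by (simp flip: of_nat_sum of_nat_add)
    also have "(\<Sum>p\<in>P. real (card (?Y p))) \<le> (\<Sum>p\<in>P. 2 * \<kappa> * real (card (fst p)))"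
    proof (rule sum_mono)
      fix p assume "p \<in> P"
      then obtain T b S where p: "p = (T, b, S)" "(T, b, S) \<in> P" by (metis surj_pair)
      note S' = S[OF p(2)]
      have T: "finite T" "T \<subseteq> carrier G" "real (card ((F <#>\<^bsub>G\<^esub> T) - T)) \<le> \<kappa> * real (card T)"
        using \<T>(2)[OF S'(5)] by auto
      \<comment> \<open>Leaving \<open>S\<close> means leaving \<open>T\<close> or landing in
        \<open>T - S\<close>; each happens at most \<open>\<kappa> * card T\<close> times, by
        invariance and by the trimming bound.\<close>
      have "card (?Y p) \<le> card (((F <#>\<^bsub>G\<^esub> T) - T) \<union> (T - S))"
      proof (rule card_inj_on_le)
        show "inj_on (\<lambda>s. g \<otimes> s) (?Y p)"
          using S'(3) gG by (auto intro!: inj_onI simp: p subset_iff)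
        show "(\<lambda>s. g \<otimes> s) ` ?Y p \<subseteq> ((F <#>\<^bsub>G\<^esub> T) - T) \<union> (T - S)"
          using S'(4) g by (auto simp: p set_mult_def)
        show "finite (((F <#>\<^bsub>G\<^esub> T) - T) \<union> (T - S))" using F T by (simp add: finite_set_mult)
      qed
      also have "\<dots> \<le> card ((F <#>\<^bsub>G\<^esub> T) - T) + card (T - S)" by (rule card_Un_le)
      also have "card (T - S) = card T - card S" using S'(1,4) by (simp add: card_Diff_subset)
      finally have "real (card (?Y p)) \<le> real (card ((F <#>\<^bsub>G\<^esub> T) - T)) + (real (card T) - real (card S))"
        using card_mono[OF T(1) S'(4)] by linarith
      also have "\<dots> \<le> 2 * \<kappa> * real (card T)" using T(3) f(5)[OF p(2)] by (simp add: algebra_simps)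
      finally show "real (card (?Y p)) \<le> 2 * \<kappa> * real (card (fst p))" by (simp add: p)
    qed
    also have "\<dots> = 2 * \<kappa> * (\<Sum>(T, c, S)\<in>P. real (card T))" by (simp add: sum_distrib_left case_prod_beta)
    also have "\<dots> \<le> 2 * \<kappa> * (2 * real n)"
    proof (rule mult_left_mono)
      let ?s = "\<Sum>(T, c, S)\<in>P. real (card T)"
      have "0 \<le> ?s" by (intro sum_nonneg) auto
      then have "1/2 * ?s \<le> (1 - \<kappa>) * ?s" using \<kappa> by (intro mult_right_mono) auto
      also have "\<dots> \<le> real (card {1..n})" by (rule sum_tile_card_le[OF act P]) (use \<T>(2) in auto)
      finally show "?s \<le> 2 * real n" by simp
    qed (use \<kappa> in simp)
    \<comment> \<open>The 5 is 1 for the uncovered points plus \<open>2 * 2\<close>: boundary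
      proportion \<open>2 * \<kappa>\<close>, and total tile size at most
      \<open>2 * n\<close>.\<close>
    finally have badle: "real (card bad) \<le> 5 * \<kappa> * real n" using rest by simp
    have in_n: "\<sigma> g b \<in> {1..n}" if "b \<in> {1..n}" for b using permutes_in_image[OF perm[OF g]] that by blast
    have "(\<Sum>b\<in>{1..n}. (?r b)\<^sup>2) = (\<Sum>b\<in>bad. (?r b)\<^sup>2)"
      by (rule sum.mono_neutral_right) (auto simp: bad_def)
    also have "\<dots> \<le> (\<Sum>b\<in>bad. M\<^sup>2)"
    proof (intro sum_mono power_mono)
      fix b assume "b \<in> bad"
      then have b: "b \<in> {1..n}" by (simp add: bad_def)
      show "?r b \<le> M" "0 \<le> ?r b"
        using M(1) \<phi>X[OF \<omega> b] \<phi>X[OF \<omega> in_n[OF b]] gG by auto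
    qed
    also have "\<dots> = real (card bad) * M\<^sup>2" by simp
    also have "\<dots> \<le> 5 * \<kappa> * real n * M\<^sup>2" using badle by (intro mult_right_mono) auto
    also have "\<dots> = (M\<^sup>2 * (5 * \<kappa>)) * real n" by (simp add: algebra_simps)
    also have "\<dots> \<le> \<delta>\<^sup>2 * real n" using M(2) by (intro mult_right_mono) auto
    finally have "1 / real n * (\<Sum>b\<in>{1..n}. (?r b)\<^sup>2) \<le> \<delta>\<^sup>2" using n by (simp add: field_simps)
    then have "sqrt (1 / real n * (\<Sum>b\<in>{1..n}. (?r b)\<^sup>2)) \<le> \<delta>"
      using \<delta> by (intro real_le_lsqrt) auto
    then show "rho2 \<rho> n (\<phi> \<omega> \<circ> \<sigma> g) (\<alpha> g \<circ> \<phi> \<omega>) \<le> \<delta>" by (simp add: rho2_def)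
  qed
  have card: "real (card (\<phi> ` \<Omega>)) = (\<Prod>p\<in>P. real (card (E p)))"
    unfolding card_image[OF inj] unfolding \<Omega>_def using f(1) by (simp add: card_PiE)
  have cov1: "0 < cov_num (3 * \<epsilon>) (snd (snd p))" if "p \<in> P" for p
    using cov_num_pos[OF S(1-3)[of "fst p" "fst (snd p)" "snd (snd p)"] \<epsilon>3] that by simp
  have Epos: "cov_num (3 * \<epsilon>) (snd (snd p)) \<le> card (E p)" "0 < card (E p)" if "p \<in> P" for p
    using E[rule_format, OF that] less_le_trans[OF cov1[OF that]] by auto
  have "(\<Sum>(T, c, S)\<in>P. cov_log (3 * \<epsilon>) S) = (\<Sum>p\<in>P. ln (real (cov_num (3 * \<epsilon>) (snd (snd p)))))"
    using S(2) by (intro sum.cong) (auto simp: cov_log_def)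
  also have "\<dots> \<le> (\<Sum>p\<in>P. ln (real (card (E p))))"
  proof (rule sum_mono)
    fix p assume "p \<in> P"
    then show "ln (real (cov_num (3 * \<epsilon>) (snd (snd p)))) \<le> ln (real (card (E p)))"
      using Epos[of p] cov1[of p] by simp
  qed
  also have "\<dots> = ln (real (card (\<phi> ` \<Omega>)))"
    unfolding card using f(1) Epos by (subst ln_prod) auto
  finally have "(\<Sum>(T, c, S)\<in>P. cov_log (3 * \<epsilon>) S) \<le> ln (real (card (\<phi> ` \<Omega>)))" .
  moreover have "finite \<Omega>" unfolding \<Omega>_def using f(1) E by (intro finite_PiE) auto
  moreover have "\<Omega> \<noteq> {}" unfolding \<Omega>_def PiE_eq_empty_iff using Epos(2) by force
  moreover have "separated_set (rho_inf \<rho> n) \<epsilon> (\<phi> ` \<Omega>)" using sep by (auto simp: separated_set_def)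
  ultimately show ?thesis using map by (intro exI[of _ "\<phi> ` \<Omega>"]) auto
qed

text \<open>The tiles have density at least \<open>s - \<kappa>\<close>, trimming costs
  \<open>cov_log (3 * \<epsilon>) {\<one>} * \<kappa>\<close> per point, and the tiles reach the
  proportion \<open>1 - \<kappa>\<close> of \<open>{1..n}\<close>.\<close>

lemma density_le_sofic_h_loc:
  assumes sofic: "sofic_approximation G d \<sigma>" and \<epsilon>: "0 < \<epsilon>" and F: "finite F" "F \<subseteq> carrier G" and \<delta>: "0 < \<delta>"
    and s: "((\<lambda>T. cov_log (3 * \<epsilon>) T / real (card T)) \<longlongrightarrow> s) (left_invariance G)"
    and \<kappa>: "0 < \<kappa>" "\<kappa> \<le> 1/2"
    and M: "\<And>x y. \<lbrakk>x \<in> topspace X; y \<in> topspace X\<rbrakk> \<Longrightarrow> \<rho> x y \<le> M" "M\<^sup>2 * (5 * \<kappa>) \<le> \<delta>\<^sup>2"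
  shows "ereal ((1 - \<kappa>) * (s - \<kappa> - cov_log (3 * \<epsilon>) {\<one>} * \<kappa>)) \<le> sofic_h_loc X \<alpha> d \<sigma> \<epsilon> \<rho> F \<delta>"
proof -
  have \<epsilon>3: "0 < 3 * \<epsilon>" using \<epsilon> by simp
  interpret c: subadditive_set_function G "cov_log (3 * \<epsilon>)" by (rule cov_log_subadditive[OF \<epsilon>3])
  let ?Q = "\<lambda>T. T \<in> left_invariant_sets G F \<kappa> \<and> (s - \<kappa>) * real (card T) \<le> cov_log (3 * \<epsilon>) T"
  have "eventually (\<lambda>T. s - \<kappa> < cov_log (3 * \<epsilon>) T / real (card T)) (left_invariance G)"
    using \<kappa> by (intro order_tendstoD(1)[OF s]) auto
  with c.eventually_left_invariant_sets[OF F \<kappa>(1)]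
  have "eventually ?Q (left_invariance G)"
    by eventually_elim (auto simp: left_invariant_sets_def less_divide_eq card_gt_0_iff)
  then have freq: "frequently ?Q (left_invariance G)"
    by (rule eventually_frequently[OF c.left_invariance_neq_bot])
  obtain \<T> \<beta> where \<T>: "finite \<T>" "0 < \<beta>" "\<Union>\<T> \<noteq> {}"
    "\<And>T. T \<in> \<T> \<Longrightarrow> finite T \<and> T \<noteq> {} \<and> T \<subseteq> carrier G \<and> ?Q T"
    "\<And>(D::nat set) B \<sigma>. partial_action G (\<Union>\<T>) D B \<sigma> \<Longrightarrow> real (card (D - B)) \<le> \<beta> * real (card D) \<Longrightarrow>
       \<exists>P. tile_family \<T> B \<sigma> \<kappa> P \<and> real (card (D - tile_union \<sigma> P)) \<le> \<kappa> * real (card D)"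
    by (rule c.obtain_tiles[OF freq \<kappa> \<kappa>(1)]) (rule that)
  define K where "K = \<Union>\<T>"
  have K: "finite K" "K \<subseteq> carrier G" using \<T>(1,4) by (auto simp: K_def)
  have \<T>': "\<And>T. T \<in> \<T> \<Longrightarrow> T \<subseteq> K \<and> finite T" using \<T>(4) by (auto simp: K_def)
  define c0 where "c0 = cov_log (3 * \<epsilon>) {\<one>}"
  have c0: "0 \<le> c0" by (simp add: c0_def c.nonneg)
  \<comment> \<open>\<open>F\<close> is included because \<open>\<sigma> g (\<sigma> t b)\<close>
    has to be rewritten for \<open>g\<close> in \<open>F\<close>.\<close>
  define L where "L = K \<union> m_inv G ` K \<union> {\<one>} \<union> F"
  have L: "finite L" "L \<subseteq> carrier G" "\<one> \<in> L" "K \<subseteq> L" "m_inv G ` K \<subseteq> L" "F \<subseteq> L"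
    using K F by (auto simp: L_def)
  show ?thesis
    unfolding sofic_h_loc_def c0_def[symmetric]
  proof (rule le_Limsup, simp, rule eventually_mono[OF eventually_good_points[OF is_group sofic L(1,2) \<T>(2)]])
    fix i
    assume i: "0 < d i \<and> real (card ({1..d i} - good_points G L (d i) (\<sigma> i))) \<le> \<beta> * real (d i)"
    define n where "n = d i"
    define B where "B = good_points G L n (\<sigma> i)"
    have n: "0 < n" using i by (simp add: n_def)
    have perm: "\<sigma> i s permutes {1..n}" if "s \<in> carrier G" for s
      using sofic that by (simp add: sofic_approximation_def n_def)
    have act: "partial_action G K {1..n} B (\<sigma> i)"
      unfolding B_def by (rule good_points_partial_action[OF is_group perm L(2-5)])
    obtain P where P: "tile_family \<T> B (\<sigma> i) \<kappa> P"
      and rest: "real (card ({1..n} - tile_union (\<sigma> i) P)) \<le> \<kappa> * real n"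
      using \<T>(5)[of "{1..n}" B "\<sigma> i"] act i by (auto simp: K_def B_def n_def)
    note f = tile_familyD[OF P]
    have tile: "finite S" "S \<subseteq> carrier G" "finite T" "T \<subseteq> carrier G" "T \<in> \<T>" if "(T, b, S) \<in> P" for T b S
      using f(2,4)[OF that] \<T>(4) by (auto intro: finite_subset)
    have "\<exists>Z. Z \<subseteq> Map_space X \<alpha> \<rho> F \<delta> n (\<sigma> i) \<and> finite Z \<and> Z \<noteq> {} \<and> separated_set (rho_inf \<rho> n) \<epsilon> Z \<and>
      (\<Sum>(T, c, S)\<in>P. cov_log (3 * \<epsilon>) S) \<le> ln (real (card Z))"
    proof (rule exists_separated_maps[OF n _ P \<T>(1) _ F _ _ rest \<kappa> \<epsilon> \<delta> M])
      show "partial_action G (\<Union>\<T>) {1..n} B (\<sigma> i)" using act by (simp add: K_def)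
      show "finite T \<and> T \<noteq> {} \<and> T \<subseteq> carrier G \<and> real (card ((F <#>\<^bsub>G\<^esub> T) - T)) \<le> \<kappa> * real (card T)"
        if "T \<in> \<T>" for T using \<T>(4)[OF that] by (simp add: left_invariant_sets_def)
      show "\<sigma> i g (\<sigma> i t b) = \<sigma> i (g \<otimes> t) b" if "g \<in> F" "t \<in> \<Union>\<T>" "b \<in> B" for g t b
        using that L(4,6) by (auto simp: B_def good_points_def K_def)
      show "\<sigma> i g permutes {1..n}" if "g \<in> F" for g using that F perm by auto
    qed
    then obtain Z where Z: "Z \<subseteq> Map_space X \<alpha> \<rho> F \<delta> n (\<sigma> i)" "finite Z" "Z \<noteq> {}"
      "separated_set (rho_inf \<rho> n) \<epsilon> Z" "(\<Sum>(T, c, S)\<in>P. cov_log (3 * \<epsilon>) S) \<le> ln (real (card Z))"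
      by blast
    define m where "m = s - \<kappa> - c0 * \<kappa>"
    have trimmed: "m * real (card T) \<le> cov_log (3 * \<epsilon>) S" if p: "(T, b, S) \<in> P" for T b S
    proof -
      have "(s - \<kappa>) * real (card T) \<le> cov_log (3 * \<epsilon>) T" using \<T>(4)[OF tile(5)[OF p]] by simp
      also have "\<dots> = cov_log (3 * \<epsilon>) (S \<union> (T - S))"
        using f(4)[OF p] by (simp add: Un_absorb1)
      also have "\<dots> \<le> cov_log (3 * \<epsilon>) S + cov_log (3 * \<epsilon>) (T - S)"
        using tile[OF p] by (intro c.subadd) auto
      also have "cov_log (3 * \<epsilon>) (T - S) \<le> c0 * real (card (T - S))"
        unfolding c0_def using tile[OF p] by (intro c.le_card) auto
      also have "\<dots> \<le> c0 * (\<kappa> * real (card T))"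
      proof (rule mult_left_mono[OF _ c0])
        have "real (card (T - S)) = real (card T) - real (card S)"
          using f(4)[OF p] tile[OF p] card_mono[of T S] by (simp add: card_Diff_subset of_nat_diff)
        then show "real (card (T - S)) \<le> \<kappa> * real (card T)" using f(5)[OF p] by (simp add: algebra_simps)
      qed
      finally show ?thesis by (simp add: m_def algebra_simps)
    qed
    have "(1 - \<kappa>) * m * real n \<le> (\<Sum>(T, c, S)\<in>P. cov_log (3 * \<epsilon>) S)"
    \<comment> \<open>The lower bound for the total tile size can be multiplied only by a
      nonnegative \<open>m\<close>; for negative \<open>m\<close> the claim follows from
      \<open>cov_log\<close> being nonnegative.\<close>
    proof (cases "0 \<le> m")
      case True
      have "real n = real (card ({1..n} - tile_union (\<sigma> i) P)) + real (card (tile_union (\<sigma> i) P))"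
        using card_tile_union(1)[OF act P \<T>'] card_mono[OF _ card_tile_union(1)[OF act P \<T>']]
        by (simp add: card_Diff_subset finite_subset of_nat_diff)
      with rest have "(1 - \<kappa>) * real n \<le> real (card (tile_union (\<sigma> i) P))" by (simp add: algebra_simps)
      also have "\<dots> = (\<Sum>(T, c, S)\<in>P. real (card S))"
        by (simp add: card_tile_union(2)[OF act P \<T>'] case_prod_beta)
      also have "\<dots> \<le> (\<Sum>(T, c, S)\<in>P. real (card T))"
      proof (rule sum_mono, clarify)
        show "real (card S) \<le> real (card T)" if "(T, b, S) \<in> P" for T b S
          using card_mono[OF tile(3)[OF that] f(4)[OF that]] by simp
      qed
      finally have "m * ((1 - \<kappa>) * real n) \<le> m * (\<Sum>(T, c, S)\<in>P. real (card T))"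
        using True by (rule mult_left_mono)
      also have "\<dots> = (\<Sum>(T, c, S)\<in>P. m * real (card T))" by (simp add: sum_distrib_left case_prod_beta)
      also have "\<dots> \<le> (\<Sum>(T, c, S)\<in>P. cov_log (3 * \<epsilon>) S)" using trimmed by (intro sum_mono) auto
      finally show ?thesis by (simp add: algebra_simps)
    next
      case False
      then have "(1 - \<kappa>) * m * real n \<le> 0" using \<kappa> by (intro mult_nonpos_nonneg mult_nonneg_nonpos) auto
      also have "0 \<le> (\<Sum>(T, c, S)\<in>P. cov_log (3 * \<epsilon>) S)"
      proof (rule sum_nonneg, clarify)
        show "0 \<le> cov_log (3 * \<epsilon>) S" if "(T, b, S) \<in> P" for T b S
          using c.nonneg[OF tile(1,2)[OF that]] .
      qed
      finally show ?thesis .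
    qed
    then have "ereal ((1 - \<kappa>) * m * real n) \<le> ereal (ln (real (card Z)))" using Z(5) by simp
    also have "\<dots> \<le> log_card (sep_number (Map_space X \<alpha> \<rho> F \<delta> n (\<sigma> i)) (rho_inf \<rho> n) \<epsilon>)"
      by (rule log_card_sep_number_ge[OF Z(1-4)])
    finally have "ereal ((1 - \<kappa>) * m * real n) / ereal (real n) \<le>
        log_card (sep_number (Map_space X \<alpha> \<rho> F \<delta> n (\<sigma> i)) (rho_inf \<rho> n) \<epsilon>) / ereal (real n)"
      using n by (intro ereal_divide_right_mono) auto
    moreover have "ereal ((1 - \<kappa>) * m * real n) / ereal (real n) = ereal ((1 - \<kappa>) * m)" using n by simp
    ultimately show "ereal ((1 - \<kappa>) * (s - \<kappa> - c0 * \<kappa>)) \<le>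
        log_card (sep_number (Map_space X \<alpha> \<rho> F \<delta> (d i) (\<sigma> i)) (rho_inf \<rho> (d i)) \<epsilon>) / ereal (real (d i))"
      by (simp add: n_def m_def)
  qed
qed

text \<open>For given \<open>F\<close> and \<open>\<delta>\<close> the constraint
  \<open>M\<^sup>2 * (5 * \<kappa>) \<le> \<delta>\<^sup>2\<close> holds for all small
  \<open>\<kappa>\<close>, so \<open>\<kappa>\<close> may tend to 0 before the infimum is
  taken.\<close>

lemma S_cover_le_sofic_h:
  assumes sofic: "sofic_approximation G d \<sigma>" and \<epsilon>: "0 < \<epsilon>"
  shows "S_cover G X \<alpha> (3 * \<epsilon>) \<rho> \<le> sofic_h G X \<alpha> d \<sigma> \<epsilon> \<rho>"
proof -
  have \<epsilon>3: "0 < 3 * \<epsilon>" using \<epsilon> by simp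
  interpret c: subadditive_set_function G "cov_log (3 * \<epsilon>)" by (rule cov_log_subadditive[OF \<epsilon>3])
  obtain s where s: "0 \<le> s" "S_cover G X \<alpha> (3 * \<epsilon>) \<rho> = ereal s"
    "((\<lambda>F. cov_log (3 * \<epsilon>) F / real (card F)) \<longlongrightarrow> s) (left_invariance G)"
    by (rule S_cover_eq_limit[OF \<epsilon>3])
  obtain M where M: "0 < M" "\<And>x y. \<lbrakk>x \<in> topspace X; y \<in> topspace X\<rbrakk> \<Longrightarrow> \<rho> x y \<le> M"
    by (rule rho_bounded) (rule that)
  have "ereal s \<le> sofic_h_loc X \<alpha> d \<sigma> \<epsilon> \<rho> F \<delta>" if F: "finite F" "F \<subseteq> carrier G" and \<delta>: "0 < \<delta>" for F \<delta>
  proof -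
    have "((\<lambda>\<kappa>. M\<^sup>2 * (5 * \<kappa>)) \<longlongrightarrow> M\<^sup>2 * (5 * 0)) (at_right 0)" by (intro tendsto_intros)
    then have "eventually (\<lambda>\<kappa>. M\<^sup>2 * (5 * \<kappa>) < \<delta>\<^sup>2) (at_right 0)" using \<delta> by (intro order_tendstoD(2)) auto
    with small_parameter have "eventually (\<lambda>\<kappa>. ereal ((1 - \<kappa>) * (s - \<kappa> - cov_log (3 * \<epsilon>) {\<one>} * \<kappa>))
        \<le> sofic_h_loc X \<alpha> d \<sigma> \<epsilon> \<rho> F \<delta>) (at_right 0)"
      by eventually_elim (rule density_le_sofic_h_loc[OF sofic \<epsilon> F \<delta> s(3) _ _ M(2)], auto)
    moreover have "((\<lambda>\<kappa>. (1 - \<kappa>) * (s - \<kappa> - cov_log (3 * \<epsilon>) {\<one>} * \<kappa>)) \<longlongrightarrow>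
        (1 - 0) * (s - 0 - cov_log (3 * \<epsilon>) {\<one>} * 0)) (at_right 0)"
      by (intro tendsto_intros)
    ultimately show ?thesis
      using tendsto_upperbound[OF tendsto_ereal] by fastforce
  qed
  then show ?thesis unfolding s(2) sofic_h_def by (intro INF_greatest) auto
qed

end

section \<open>Comparison of the mean dimensions\<close>

text \<open>Multiplication by \<open>a\<close> is a bijection that maps the filter of right
  neighbourhoods of 0 to itself.\<close>

lemma Liminf_scale:
  fixes a :: real and f :: "real \<Rightarrow> 'b::complete_lattice"
  assumes "0 < a"
  shows "Liminf (at_right 0) (\<lambda>x. f (a * x)) = Liminf (at_right 0) f"
proof -
  have "Liminf (at_right 0) f = Liminf (filtermap (times a) (at_right 0)) f"
    using filtermap_times_pos_at_right[OF assms, of 0] by simp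
  then show ?thesis using assms by (simp add: Liminf_filtermap_eq inj_on_def)
qed

text \<open>The quotient of \<open>ln (a * \<epsilon>)\<close> and \<open>ln \<epsilon>\<close>
  tends to 1, so a change of scale costs at most a factor \<open>c\<close> for every
  \<open>c > 1\<close>; then \<open>c\<close> tends to 1.\<close>

lemma Liminf_log_scale_le:
  fixes f g :: "real \<Rightarrow> ereal"
  assumes a: "0 < a" and le: "\<And>\<epsilon>. 0 < \<epsilon> \<Longrightarrow> f (a * \<epsilon>) \<le> g \<epsilon>" and g: "\<And>\<epsilon>. 0 < \<epsilon> \<Longrightarrow> 0 \<le> g \<epsilon>"
  shows "Liminf (at_right 0) (\<lambda>\<epsilon>. f \<epsilon> / ereal \<bar>ln \<epsilon>\<bar>) \<le> Liminf (at_right 0) (\<lambda>\<epsilon>. g \<epsilon> / ereal \<bar>ln \<epsilon>\<bar>)"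
    (is "?A \<le> ?B")
proof -
  have step: "?A \<le> ereal c * ?B" if c: "1 < c" for c
  proof -
    have small: "eventually (\<lambda>\<epsilon>::real. ln \<epsilon> < b) (at_right 0)" for b
      using ln_at_0 by (simp add: filterlim_at_bot_dense)
    have "eventually (\<lambda>\<epsilon>::real. 0 < \<epsilon>) (at_right 0)" by (simp add: eventually_at_right_less)
    \<comment> \<open>The three thresholds make \<open>ln \<epsilon>\<close> negative,
      \<open>ln (a * \<epsilon>)\<close> negative, and \<open>\<bar>ln \<epsilon>\<bar> \<le> c *
      \<bar>ln (a * \<epsilon>)\<bar>\<close>.\<close>
    with small[of 0] small[of "- ln a"] small[of "- c * ln a / (c - 1)"]
    have "eventually (\<lambda>\<epsilon>. f (a * \<epsilon>) / ereal \<bar>ln (a * \<epsilon>)\<bar> \<le> ereal c * (g \<epsilon> / ereal \<bar>ln \<epsilon>\<bar>)) (at_right 0)"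
    proof eventually_elim
      case (elim \<epsilon>)
      have ln: "ln (a * \<epsilon>) = ln a + ln \<epsilon>" using a elim by (simp add: ln_mult_pos)
      have pos: "0 < \<bar>ln (a * \<epsilon>)\<bar>" "0 < \<bar>ln \<epsilon>\<bar>" using elim ln by auto
      have "ln \<epsilon> * (c - 1) < - c * ln a"
        using elim(3) c pos_less_divide_eq[of "c - 1" "ln \<epsilon>" "- c * ln a"] by linarith
      then have ratio: "\<bar>ln \<epsilon>\<bar> \<le> c * \<bar>ln (a * \<epsilon>)\<bar>" using elim ln by (simp add: algebra_simps)
      have "f (a * \<epsilon>) / ereal \<bar>ln (a * \<epsilon>)\<bar> \<le> g \<epsilon> / ereal \<bar>ln (a * \<epsilon>)\<bar>"
        using le elim pos by (intro ereal_divide_right_mono) auto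
      also have "\<dots> \<le> ereal c * (g \<epsilon> / ereal \<bar>ln \<epsilon>\<bar>)"
      proof (cases "g \<epsilon>")
        case (real r)
        then have "0 \<le> r" using g[of \<epsilon>] elim by simp
        then have "r * \<bar>ln \<epsilon>\<bar> \<le> r * (c * \<bar>ln (a * \<epsilon>)\<bar>)" using ratio by (rule mult_left_mono[rotated])
        then have "r / \<bar>ln (a * \<epsilon>)\<bar> \<le> c * (r / \<bar>ln \<epsilon>\<bar>)" using pos by (simp add: field_simps)
        then show ?thesis using real pos by simp
      next
        case PInf
        then show ?thesis using pos c by simp
      next
        case MInf
        then show ?thesis using g[of \<epsilon>] elim by simp
      qed
      finally show ?case .
    qed
    then have "Liminf (at_right 0) (\<lambda>\<epsilon>. f (a * \<epsilon>) / ereal \<bar>ln (a * \<epsilon>)\<bar>) \<le>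
        Liminf (at_right 0) (\<lambda>\<epsilon>. ereal c * (g \<epsilon> / ereal \<bar>ln \<epsilon>\<bar>))"
      by (rule Liminf_mono)
    also have "\<dots> = ereal c * ?B" using c by (intro Liminf_ereal_mult_left) auto
    finally show ?thesis using Liminf_scale[OF a, of "\<lambda>\<epsilon>. f \<epsilon> / ereal \<bar>ln \<epsilon>\<bar>"] by simp
  qed
  have "eventually (\<lambda>\<epsilon>::real. ln \<epsilon> < 0 \<and> 0 < \<epsilon>) (at_right 0)"
    by (rule eventually_at_rightI[of 0 1]) auto
  then have "eventually (\<lambda>\<epsilon>. 0 \<le> g \<epsilon> / ereal \<bar>ln \<epsilon>\<bar>) (at_right 0)"
    by eventually_elim (auto intro!: zero_le_divide_ereal g)
  then have "0 \<le> ?B" by (rule Liminf_bounded)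
  then consider b where "?B = ereal b" | "?B = \<infinity>" by (cases ?B) auto
  then show ?thesis
  proof cases
    case 1
    have "((\<lambda>c. c * b) \<longlongrightarrow> 1 * b) (at_right 1)" by (intro tendsto_intros)
    moreover have "eventually (\<lambda>c. ?A \<le> ereal (c * b)) (at_right 1)"
      using eventually_at_right_less[of 1] by eventually_elim (use step 1 in simp)
    ultimately have "?A \<le> ereal (1 * b)"
      by (intro tendsto_lowerbound[OF tendsto_ereal]) auto
    then show ?thesis by (simp add: 1)
  qed simp
qed

lemma compatible_metric_imp_continuous_pseudometric:
  assumes "compatible_metric X \<rho>"
  shows "continuous_pseudometric X \<rho>"
proof -
  interpret Metric_space "topspace X" \<rho> using assms by (simp add: compatible_metric_def)
  have top: "mtopology = X" using assms by (simp add: compatible_metric_def)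
  have "continuous_map (prod_topology X X) euclideanreal (\<lambda>(x, y). \<rho> x y)"
    using continuous_map_metric[of Self] by (simp add: mtopology_of_def top)
  then show ?thesis
    unfolding continuous_pseudometric_def using commute triangle by simp
qed

text \<open>A nonempty \<open>{1..d i}\<close> has no map into the empty space, and
  \<open>d i\<close> is eventually positive.\<close>

lemma sofic_h_trivial:
  assumes G: "group G" and sofic: "sofic_approximation G d \<sigma>" and X: "topspace X = {}"
  shows "sofic_h G X \<alpha> d \<sigma> \<epsilon> \<rho> = -\<infinity>"
proof -
  interpret group G by fact
  have dpos: "eventually (\<lambda>i. 0 < d i) sequentially"
    using eventually_good_points[OF G sofic, of "{}" 1] by (auto elim: eventually_mono)
  have "sofic_h_loc X \<alpha> d \<sigma> \<epsilon> \<rho> {\<one>\<^bsub>G\<^esub>} 1 \<le> -\<infinity>"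
    unfolding sofic_h_loc_def
  proof (rule Limsup_bounded, rule eventually_mono[OF dpos])
    fix i assume i: "0 < d i"
    then have "{1..d i} \<rightarrow>\<^sub>E topspace X = {}" unfolding X by (intro PiE_eq_empty_iff[THEN iffD2]) force
    then have "Map_space X \<alpha> \<rho> {\<one>\<^bsub>G\<^esub>} 1 (d i) (\<sigma> i) = {}" by (auto simp: Map_space_def)
    then have "sep_number (Map_space X \<alpha> \<rho> {\<one>\<^bsub>G\<^esub>} 1 (d i) (\<sigma> i)) (rho_inf \<rho> (d i)) \<epsilon> \<le> enat 0"
      unfolding sep_number_def by (intro SUP_least) auto
    then have "log_card (sep_number (Map_space X \<alpha> \<rho> {\<one>\<^bsub>G\<^esub>} 1 (d i) (\<sigma> i)) (rho_inf \<rho> (d i)) \<epsilon>) \<le> log_card (enat 0)"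
      by (rule log_card_mono)
    then show "log_card (sep_number (Map_space X \<alpha> \<rho> {\<one>\<^bsub>G\<^esub>} 1 (d i) (\<sigma> i)) (rho_inf \<rho> (d i)) \<epsilon>) /
        ereal (real (d i)) \<le> -\<infinity>"
      using i by (simp add: log_card_def)
  qed
  moreover have "sofic_h G X \<alpha> d \<sigma> \<epsilon> \<rho> \<le> sofic_h_loc X \<alpha> d \<sigma> \<epsilon> \<rho> {\<one>\<^bsub>G\<^esub>} 1"
    unfolding sofic_h_def by (intro INF_lower2[of "{\<one>\<^bsub>G\<^esub>}"] INF_lower) auto
  ultimately show ?thesis by simp
qed

text \<open>The empty cover has mesh 0, so every covering number is 0 and its logarithm
  -infinity.\<close>

lemma S_cover_trivial:
  fixes X :: "'a topology"
  assumes G: "amenable_group G" and X: "topspace X = {}" and \<epsilon>: "0 < \<epsilon>"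
  shows "S_cover G X \<alpha> \<epsilon> \<rho> = -\<infinity>"
proof -
  \<comment> \<open>The zero function gives access to the facts about the filter.\<close>
  interpret c: subadditive_set_function G "\<lambda>_. 0" by (rule subadditive_set_function.intro) (simp_all add: G)
  have "min_cover X \<rho>' \<epsilon> = 0" for \<rho>'
  proof -
    have "finite_open_cover X {} \<and> mesh {} \<rho>' < \<epsilon> \<and> card ({} :: 'a set set) = 0"
      using X \<epsilon> by (simp add: finite_open_cover_def mesh_def)
    then have "min_cover X \<rho>' \<epsilon> \<le> 0"
      unfolding min_cover_def by (intro Least_le[of _ 0] exI[of _ "{}"])
    then show ?thesis by simp
  qed
  then have cover: "log_card (enat (min_cover X \<rho>' \<epsilon>)) = -\<infinity>" for \<rho>' by (simp add: log_card_def)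
  have "eventually (\<lambda>F. F \<in> left_invariant_sets G {} 1) (left_invariance G)"
    by (rule c.eventually_left_invariant_sets) auto
  then have "eventually (\<lambda>F. -\<infinity> =
      log_card (enat (min_cover X (rho_set \<alpha> \<rho> F) \<epsilon>)) / ereal (real (card F))) (left_invariance G)"
    by eventually_elim (auto simp: cover left_invariant_sets_def card_gt_0_iff)
  then have "((\<lambda>F. log_card (enat (min_cover X (rho_set \<alpha> \<rho> F) \<epsilon>)) / ereal (real (card F))) \<longlongrightarrow> -\<infinity>) (left_invariance G)"
    by (rule Lim_transform_eventually[OF tendsto_const])
  then show ?thesis
    unfolding S_cover_def by (intro tendsto_Lim c.left_invariance_neq_bot)
qed

lemma sofic_mdim_metric_eq:
  assumes G: "amenable_group G" and X: "compact_space X" and \<alpha>: "continuous_action G X \<alpha>"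
    and sofic: "sofic_approximation G d \<sigma>" and \<rho>: "continuous_pseudometric X \<rho>"
  shows "sofic_mdim_metric G X \<alpha> d \<sigma> \<rho> = mdim_metric G X \<alpha> \<rho>"
proof (cases "topspace X = {}")
  case True
  have "group G" using G by (simp add: amenable_group_def)
  then have "sofic_h G X \<alpha> d \<sigma> \<epsilon> \<rho> = S_cover G X \<alpha> \<epsilon> \<rho>" if "0 < \<epsilon>" for \<epsilon>
    using sofic_h_trivial[OF _ sofic True] S_cover_trivial[OF G True that] by metis
  then have "eventually (\<lambda>\<epsilon>. sofic_h G X \<alpha> d \<sigma> \<epsilon> \<rho> / ereal \<bar>ln \<epsilon>\<bar> = S_cover G X \<alpha> \<epsilon> \<rho> / ereal \<bar>ln \<epsilon>\<bar>) (at_right 0)"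
    using eventually_at_right_less[of "0::real"] by (auto elim: eventually_mono)
  then show ?thesis unfolding sofic_mdim_metric_def mdim_metric_def by (rule Liminf_eq)
next
  case False
  interpret pseudometric_action G X \<alpha> \<rho>
    by unfold_locales (fact G X \<alpha> \<rho> False)+
  have S: "0 \<le> S_cover G X \<alpha> \<epsilon> \<rho>" if "0 < \<epsilon>" for \<epsilon>
    using S_cover_eq_limit[OF that] by (metis ereal_less_eq(5))
  \<comment> \<open>Almost equivariant maps exist by the lower bound, which rules out the value
    -infinity.\<close>
  have h: "0 \<le> sofic_h G X \<alpha> d \<sigma> \<epsilon> \<rho>" if "0 < \<epsilon>" for \<epsilon>
    using S[of "3 * \<epsilon>"] S_cover_le_sofic_h[OF sofic that] that by (auto intro: order_trans)
  show ?thesis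
    unfolding sofic_mdim_metric_def mdim_metric_def
  proof (rule antisym)
    show "Liminf (at_right 0) (\<lambda>\<epsilon>. sofic_h G X \<alpha> d \<sigma> \<epsilon> \<rho> / ereal \<bar>ln \<epsilon>\<bar>) \<le>
        Liminf (at_right 0) (\<lambda>\<epsilon>. S_cover G X \<alpha> \<epsilon> \<rho> / ereal \<bar>ln \<epsilon>\<bar>)"
      by (rule Liminf_log_scale_le[of 2]) (use S sofic_h_le_S_cover[OF sofic] in auto)
    show "Liminf (at_right 0) (\<lambda>\<epsilon>. S_cover G X \<alpha> \<epsilon> \<rho> / ereal \<bar>ln \<epsilon>\<bar>) \<le>
        Liminf (at_right 0) (\<lambda>\<epsilon>. sofic_h G X \<alpha> d \<sigma> \<epsilon> \<rho> / ereal \<bar>ln \<epsilon>\<bar>)"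
      by (rule Liminf_log_scale_le[of 3]) (use h S_cover_le_sofic_h[OF sofic] in auto)
  qed
qed

theorem theorem5p1:
  fixes G :: "('g, 'm) monoid_scheme"
    and X :: "'x topology"
    and \<alpha> :: "'g \<Rightarrow> 'x \<Rightarrow> 'x"
    and d :: "nat \<Rightarrow> nat"
    and \<sigma> :: "nat \<Rightarrow> 'g \<Rightarrow> nat \<Rightarrow> nat"
  assumes "amenable_group G"
    and "compact_space X" and "metrizable_space X"
    and "continuous_action G X \<alpha>"
    and "sofic_approximation G d \<sigma>"
  shows "(\<forall>\<rho>. continuous_pseudometric X \<rho> \<longrightarrow>
            sofic_mdim_metric G X \<alpha> d \<sigma> \<rho> = mdim_metric G X \<alpha> \<rho>) \<and>
         sofic_mdim G X \<alpha> d \<sigma> = mdim G X \<alpha>"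
proof
  have eq: "sofic_mdim_metric G X \<alpha> d \<sigma> \<rho> = mdim_metric G X \<alpha> \<rho>" if "continuous_pseudometric X \<rho>" for \<rho>
    using sofic_mdim_metric_eq[OF assms(1,2,4,5) that] .
  then show "\<forall>\<rho>. continuous_pseudometric X \<rho> \<longrightarrow>
      sofic_mdim_metric G X \<alpha> d \<sigma> \<rho> = mdim_metric G X \<alpha> \<rho>" by blast
  show "sofic_mdim G X \<alpha> d \<sigma> = mdim G X \<alpha>"
    unfolding sofic_mdim_def mdim_def
    using eq compatible_metric_imp_continuous_pseudometric by (intro INF_cong) auto
qed

end
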